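(* Let $X$ be a complex Hilbert space, $Y$ a Hilbert space, $A_0:\mathcal{D}(A_0)\to X$ a strictly positive self-adjoint operator and $C\in\mathcal{L}(X,Y)$ such that $C^*C\in\mathcal{L}(\mathcal{D}(A_0^2))\cap\mathcal{L}(\mathcal{D}(A_0))$. Assume that the pair $(iA_0,C)$ is exactly observable in time $\tau>0$ and set $\eta:=\|\mathbb{L}_\tau\|_{\mathcal{L}(X)}<1$. Let $(X_h)_{h>0}$ be a family of finite-dimensional subspaces of $\mathcal{D}(A_0^{1/2})$ satisfying the approximation property stated in the context with exponent $\theta>0$. Let $z_0\in\mathcal{D}(A_0^2)$ be the initial value of the system $\dot z(t)=iA_0z(t)$ for $t\ge0$, $z(0)=z_0$, with output $y(t)=Cz(t)$ for $t\in[0,\tau]$, let $y_h\in L^1([0,\tau],Y)$ be an approximation of $y$, set $$N_h=\theta\,\frac{\ln h}{\ln\eta},$$ and let $z_{0,h}=\sum_{0\le n\le N_h}\mathbb{L}_{h,\tau}^{n}\,z_h^-(0)$ (sum over integers $n$). Then there exist $M_\tau>0$ (which may depend on $\tau$ but not on $z_0$ or $h$) and $h^*>0$ such that for all $h\in(0,h^* )$ $$\|z_0-z_{0,h}\|\le M_\tau\left(h^\theta\ln^2h\,\|z_0\|_2+|\ln h|\int_0^\tau\|C^*(y(s)-y_h(s))\|\,ds\right).$$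
   Context: Notation. $\langle\cdot,\cdot\rangle$ and $\|\cdot\|$ are the inner product and norm of $X$; $\|\varphi\|_\alpha=\|A_0^\alpha\varphi\|$ is the norm of $\mathcal{D}(A_0^\alpha)$, and $\langle\varphi,\psi\rangle_{1/2}=\langle A_0^{1/2}\varphi,A_0^{1/2}\psi\rangle$. The dot denotes the time derivative. Exact observability of $(iA_0,C)$ in time $\tau$: there is $k_\tau>0$ such that $\int_0^\tau\|y(t)\|^2dt\ge k_\tau^2\|z_0\|^2$ for all $z_0\in\mathcal{D}(A_0)$, where $y(t)=Cz(t)$, $\dot z=iA_0z$, $z(0)=z_0$. Semigroups. $\mathbb{T}^+$ and $\mathbb{T}^-$ are the $C_0$-semigroups on $X$ generated by $iA_0-C^*C$ and $-iA_0-C^*C$ respectively, and $\mathbb{L}_\tau=\mathbb{T}^-_\tau\mathbb{T}^+_\tau$. Under exact observability in time $\tau$ it is known that $\|\mathbb{L}_\tau\|_{\mathcal{L}(X)}<1$. Galerkin spaces. $X_h\subset\mathcal{D}(A_0^{1/2})$ is endowed with the norm of $X$. $\pi_h$ is the orthogonal projection from $\mathcal{D}(A_0^{1/2})$ (with inner product $\langle\cdot,\cdot\rangle_{1/2}$) onto $X_h$. Approximation property: there exist $M>0$, $\theta>0$, $h^*>0$ such that $\|\pi_h\varphi-\varphi\|\le Mh^\theta\|\varphi\|_{1/2}$ for all $\varphi\in\mathcal{D}(A_0^{1/2})$ and all $h\in(0,h^* )$. Discrete semigroups. For $q_0\in\mathcal{D}(A_0^{1/2})$, $\mathbb{T}^\pm_{h,t}q_0:=q_h(t)$,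 where $q_h:[0,\tau]\to X_h$ is the unique solution of $$\langle\dot q_h(t),\varphi_h\rangle=\pm i\langle q_h(t),\varphi_h\rangle_{1/2}-\langle C^*Cq_h(t),\varphi_h\rangle\quad\forall\varphi_h\in X_h,\qquad q_h(0)=\pi_hq_0$$ (with the corresponding sign), and $\mathbb{L}_{h,\tau}=\mathbb{T}^-_{h,\tau}\mathbb{T}^+_{h,\tau}$. Discrete observers. $z_h^+,z_h^-:[0,\tau]\to X_h$ satisfy, for all $\varphi_h\in X_h$ and $t\in[0,\tau]$, $$\langle\dot z_h^+(t),\varphi_h\rangle=i\langle z_h^+(t),\varphi_h\rangle_{1/2}-\langle C^*Cz_h^+(t),\varphi_h\rangle+\langle C^*y_h(t),\varphi_h\rangle,\quad z_h^+(0)=0,$$ $$\langle\dot z_h^-(t),\varphi_h\rangle=i\langle z_h^-(t),\varphi_h\rangle_{1/2}+\langle C^*Cz_h^-(t),\varphi_h\rangle-\langle C^*y_h(t),\varphi_h\rangle,\quad z_h^-(\tau)=z_h^+(\tau).$$ *)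

theory Defs
  imports "HOL-Analysis.Analysis"
begin

text \<open>
  The inner product is linear in its \<^emph>\<open>first\<close> argument; only with this convention is the Galerkin
  form \<open>i \<langle>q, \<phi>\<rangle>\<^sub>1\<^sub>/\<^sub>2\<close> the weak form of \<open>i A\<^sub>0 q\<close>.  The underlying real Hilbert space (with inner
  product \<open>Re \<langle>x, y\<rangle>\<close>, hence with the same norm) is part of the class, so that the library of
  \<open>real_inner\<close> applies.
\<close>

class complex_inner = real_inner +
  fixes scaleC :: "complex \<Rightarrow> 'a \<Rightarrow> 'a" (infixr "*\<^sub>C" 75)
    and cinner :: "'a \<Rightarrow> 'a \<Rightarrow> complex"
  assumes scaleC_add_right: "c *\<^sub>C (x + y) = c *\<^sub>C x + c *\<^sub>C y"
    and scaleC_add_left: "(c + d) *\<^sub>C x = c *\<^sub>C x + d *\<^sub>C x"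
    and scaleC_scaleC: "c *\<^sub>C d *\<^sub>C x = (c * d) *\<^sub>C x"
    and scaleC_of_real: "complex_of_real r *\<^sub>C x = r *\<^sub>R x"
    and cinner_commute: "cinner x y = cnj (cinner y x)"
    and cinner_add_left: "cinner (x + y) z = cinner x z + cinner y z"
    and cinner_scaleC_left: "cinner (c *\<^sub>C x) y = c * cinner x y"
    and inner_eq_Re_cinner: "inner x y = Re (cinner x y)"

class complex_hilbert = complex_inner + complete_space

global_interpretation complex_vector:
  vector_space "scaleC :: complex \<Rightarrow> 'a \<Rightarrow> 'a::complex_inner"
  using scaleC_of_real[of 1]
  by unfold_locales (simp_all add: scaleC_add_right scaleC_add_left scaleC_scaleC)

instantiation complex :: complex_hilbert
begin

definition scaleC_complex :: "complex \<Rightarrow> complex \<Rightarrow> complex" where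
  "scaleC_complex c x = c * x"

definition cinner_complex :: "complex \<Rightarrow> complex \<Rightarrow> complex" where
  "cinner_complex x y = x * cnj y"

instance
  by standard
    (simp_all add: scaleC_complex_def cinner_complex_def algebra_simps inner_complex_def
      scaleR_conv_of_real)

end

definition bounded_clinear :: "('a::complex_inner \<Rightarrow> 'b::complex_inner) \<Rightarrow> bool" where
  "bounded_clinear f \<longleftrightarrow> bounded_linear f \<and> (\<forall>c x. f (c *\<^sub>C x) = c *\<^sub>C f x)"

definition cadjoint :: "('a::complex_inner \<Rightarrow> 'b::complex_inner) \<Rightarrow> 'b \<Rightarrow> 'a" where
  "cadjoint f y = (THE x. \<forall>u. cinner (f u) y = cinner u x)"

text \<open>
  An unbounded operator \<open>A : D(A) \<rightarrow> X\<close> is a partial function: \<open>dom A\<close> is its domain,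
  \<open>the (A x)\<close> its value at \<open>x \<in> dom A\<close>, and \<open>A \<circ>\<^sub>m A\<close> is \<open>A\<^sup>2\<close> with domain
  \<open>{x \<in> D(A). A x \<in> D(A)}\<close>.
\<close>

type_synonym 'a operator = "'a \<rightharpoonup> 'a"

definition linear_operator :: "'a::complex_inner operator \<Rightarrow> bool" where
  "linear_operator A \<longleftrightarrow>
     complex_vector.subspace (dom A) \<and>
     (\<forall>x\<in>dom A. \<forall>y\<in>dom A. the (A (x + y)) = the (A x) + the (A y)) \<and>
     (\<forall>c. \<forall>x\<in>dom A. the (A (c *\<^sub>C x)) = c *\<^sub>C the (A x))"

text \<open>The last conjunct is the equality of the graphs of \<open>A\<close> and of its adjoint \<open>A\<^sup>*\<close>.\<close>

definition self_adjoint :: "'a::complex_inner operator \<Rightarrow> bool" where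
  "self_adjoint A \<longleftrightarrow>
     linear_operator A \<and> closure (dom A) = UNIV \<and>
     (\<forall>x w. A x = Some w \<longleftrightarrow> (\<forall>u\<in>dom A. cinner (the (A u)) x = cinner u w))"

definition positive_operator :: "'a::complex_inner operator \<Rightarrow> bool" where
  "positive_operator A \<longleftrightarrow> (\<forall>x\<in>dom A. 0 \<le> Re (cinner (the (A x)) x))"

definition strictly_positive :: "'a::complex_inner operator \<Rightarrow> bool" where
  "strictly_positive A \<longleftrightarrow> (\<exists>m>0. \<forall>x\<in>dom A. m * (norm x)\<^sup>2 \<le> Re (cinner (the (A x)) x))"

definition sqrt_operator :: "'a::complex_inner operator \<Rightarrow> 'a operator" where
  "sqrt_operator A = (THE S. self_adjoint S \<and> positive_operator S \<and> S \<circ>\<^sub>m S = A)"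

text \<open>
  \<open>dom_norm A x = \<parallel>A x\<parallel>\<close> for \<open>x \<in> D(A)\<close>; applied to the operators \<open>A\<^sub>0\<^sup>\<alpha>\<close> it is the norm \<open>\<parallel>x\<parallel>\<^sub>\<alpha>\<close>,
  and \<open>bounded_on_dom A\<^sub>0\<^sup>\<alpha> B\<close> says that the linear map \<open>B\<close> restricts to an element of \<open>\<L>(D(A\<^sub>0\<^sup>\<alpha>))\<close>.
\<close>

definition dom_norm :: "'a::complex_inner operator \<Rightarrow> 'a \<Rightarrow> real" where
  "dom_norm A x = norm (the (A x))"

definition bounded_on_dom :: "'a::complex_inner operator \<Rightarrow> ('a \<Rightarrow> 'a) \<Rightarrow> bool" where
  "bounded_on_dom A B \<longleftrightarrow>
     (\<forall>x\<in>dom A. B x \<in> dom A) \<and> (\<exists>K. \<forall>x\<in>dom A. dom_norm A (B x) \<le> K * dom_norm A x)"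

definition cinner_half :: "'a::complex_inner operator \<Rightarrow> 'a \<Rightarrow> 'a \<Rightarrow> complex" where
  "cinner_half A x y = cinner (the (sqrt_operator A x)) (the (sqrt_operator A y))"

definition C0_semigroup :: "(real \<Rightarrow> 'a::complex_inner \<Rightarrow> 'a) \<Rightarrow> bool" where
  "C0_semigroup T \<longleftrightarrow>
     (\<forall>t\<ge>0. bounded_clinear (T t)) \<and> T 0 = id \<and>
     (\<forall>s\<ge>0. \<forall>t\<ge>0. T (s + t) = T s \<circ> T t) \<and>
     (\<forall>x. ((\<lambda>t. T t x) \<longlongrightarrow> x) (at_right 0))"

definition generates :: "'a::complex_inner operator \<Rightarrow> (real \<Rightarrow> 'a \<Rightarrow> 'a) \<Rightarrow> bool" where
  "generates G T \<longleftrightarrow>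
     C0_semigroup T \<and>
     (\<forall>x y. G x = Some y \<longleftrightarrow> ((\<lambda>t. (T t x - x) /\<^sub>R t) \<longlongrightarrow> y) (at_right 0))"

definition damped :: "complex \<Rightarrow> 'a::complex_inner operator \<Rightarrow> ('a \<Rightarrow> 'a) \<Rightarrow> 'a operator" where
  "damped c A B = (\<lambda>x. map_option (\<lambda>y. c *\<^sub>C y - B x) (A x))"

definition conservative_solution ::
    "'a::complex_inner operator \<Rightarrow> 'a \<Rightarrow> (real \<Rightarrow> 'a) \<Rightarrow> bool" where
  "conservative_solution A z0 z \<longleftrightarrow>
     z 0 = z0 \<and>
     (\<forall>t\<ge>0. z t \<in> dom A \<and>
       (z has_vector_derivative (\<i> *\<^sub>C the (A (z t)))) (at t within {0..}))"

definition exactly_observable ::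
    "'a::complex_inner operator \<Rightarrow> ('a \<Rightarrow> 'b::complex_inner) \<Rightarrow> real \<Rightarrow> bool" where
  "exactly_observable A C \<tau> \<longleftrightarrow>
     (\<exists>k>0. \<forall>z0\<in>dom A. \<forall>z. conservative_solution A z0 z \<longrightarrow>
        integral {0..\<tau>} (\<lambda>t. (norm (C (z t)))\<^sup>2) \<ge> k\<^sup>2 * (norm z0)\<^sup>2)"

definition finite_dim_subspace :: "'a::complex_inner set \<Rightarrow> bool" where
  "finite_dim_subspace V \<longleftrightarrow> (\<exists>B. finite B \<and> V = complex_vector.span B)"

definition galerkin_proj :: "'a::complex_inner operator \<Rightarrow> 'a set \<Rightarrow> 'a \<Rightarrow> 'a" where
  "galerkin_proj A V q = (THE p. p \<in> V \<and> (\<forall>\<phi>\<in>V. cinner_half A (q - p) \<phi> = 0))"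

definition approximation_property ::
    "'a::complex_inner operator \<Rightarrow> (real \<Rightarrow> 'a set) \<Rightarrow> real \<Rightarrow> bool" where
  "approximation_property A Xh \<theta> \<longleftrightarrow>
     (\<exists>M>0. \<exists>hs>0. \<forall>\<phi>\<in>dom (sqrt_operator A). \<forall>h\<in>{0<..<hs}.
        norm (galerkin_proj A (Xh h) \<phi> - \<phi>) \<le> M * h powr \<theta> * dom_norm (sqrt_operator A) \<phi>)"

definition discrete_solution ::
    "complex \<Rightarrow> 'a::complex_inner operator \<Rightarrow> ('a \<Rightarrow> 'a) \<Rightarrow> 'a set \<Rightarrow> real \<Rightarrow> 'a \<Rightarrow> (real \<Rightarrow> 'a) \<Rightarrow> bool"
  where
  "discrete_solution c A B V \<tau> q0 q \<longleftrightarrow>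
     q 0 = galerkin_proj A V q0 \<and> (\<forall>t\<in>{0..\<tau>}. q t \<in> V) \<and>
     (\<exists>q'. \<forall>t\<in>{0..\<tau>}. (q has_vector_derivative q' t) (at t within {0..\<tau>}) \<and>
        (\<forall>\<phi>\<in>V. cinner (q' t) \<phi> = c * cinner_half A (q t) \<phi> - cinner (B (q t)) \<phi>))"

text \<open>
  The value at time \<open>t \<in> [0, \<tau>]\<close> of the solution.  (The description ranges over that value rather than
  over \<open>q\<close>, since \<open>q\<close> is unique on \<open>[0, \<tau>]\<close> only.)
\<close>

definition discrete_semigroup ::
    "complex \<Rightarrow> 'a::complex_inner operator \<Rightarrow> ('a \<Rightarrow> 'a) \<Rightarrow> 'a set \<Rightarrow> real \<Rightarrow> real \<Rightarrow> 'a \<Rightarrow> 'a" where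
  "discrete_semigroup c A B V \<tau> t q0 = (THE v. \<exists>q. discrete_solution c A B V \<tau> q0 q \<and> v = q t)"

definition discrete_L ::
    "'a::complex_inner operator \<Rightarrow> ('a \<Rightarrow> 'a) \<Rightarrow> 'a set \<Rightarrow> real \<Rightarrow> 'a \<Rightarrow> 'a" where
  "discrete_L A B V \<tau> =
     discrete_semigroup (- \<i>) A B V \<tau> \<tau> \<circ> discrete_semigroup \<i> A B V \<tau> \<tau>"

text \<open>
  \<open>L\<^sup>1([0, \<tau>], E)\<close> in the sense of Bochner.  It is spelled out because the Bochner integral of the
  library is restricted to second countable spaces, and \<open>E\<close> need not be separable here.
\<close>

definition L1_on :: "real \<Rightarrow> (real \<Rightarrow> 'a::real_normed_vector) \<Rightarrow> bool" where
  "L1_on \<tau> f \<longleftrightarrow>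
     (\<exists>s. (\<forall>n::nat. simple_function (lebesgue_on {0..\<tau>}) (s n)) \<and>
          (AE t in lebesgue_on {0..\<tau>}. (\<lambda>n. s n t) \<longlonglongrightarrow> f t)) \<and>
     (\<lambda>t. norm (f t)) integrable_on {0..\<tau>}"

text \<open>
  \<open>\<langle>z'(t), \<phi>\<rangle> = i \<langle>z(t), \<phi>\<rangle>\<^sub>1\<^sub>/\<^sub>2 + \<sigma> \<langle>C\<^sup>* (y\<^sub>h(t) - C z(t)), \<phi>\<rangle>\<close>, where \<open>\<sigma> = 1\<close> for the forward and
  \<open>\<sigma> = -1\<close> for the backward observer.  Since \<open>y\<^sub>h\<close> is merely \<open>L\<^sup>1\<close>, solutions are understood in
  \<open>W\<^sup>1\<^sup>,\<^sup>1([0, \<tau>], V)\<close>: \<open>z\<close> is the indefinite integral of \<open>z' \<in> L\<^sup>1\<close> and the equation holds for almost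
  every \<open>t\<close>.
\<close>

definition discrete_observer ::
    "real \<Rightarrow> 'a::complex_inner operator \<Rightarrow> ('a \<Rightarrow> 'b::complex_inner) \<Rightarrow> 'a set \<Rightarrow> real \<Rightarrow>
      (real \<Rightarrow> 'b) \<Rightarrow> (real \<Rightarrow> 'a) \<Rightarrow> bool" where
  "discrete_observer \<sigma> A C V \<tau> yh z \<longleftrightarrow>
     (\<forall>t\<in>{0..\<tau>}. z t \<in> V) \<and>
     (\<exists>z'. L1_on \<tau> z' \<and>
       (\<forall>t\<in>{0..\<tau>}. (z' has_integral (z t - z 0)) {0..t}) \<and>
       (AE t in lebesgue_on {0..\<tau>}. z' t \<in> V \<and>
         (\<forall>\<phi>\<in>V. cinner (z' t) \<phi> =
            \<i> * cinner_half A (z t) \<phi>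
            - \<sigma> * cinner (cadjoint C (C (z t))) \<phi>
            + \<sigma> * cinner (cadjoint C (yh t)) \<phi>)))"

end

theory Submission
  imports Defs
begin

text \<open>
  Write \<open>B = C\<^sup>* C\<close>, \<open>L = T\<^sup>-\<^sub>\<tau> T\<^sup>+\<^sub>\<tau>\<close>, \<open>\<pi>\<close> for the Galerkin projection onto \<open>X\<^sub>h\<close> and \<open>L\<^sub>h\<close> for the
  discrete counterpart of \<open>L\<close>.  The observers are built so that their errors solve the damped
  equations; for the exact observers this gives \<open>z\<^sub>0 - z\<^sup>-(0) = L z\<^sub>0\<close>, and for the discrete ones
  \<open>\<pi> z\<^sub>0 - z\<^sub>h\<^sup>-(0) = L\<^sub>h \<pi> z\<^sub>0 + r\<close>, where \<open>r\<close> is a Galerkin consistency error of size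
  \<open>h\<^sup>\<theta> \<parallel>z\<^sub>0\<parallel>\<^sub>2 + \<integral> \<parallel>C\<^sup>* (y - y\<^sub>h)\<parallel>\<close>.  Hence the Neumann sum telescopes:
  \<open>z\<^sub>0 - z\<^sub>0\<^sub>,\<^sub>h = (z\<^sub>0 - \<pi> z\<^sub>0) + L\<^sub>h\<^sup>n \<pi> z\<^sub>0 + \<Sum>\<^sub>j\<^sub><\<^sub>n L\<^sub>h\<^sup>j r\<close>, with \<open>n\<close> of order \<open>\<bar>ln h\<bar>\<close> terms.  As
  \<open>L\<^sub>h\<close> is a contraction, the last sum is at most \<open>n \<parallel>r\<parallel>\<close> (\<open>reconstruction_error\<close>).

  It remains to bound \<open>L\<^sub>h\<^sup>n \<pi> z\<^sub>0\<close>.  The number of terms is chosen so that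
  \<open>\<parallel>L\<^sup>n z\<^sub>0\<parallel> \<le> \<eta>\<^sup>n \<parallel>z\<^sub>0\<parallel> \<le> h\<^sup>\<theta> \<parallel>z\<^sub>0\<parallel>\<close>, and replacing \<open>L\<^sub>h\<close> by \<open>L\<close> one factor at a time costs
  \<open>h\<^sup>\<theta> \<parallel>L\<^sup>j z\<^sub>0\<parallel>\<^sub>2\<close> for each \<open>j < n\<close> (\<open>iterate_error\<close>).  A bound \<open>\<parallel>L x\<parallel>\<^sub>2 \<le> M \<parallel>x\<parallel>\<^sub>2\<close> would let these
  norms grow geometrically and destroy the rate.  But \<open>T\<^sup>\<plusminus>\<close> commute with their generators, which
  differ from \<open>\<plusminus>i A\<^sub>0\<close> by the bounded operator \<open>B\<close>, so the growth is additive: one application of \<open>L\<close>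
  adds at most a multiple of \<open>\<parallel>x\<parallel>\<close> to \<open>\<parallel>x\<parallel>\<^sub>1\<close> and of \<open>\<parallel>x\<parallel>\<^sub>1\<close> to \<open>\<parallel>x\<parallel>\<^sub>2\<close>.  Since \<open>\<Sum>\<^sub>j \<parallel>L\<^sup>j z\<^sub>0\<parallel>\<close>
  converges, \<open>\<parallel>L\<^sup>j z\<^sub>0\<parallel>\<^sub>1\<close> stays bounded and \<open>\<parallel>L\<^sup>j z\<^sub>0\<parallel>\<^sub>2\<close> grows at most linearly in \<open>j\<close>
  (\<open>L_iterates\<close>); summing over \<open>j < n\<close> produces the factor \<open>ln\<^sup>2 h\<close>.

  All consistency errors come from one energy estimate (\<open>galerkin_error\<close>).  If \<open>q' = c A\<^sub>0 q + k\<close> with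
  \<open>c = \<plusminus>i\<close>, the difference of \<open>\<pi> q\<close> and a Galerkin solution solves the dissipative discrete equation
  with a source made of \<open>\<pi> q' - q'\<close> and \<open>B (\<pi> q - q)\<close>; the unbounded term drops out because
  \<open>\<langle>\<pi> q - q, \<phi>\<rangle>\<^sub>1\<^sub>/\<^sub>2 = 0\<close> for \<open>\<phi> \<in> X\<^sub>h\<close>.

  The groundwork is the following.  \<open>A\<^sub>0\<^sup>-\<^sup>1\<close> has a bounded positive square root \<open>Q\<close>, and \<open>A\<^sub>0\<^sup>1\<^sup>/\<^sup>2\<close> is its
  inverse (\<open>sqrt_operator_inverse\<close>); the domains of \<open>A\<^sub>0\<^sup>1\<^sup>/\<^sup>2\<close>, \<open>A\<^sub>0\<close> and \<open>A\<^sub>0\<^sup>2\<close> are the ranges of \<open>Q\<close>, \<open>Q\<^sup>2\<close>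
  and \<open>Q\<^sup>4\<close>, so that everything can be said with bounded operators.  The group generated by \<open>i A\<^sub>0\<close>
  (\<open>unitary_orbit\<close>) provides the solutions to which exact observability applies, and comparing them
  with damped orbits gives \<open>\<parallel>T\<^sup>+\<^sub>\<tau>\<parallel> < 1\<close> (\<open>damped_decay\<close>), hence \<open>\<eta> < 1\<close>.
\<close>

instance complex_hilbert \<subseteq> banach ..

section \<open>Complex inner product spaces\<close>

lemma scaleC_i_i: "\<i> *\<^sub>C \<i> *\<^sub>C x = - (x :: 'a::complex_inner)"
  by (simp only: scaleC_scaleC i_squared) (use complex_vector.scale_minus_left[of 1 x] scaleC_of_real[of 1 x] in simp)

lemma cinner_scaleC_right: "cinner x (c *\<^sub>C y) = cnj c * cinner x (y :: 'a::complex_inner)"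
  by (metis cinner_commute cinner_scaleC_left complex_cnj_mult)

lemma inner_scaleC_right: "inner x (c *\<^sub>C y) = inner (cnj c *\<^sub>C x) (y :: 'a::complex_inner)"
  by (simp add: inner_eq_Re_cinner cinner_scaleC_right cinner_scaleC_left)

lemma norm_scaleC: "norm (c *\<^sub>C x) = cmod c * norm (x :: 'a::complex_inner)"
proof -
  have "(norm (c *\<^sub>C x))\<^sup>2 = (cmod c * norm x)\<^sup>2"
  proof -
    have "(norm (c *\<^sub>C x))\<^sup>2 = Re (c * cnj c * cinner x x)"
      unfolding power2_norm_eq_inner
      by (simp only: inner_eq_Re_cinner cinner_scaleC_right cinner_scaleC_left mult_ac)
    also have "c * cnj c = complex_of_real ((cmod c)\<^sup>2)"
      by (simp only: complex_norm_square)
    finally show ?thesis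
      by (simp only: power_mult_distrib power2_norm_eq_inner inner_eq_Re_cinner)
        (simp add: Re_complex_of_real flip: of_real_power)
  qed
  then show ?thesis by (metis norm_ge_zero power2_eq_iff_nonneg zero_le_mult_iff)
qed

lemma bounded_linear_scaleC: "bounded_linear (\<lambda>x :: 'a::complex_inner. c *\<^sub>C x)"
proof (rule bounded_linear_intro[where K = "cmod c"])
  fix r and x :: 'a
  show "c *\<^sub>C r *\<^sub>R x = r *\<^sub>R c *\<^sub>C x"
    by (simp add: scaleC_scaleC mult.commute flip: scaleC_of_real)
qed (simp_all add: scaleC_add_right norm_scaleC mult.commute)

lemma Im_cinner: "Im (cinner x y) = inner x (\<i> *\<^sub>C (y :: 'a::complex_inner))"
  by (simp add: inner_eq_Re_cinner cinner_scaleC_right)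

lemma cinner_eqI:
  fixes x :: "'a::complex_inner" and u :: "'b::complex_inner"
  assumes "inner x y = inner u v" "inner x (\<i> *\<^sub>C y) = inner u (\<i> *\<^sub>C v)"
  shows "cinner x y = cinner u v"
  by (rule complex_eqI) (use assms in \<open>simp_all add: Im_cinner inner_eq_Re_cinner\<close>)

lemma inner_imaginary_self:
  assumes "Re c = 0"
  shows "inner (c *\<^sub>C x) (x :: 'a::complex_inner) = 0"
proof -
  have "inner (c *\<^sub>C x) x = inner x (cnj (c) *\<^sub>C x)" by (simp add: inner_scaleC_right)
  moreover have "cnj c = - c" using assms by (simp add: complex_eq_iff)
  ultimately have "inner (c *\<^sub>C x) x = - inner x (c *\<^sub>C x)"
    by (simp add: complex_vector.scale_minus_left)
  then show ?thesis by (simp add: inner_commute)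
qed

section \<open>Orthogonal projection, Riesz representation and adjoints\<close>

text \<open>
  By the parallelogram law every minimizing sequence of the distance to \<open>V\<close> is a Cauchy sequence.
\<close>

lemma closed_subspace_nearest_point:
  fixes V :: "'a::{real_inner,banach} set"
  assumes V: "subspace V" and clV: "closed V"
  obtains p where "p \<in> V" "\<And>v. v \<in> V \<Longrightarrow> inner (x - p) v = 0"
proof -
  define d where "d = (INF v\<in>V. (norm (x - v))\<^sup>2)"
  have bdd: "bdd_below ((\<lambda>v. (norm (x - v))\<^sup>2) ` V)"
    by (rule bdd_belowI[of _ 0]) auto
  have "0 \<in> V" using V by (rule subspace_0)
  have d_le: "d \<le> (norm (x - v))\<^sup>2" if "v \<in> V" for v
    unfolding d_def using bdd that by (rule cINF_lower)
  have "\<exists>v\<in>V. (norm (x - v))\<^sup>2 < d + 1 / real (Suc n)" for n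
    using cINF_less_iff[of V "\<lambda>v. (norm (x - v))\<^sup>2" "d + 1 / real (Suc n)"] bdd \<open>0 \<in> V\<close>
    by (auto simp: d_def)
  then obtain v where vV: "\<And>n. v n \<in> V"
    and v: "\<And>n. (norm (x - v n))\<^sup>2 < d + 1 / real (Suc n)" by metis
  have par: "(norm (v m - v n))\<^sup>2 \<le> 2 / real (Suc m) + 2 / real (Suc n)" for m n
  proof -
    have "(1/2) *\<^sub>R (v m + v n) \<in> V"
      using V vV by (simp add: subspace_add subspace_scale)
    then have "d \<le> (norm (x - (1/2) *\<^sub>R (v m + v n)))\<^sup>2" by (rule d_le)
    also have "\<dots> = (norm ((x - v m) + (x - v n)))\<^sup>2 / 4"
    proof -
      have "x - (1/2) *\<^sub>R (v m + v n) = (1/2) *\<^sub>R ((x - v m) + (x - v n))"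
        by (simp add: algebra_simps flip: scaleR_left_distrib)
      then show ?thesis by (simp only: norm_scaleR) (simp add: power_divide)
    qed
    finally have "4 * d \<le> (norm ((x - v m) + (x - v n)))\<^sup>2" by simp
    moreover have "(norm ((x - v m) + (x - v n)))\<^sup>2 + (norm (v m - v n))\<^sup>2
        = 2 * (norm (x - v m))\<^sup>2 + 2 * (norm (x - v n))\<^sup>2"
      by (simp add: power2_norm_eq_inner inner_diff inner_add inner_commute algebra_simps)
    ultimately show ?thesis using v[of m] v[of n] by simp
  qed
  have "Cauchy v"
  proof (rule CauchyI)
    fix e :: real assume "e > 0"
    then obtain N where N: "4 / e\<^sup>2 < real N" using reals_Archimedean2 by blast
    show "\<exists>M. \<forall>m\<ge>M. \<forall>n\<ge>M. norm (v m - v n) < e"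
    proof (intro exI allI impI)
      fix m n assume "m \<ge> N" "n \<ge> N"
      have "N > 0" using N \<open>e > 0\<close> by (cases N) (auto simp: not_less field_simps)
      have *: "2 / real (Suc k) < e\<^sup>2 / 2" if "k \<ge> N" for k
      proof -
        have "4 < real N * e\<^sup>2" using N \<open>e > 0\<close> by (simp add: field_simps)
        also have "\<dots> \<le> real (Suc k) * e\<^sup>2" using that by (intro mult_right_mono) auto
        finally show ?thesis by (simp add: field_simps del: of_nat_Suc)
      qed
      have "(norm (v m - v n))\<^sup>2 < e\<^sup>2"
        using par[of m n] *[OF \<open>m \<ge> N\<close>] *[OF \<open>n \<ge> N\<close>] by linarith
      then show "norm (v m - v n) < e"
        using \<open>e > 0\<close> by (simp add: power2_less_imp_less)
    qed
  qed
  then obtain p where p: "v \<longlonglongrightarrow> p" using Cauchy_convergent_iff convergent_def by blast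
  have pV: "p \<in> V" using closed_sequentially[OF clV] vV p by blast
  have dp: "(norm (x - p))\<^sup>2 \<le> d"
  proof (rule LIMSEQ_le)
    show "(\<lambda>n. (norm (x - v n))\<^sup>2) \<longlonglongrightarrow> (norm (x - p))\<^sup>2" by (intro tendsto_intros p)
    show "(\<lambda>n. d + 1 / real (Suc n)) \<longlonglongrightarrow> d"
      using tendsto_add[OF tendsto_const LIMSEQ_inverse_real_of_nat, of d]
      by (simp add: inverse_eq_divide)
  qed (use v in \<open>auto intro!: exI[of _ 0] less_imp_le\<close>)
  have "inner (x - p) w = 0" if "w \<in> V" for w
  proof (cases "w = 0")
    case False
    \<comment> \<open>Moving from \<open>p\<close> along \<open>w\<close> by this amount would lower the distance.\<close>
    define t where "t = inner (x - p) w / inner w w"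
    have "p + t *\<^sub>R w \<in> V" using V pV that by (simp add: subspace_add subspace_scale)
    then have "(norm (x - p))\<^sup>2 \<le> (norm (x - p - t *\<^sub>R w))\<^sup>2"
      using d_le dp by (metis add_diff_cancel_left' diff_diff_eq order_trans)
    also have "\<dots> = (norm (x - p))\<^sup>2 - (inner (x - p) w)\<^sup>2 / inner w w"
    proof -
      have "inner (a - t *\<^sub>R w) (a - t *\<^sub>R w) = inner a a - 2 * t * inner a w + t * t * inner w w" for a
        by (simp add: inner_diff inner_commute algebra_simps)
      then show ?thesis using False
        unfolding power2_norm_eq_inner t_def by (simp add: power2_eq_square)
    qed
    finally have "(inner (x - p) w)\<^sup>2 / inner w w \<le> 0" by simp
    moreover have "inner w w > 0" using False by simp
    ultimately show ?thesis
      by (simp add: divide_le_0_iff)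
  qed simp
  with pV that show thesis by blast
qed

text \<open>
  The vector from \<open>x\<close> to its nearest point in the closure of \<open>V\<close> is orthogonal to \<open>V\<close>.
\<close>

lemma dense_subspaceI:
  fixes V :: "'a::{real_inner,banach} set"
  assumes V: "subspace V" and *: "\<And>y. (\<And>v. v \<in> V \<Longrightarrow> inner v y = 0) \<Longrightarrow> y = 0"
  shows "closure V = UNIV"
proof -
  have "x \<in> closure V" for x
  proof -
    have "subspace (closure V)"
      unfolding subspace_def
    proof (intro conjI ballI allI)
      show "0 \<in> closure V" using V subspace_0 closure_subset by blast
      fix a b c assume a: "a \<in> closure V" and b: "b \<in> closure V"
      from a b obtain f g where f: "\<forall>n. f n \<in> V" "f \<longlonglongrightarrow> a" and g: "\<forall>n. g n \<in> V" "g \<longlonglongrightarrow> b"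
        by (auto simp: closure_sequential)
      have "(\<lambda>n. f n + g n) \<longlonglongrightarrow> a + b" by (intro tendsto_add f g)
      with f g V show "a + b \<in> closure V"
        unfolding closure_sequential by (intro exI[of _ "\<lambda>n. f n + g n"]) (auto simp: subspace_add)
      have "(\<lambda>n. c *\<^sub>R f n) \<longlonglongrightarrow> c *\<^sub>R a" by (intro tendsto_intros f)
      with f V show "c *\<^sub>R a \<in> closure V"
        unfolding closure_sequential by (intro exI[of _ "\<lambda>n. c *\<^sub>R f n"]) (auto simp: subspace_scale)
    qed
    then obtain p where p: "p \<in> closure V" "\<And>v. v \<in> closure V \<Longrightarrow> inner (x - p) v = 0"
      using closed_subspace_nearest_point[of "closure V" x] by auto
    then have "x - p = 0" by (intro *) (metis closure_subset inner_commute subsetD)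
    with p show ?thesis by simp
  qed
  then show ?thesis by blast
qed

text \<open>
  The representing vector is normal to the kernel of \<open>f\<close>.
\<close>

lemma riesz_representation:
  fixes f :: "'a::{real_inner,banach} \<Rightarrow> real"
  assumes "bounded_linear f"
  shows "\<exists>x. \<forall>u. f u = inner u x"
proof (cases "\<forall>u. f u = 0")
  case True
  then show ?thesis by (intro exI[of _ 0]) simp
next
  case False
  then obtain u where u: "f u \<noteq> 0" by blast
  interpret f: bounded_linear f by fact
  have "closed (f -` {0})"
    by (intro continuous_closed_vimage) (auto intro: f.continuous)
  moreover have "subspace (f -` {0})" by (auto simp: subspace_def f.add f.scaleR)
  ultimately obtain p where p: "f p = 0" "\<And>v. f v = 0 \<Longrightarrow> inner (u - p) v = 0"
    using closed_subspace_nearest_point[of "f -` {0}" u] by auto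
  define n where "n = u - p"
  have fn: "f n \<noteq> 0" using u p by (simp add: n_def f.diff)
  then have n0: "n \<noteq> 0" using f.zero by auto
  have "f w = inner w ((f n / inner n n) *\<^sub>R n)" for w
  proof -
    have "f (w - (f w / f n) *\<^sub>R n) = 0" using fn by (simp add: f.diff f.scaleR)
    then have "inner n (w - (f w / f n) *\<^sub>R n) = 0" using p unfolding n_def by blast
    then have "inner n w = f w / f n * inner n n" by (simp add: inner_diff)
    then show ?thesis using fn n0 by (simp add: inner_commute field_simps)
  qed
  then show ?thesis by blast
qed

lemma eq_if_inner_eq:
  fixes x y :: "'a::real_inner"
  assumes "\<And>u. inner u x = inner u y"
  shows "x = y"
proof -
  have "inner (x - y) (x - y) = 0" using assms[of "x - y"] by (simp only: inner_diff_right diff_self)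
  then show ?thesis by simp
qed

text \<open>
  The representation theorem for real functionals suffices: since \<open>C\<close> commutes with \<open>i\<close>, equality of
  the real parts of \<open>\<langle>C u, y\<rangle>\<close> and \<open>\<langle>u, x\<rangle>\<close> for all \<open>u\<close> implies equality of the complex numbers.
\<close>

lemma cadjoint_props:
  fixes C :: "'a::complex_hilbert \<Rightarrow> 'b::complex_hilbert"
  assumes C: "bounded_clinear C"
  shows inner_cadjoint: "inner (C u) y = inner u (cadjoint C y)"
    and bounded_linear_cadjoint: "bounded_linear (cadjoint C)"
    and cadjoint_scaleC: "cadjoint C (c *\<^sub>C y) = c *\<^sub>C cadjoint C y"
proof -
  from C interpret C: bounded_linear C by (simp add: bounded_clinear_def)
  have CC: "C (c *\<^sub>C x) = c *\<^sub>C C x" for c x using C by (simp add: bounded_clinear_def)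
  have ex: "\<exists>x. \<forall>u. inner (C u) y = inner u x" for y
    by (rule riesz_representation)
      (intro bounded_linear_compose[OF bounded_linear_inner_left] C.bounded_linear_axioms)
  have adj: "\<forall>u. cinner (C u) y = cinner u (cadjoint C y)" for y
  proof -
    obtain x where x: "\<forall>u. inner (C u) y = inner u x" using ex by blast
    have "\<forall>u. cinner (C u) y = cinner u x"
      by (auto intro!: cinner_eqI simp: x inner_scaleC_right simp flip: CC)
    moreover have "x' = x" if "\<forall>u. cinner (C u) y = cinner u x'" for x'
    proof -
      have "inner u x' = inner u x" for u using that x by (simp add: inner_eq_Re_cinner)
      then show ?thesis by (rule eq_if_inner_eq)
    qed
    ultimately show ?thesis unfolding cadjoint_def by (rule theI2) blast+
  qed
  show inner: "inner (C u) y = inner u (cadjoint C y)" for u y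
    using adj by (simp add: inner_eq_Re_cinner)
  obtain K where K: "\<And>x. norm (C x) \<le> norm x * K" "K \<ge> 0" using C.nonneg_bounded by blast
  show "bounded_linear (cadjoint C)"
  proof (rule bounded_linear_intro)
    fix y
    have "norm (cadjoint C y) * norm (cadjoint C y) = inner (C (cadjoint C y)) y"
      by (simp add: inner flip: power2_norm_eq_inner power2_eq_square)
    also have "\<dots> \<le> norm (C (cadjoint C y)) * norm y" by (rule norm_cauchy_schwarz)
    also have "\<dots> \<le> norm (cadjoint C y) * K * norm y" by (intro mult_right_mono K) auto
    finally show "norm (cadjoint C y) \<le> norm y * K"
      by (cases "cadjoint C y = 0") (auto simp: K(2) mult.assoc mult.commute)
  qed (auto intro!: eq_if_inner_eq[where 'a = 'a] simp: inner_add_right simp flip: inner)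
  show "cadjoint C (c *\<^sub>C y) = c *\<^sub>C cadjoint C y" for c y
    by (rule eq_if_inner_eq) (simp only: inner_scaleC_right inner[symmetric] CC[symmetric])
qed

lemma eq_on_dense:
  fixes f g :: "'a::real_normed_vector \<Rightarrow> real"
  assumes "closure S = UNIV" "continuous_on UNIV f" "continuous_on UNIV g" "\<And>x. x \<in> S \<Longrightarrow> f x \<le> g x"
  shows "f x \<le> g x"
proof -
  have "closed {x. f x \<le> g x}" by (intro closed_Collect_le assms)
  then have "closure S \<subseteq> {x. f x \<le> g x}" using assms by (intro closure_minimal) auto
  then show ?thesis using assms by auto
qed

section \<open>Exponentials of bounded operators\<close>

text \<open>
  Used for the exponential series and for the approximation of the unitary group.
\<close>

lemma has_vector_derivative_uniform_limit:
  fixes f :: "nat \<Rightarrow> real \<Rightarrow> 'a::banach"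
  assumes S: "convex S"
    and f: "\<And>n x. x \<in> S \<Longrightarrow> (f n has_vector_derivative f' n x) (at x within S)"
    and f': "uniform_limit S f' g' sequentially"
    and g: "\<And>x. x \<in> S \<Longrightarrow> (\<lambda>n. f n x) \<longlonglongrightarrow> g x"
    and x: "x \<in> S"
  shows "(g has_vector_derivative g' x) (at x within S)"
proof -
  have "\<exists>k. \<forall>y\<in>S. (\<lambda>n. f n y) \<longlonglongrightarrow> k y \<and> (k has_derivative (\<lambda>h. h *\<^sub>R g' y)) (at y within S)"
  proof (rule has_derivative_sequence[where f = f and f' = "\<lambda>n y h. h *\<^sub>R f' n y" and S = S
        and l = "g x"])
    show "(f n has_derivative (\<lambda>h. h *\<^sub>R f' n y)) (at y within S)" if "y \<in> S" for n y
      using f[OF that] by (simp add: has_vector_derivative_def)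
    fix e :: real assume "e > 0"
    with f' have "\<forall>\<^sub>F n in sequentially. \<forall>y\<in>S. dist (f' n y) (g' y) < e" by (rule uniform_limitD)
    then show "\<forall>\<^sub>F n in sequentially. \<forall>y\<in>S. \<forall>h. norm (h *\<^sub>R f' n y - h *\<^sub>R g' y) \<le> e * norm h"
    proof (rule eventually_mono, intro ballI allI)
      fix n y and h :: real assume "\<forall>y\<in>S. dist (f' n y) (g' y) < e" "y \<in> S"
      then have "norm (f' n y - g' y) \<le> e" by (auto simp: dist_norm intro: less_imp_le)
      then have "\<bar>h\<bar> * norm (f' n y - g' y) \<le> \<bar>h\<bar> * e" by (intro mult_left_mono) auto
      then show "norm (h *\<^sub>R f' n y - h *\<^sub>R g' y) \<le> e * norm h"
        by (simp add: mult.commute flip: scaleR_diff_right)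
    qed
  qed (use S in simp, use x in simp, use x g in simp)
  then obtain k where k: "\<And>y. y \<in> S \<Longrightarrow> (\<lambda>n. f n y) \<longlonglongrightarrow> k y"
    "(k has_derivative (\<lambda>h. h *\<^sub>R g' x)) (at x within S)" using x by blast
  have "k y = g y" if "y \<in> S" for y using k(1) g that LIMSEQ_unique by blast
  with k(2) x show ?thesis
    unfolding has_vector_derivative_def by (metis has_derivative_transform)
qed

definition operator_exp :: "('a::banach \<Rightarrow> 'a) \<Rightarrow> real \<Rightarrow> 'a \<Rightarrow> 'a" where
  "operator_exp F t x = (\<Sum>n. (t ^ n / fact n) *\<^sub>R (F ^^ n) x)"

lemma operator_exp_sums:
  fixes F :: "'a::banach \<Rightarrow> 'a"
  assumes F: "bounded_linear F"
  shows "(\<lambda>n. (t ^ n / fact n) *\<^sub>R (F ^^ n) x) sums operator_exp F t x"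
    and "uniform_limit {-r..r} (\<lambda>n t. \<Sum>i<n. (t ^ i / fact i) *\<^sub>R (F ^^ i) x) (\<lambda>t. operator_exp F t x) sequentially"
proof -
  interpret F: bounded_linear F by fact
  obtain K where K: "\<And>x. norm (F x) \<le> norm x * K" "K \<ge> 0" using F.nonneg_bounded by blast
  have pow: "norm ((F ^^ n) x) \<le> K ^ n * norm x" for n x
  proof (induction n)
    case (Suc n)
    have "norm ((F ^^ Suc n) x) \<le> norm ((F ^^ n) x) * K" using K by simp
    also have "\<dots> \<le> K ^ n * norm x * K" using Suc K by (intro mult_right_mono)
    finally show ?case by (simp add: mult_ac)
  qed simp
  have sm: "summable (\<lambda>n. inverse (fact n) * (r * K) ^ n * norm x)" for r
    by (intro summable_mult2 summable_exp)
  have bd: "norm ((t ^ n / fact n) *\<^sub>R (F ^^ n) x) \<le> inverse (fact n) * (r * K) ^ n * norm x"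
    if "\<bar>t\<bar> \<le> r" for t r n x
  proof -
    have "\<bar>t\<bar> ^ n * norm ((F ^^ n) x) \<le> r ^ n * (K ^ n * norm x)"
      using that pow by (intro mult_mono power_mono) auto
    then have "\<bar>t\<bar> ^ n * norm ((F ^^ n) x) / fact n \<le> r ^ n * (K ^ n * norm x) / fact n"
      by (intro divide_right_mono) auto
    then show ?thesis by (simp add: power_abs power_mult_distrib divide_inverse abs_mult mult_ac)
  qed
  have "summable (\<lambda>n. (t ^ n / fact n) *\<^sub>R (F ^^ n) x)"
    by (rule summable_norm_cancel, rule summable_comparison_test[OF _ sm[of "\<bar>t\<bar>"]])
      (use bd in auto)
  then show "(\<lambda>n. (t ^ n / fact n) *\<^sub>R (F ^^ n) x) sums operator_exp F t x"
    unfolding operator_exp_def by (rule summable_sums)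
  show "uniform_limit {-r..r} (\<lambda>n t. \<Sum>i<n. (t ^ i / fact i) *\<^sub>R (F ^^ i) x) (\<lambda>t. operator_exp F t x) sequentially"
    unfolding operator_exp_def by (rule Weierstrass_m_test[OF _ sm[of r]]) (use bd in auto)
qed

lemma operator_exp_commute:
  assumes "bounded_linear F" "bounded_linear G" "\<And>x. F (G x) = G (F x)"
  shows "operator_exp F t (G x) = G (operator_exp F t x)"
proof -
  interpret G: bounded_linear G by fact
  have "(F ^^ n) (G x) = G ((F ^^ n) x)" for n by (induction n) (use assms in auto)
  then have "(\<lambda>n. (t ^ n / fact n) *\<^sub>R (F ^^ n) (G x)) sums G (operator_exp F t x)"
    using G.sums[OF operator_exp_sums(1)[OF assms(1), of t x]] by (simp add: G.scaleR)
  with operator_exp_sums(1)[OF assms(1)] show ?thesis by (metis sums_unique2)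
qed

lemma operator_exp_diff:
  assumes "bounded_linear F"
  shows "operator_exp F t (x - y) = operator_exp F t x - operator_exp F t y"
proof -
  interpret F: bounded_linear F by fact
  have "(F ^^ n) (x - y) = (F ^^ n) x - (F ^^ n) y" for n by (induction n) (auto simp: F.diff)
  then have "(\<lambda>n. (t ^ n / fact n) *\<^sub>R (F ^^ n) (x - y)) sums (operator_exp F t x - operator_exp F t y)"
    using sums_diff[OF operator_exp_sums(1)[OF assms] operator_exp_sums(1)[OF assms]]
    by (simp add: scaleR_diff_right)
  with operator_exp_sums(1)[OF assms] show ?thesis by (metis sums_unique2)
qed

lemma operator_exp_0 [simp]: "operator_exp F 0 x = x"
proof -
  have "(\<lambda>n. (0 ^ n / fact n) *\<^sub>R (F ^^ n) x) = (\<lambda>n. if n = 0 then x else 0)"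
    by (auto simp: fun_eq_iff)
  then show ?thesis using sums_single[of 0 "\<lambda>_. x"] by (simp add: operator_exp_def sums_iff)
qed

text \<open>
  Differentiating the series for \<open>x\<close> term by term gives the series for \<open>F x\<close>.
\<close>

lemma operator_exp_has_vector_derivative:
  fixes F :: "'a::banach \<Rightarrow> 'a"
  assumes F: "bounded_linear F"
  shows "((\<lambda>t. operator_exp F t x) has_vector_derivative F (operator_exp F t x)) (at t within S)"
proof -
  define r where "r = \<bar>t\<bar> + 1"
  define f where "f = (\<lambda>n t. \<Sum>i<Suc n. (t ^ i / fact i) *\<^sub>R (F ^^ i) x)"
  define f' where "f' = (\<lambda>n t. \<Sum>i<n. (t ^ i / fact i) *\<^sub>R (F ^^ i) (F x))"
  have "((\<lambda>t. operator_exp F t x) has_vector_derivative operator_exp F t (F x)) (at t within {-r..r})"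
  proof (rule has_vector_derivative_uniform_limit)
    show "(f n has_vector_derivative f' n t) (at t within {-r..r})" for n t
    proof -
      have "f n = (\<lambda>t. x + (\<Sum>i<n. (t ^ Suc i / fact (Suc i)) *\<^sub>R (F ^^ Suc i) x))"
        unfolding f_def sum.lessThan_Suc_shift by simp
      moreover have "((\<lambda>t. (t ^ Suc i / fact (Suc i)) *\<^sub>R (F ^^ Suc i) x) has_vector_derivative
          (t ^ i / fact i) *\<^sub>R (F ^^ i) (F x)) (at t within {-r..r})" for i
      proof -
        have "((\<lambda>t. t ^ Suc i / fact (Suc i)) has_real_derivative t ^ i / fact i) (at t within {-r..r})"
          by (rule derivative_eq_intros refl | simp add: field_simps del: of_nat_Suc)+
        then show ?thesis
          unfolding has_real_derivative_iff_has_vector_derivative funpow_Suc_right o_def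
          by (rule bounded_linear.has_vector_derivative[OF bounded_linear_scaleR_left])
      qed
      then have "((\<lambda>t. x + (\<Sum>i<n. (t ^ Suc i / fact (Suc i)) *\<^sub>R (F ^^ Suc i) x)) has_vector_derivative
          0 + (\<Sum>i<n. (t ^ i / fact i) *\<^sub>R (F ^^ i) (F x))) (at t within {-r..r})"
        by (intro has_vector_derivative_add has_vector_derivative_const has_vector_derivative_sum)
      ultimately show ?thesis unfolding f'_def by simp
    qed
    show "uniform_limit {-r..r} f' (\<lambda>t. operator_exp F t (F x)) sequentially"
      unfolding f'_def by (rule operator_exp_sums(2)[OF F])
    show "(\<lambda>n. f n t) \<longlonglongrightarrow> operator_exp F t x" for t
      using operator_exp_sums(1)[OF F, of t x] unfolding f_def sums_def by (rule LIMSEQ_Suc)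
  qed (auto simp: r_def)
  then have "((\<lambda>t. operator_exp F t x) has_vector_derivative F (operator_exp F t x)) (at t within {-r..r})"
    by (simp add: operator_exp_commute[OF F F])
  moreover have "at t within {-r..r} = at t"
    by (rule at_within_interior) (auto simp: r_def)
  ultimately show ?thesis by (simp add: has_vector_derivative_at_within)
qed

section \<open>Energy estimates\<close>

text \<open>
  Over a fine partition the errors \<open>\<epsilon> (t - s)\<close> add up to \<open>\<epsilon> (b - a)\<close>.
\<close>

lemma decreasing_if_small_increments:
  fixes \<psi> :: "real \<Rightarrow> real"
  assumes "a \<le> b"
    and incr: "\<And>\<epsilon>. \<epsilon> > 0 \<Longrightarrow> \<exists>\<delta>>0. \<forall>s t. a \<le> s \<longrightarrow> s \<le> t \<longrightarrow> t \<le> b \<longrightarrow> t - s < \<delta> \<longrightarrow>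
      \<psi> t \<le> \<psi> s + \<epsilon> * (t - s)"
  shows "\<psi> b \<le> \<psi> a"
proof -
  have *: "\<psi> b \<le> \<psi> a + \<epsilon> * (b - a)" if \<epsilon>: "\<epsilon> > 0" for \<epsilon>
  proof -
    obtain \<delta> where "\<delta> > 0" and \<delta>: "\<And>s t. a \<le> s \<Longrightarrow> s \<le> t \<Longrightarrow> t \<le> b \<Longrightarrow> t - s < \<delta> \<Longrightarrow>
      \<psi> t \<le> \<psi> s + \<epsilon> * (t - s)" using incr[OF \<epsilon>] by blast
    obtain n where n: "(b - a) / \<delta> < real n" using reals_Archimedean2 by blast
    have "n > 0" using n \<open>\<delta> > 0\<close> \<open>a \<le> b\<close> by (cases n) (auto simp: not_less field_simps)
    define d where "d = (b - a) / real n"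
    have d: "0 \<le> d" "d < \<delta>" "real n * d = b - a"
      using n \<open>n > 0\<close> \<open>\<delta> > 0\<close> \<open>a \<le> b\<close> by (auto simp: d_def field_simps)
    have "\<psi> (a + real k * d) \<le> \<psi> a + \<epsilon> * (real k * d)" if "k \<le> n" for k
      using that
    proof (induction k)
      case (Suc k)
      have "real (Suc k) * d \<le> real n * d" using Suc.prems d by (intro mult_right_mono) auto
      then have "\<psi> (a + real (Suc k) * d) \<le> \<psi> (a + real k * d) + \<epsilon> * (a + real (Suc k) * d - (a + real k * d))"
        using d by (intro \<delta>) (auto simp: algebra_simps)
      with Suc show ?case by (simp add: algebra_simps)
    qed simp
    from this[of n] show ?thesis by (simp add: d(3))
  qed
  show ?thesis
  proof (rule field_le_epsilon)
    fix e :: real assume "e > 0"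
    have "\<psi> b \<le> \<psi> a + e / (b - a + 1) * (b - a)" using \<open>e > 0\<close> \<open>a \<le> b\<close> by (intro *) auto
    also have "e / (b - a + 1) * (b - a) \<le> e" using \<open>e > 0\<close> \<open>a \<le> b\<close> by (simp add: field_simps)
    finally show "\<psi> b \<le> \<psi> a + e" by simp
  qed
qed

text \<open>
  Dissipativity removes the first-order term of \<open>\<parallel>x + d F x\<parallel>\<^sup>2\<close>, so an explicit Euler step increases
  the norm only to second order in the step size.
\<close>

lemma dissipative_step:
  fixes F :: "'a::real_inner \<Rightarrow> 'a"
  assumes diss: "inner (F x) x \<le> 0" and K: "norm (F x) \<le> K * norm x" and "0 \<le> d" "0 \<le> K"
  shows "norm (x + d *\<^sub>R F x) \<le> (1 + K\<^sup>2 * d\<^sup>2) * norm x"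
proof (rule power2_le_imp_le)
  have "(norm (x + d *\<^sub>R F x))\<^sup>2 = (norm x)\<^sup>2 + 2 * d * inner (F x) x + d\<^sup>2 * (norm (F x))\<^sup>2"
    unfolding power2_norm_eq_inner
    by (simp add: inner_add inner_commute algebra_simps power2_eq_square)
  also have "\<dots> \<le> (norm x)\<^sup>2 + 0 + d\<^sup>2 * (K * norm x)\<^sup>2"
    using diss \<open>0 \<le> d\<close> by (intro add_mono mult_left_mono power_mono K) (auto simp: mult_nonneg_nonpos)
  also have "\<dots> \<le> ((1 + K\<^sup>2 * d\<^sup>2) * norm x)\<^sup>2"
  proof -
    have "((1 + K\<^sup>2 * d\<^sup>2) * norm x)\<^sup>2 = (norm x)\<^sup>2 + 2 * (d\<^sup>2 * (K * norm x)\<^sup>2) + (K\<^sup>2 * d\<^sup>2 * norm x)\<^sup>2"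
      by (simp add: power2_eq_square algebra_simps)
    moreover have "0 \<le> d\<^sup>2 * (K * norm x)\<^sup>2" "0 \<le> (K\<^sup>2 * d\<^sup>2 * norm x)\<^sup>2" by simp_all
    ultimately show ?thesis by linarith
  qed
  finally show "(norm (x + d *\<^sub>R F x))\<^sup>2 \<le> ((1 + K\<^sup>2 * d\<^sup>2) * norm x)\<^sup>2" .
  show "0 \<le> (1 + K\<^sup>2 * d\<^sup>2) * norm x" by (intro mult_nonneg_nonneg add_nonneg_nonneg) auto
qed

text \<open>
  The curve \<open>r\<close> is the indefinite integral of a function that need not be continuous, so its norm
  cannot be differentiated everywhere.  Instead \<open>\<parallel>r\<parallel> - \<integral> \<gamma>\<close> is shown to increase by \<open>o(t - s)\<close> at most
  over short intervals \<open>[s, t]\<close>, uniformly, by comparing \<open>r\<close> with an Euler step from \<open>s\<close>.  The bound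
  does not involve the norm of \<open>F\<close>, which blows up for Galerkin operators as \<open>h\<close> tends to \<open>0\<close>.
\<close>

theorem dissipative_energy_estimate:
  fixes F :: "'a::{real_inner,banach} \<Rightarrow> 'a" and a b :: real
  assumes F: "bounded_linear F" and diss: "\<And>x. inner (F x) x \<le> 0"
    and "a \<le> b"
    and r: "\<And>s t. a \<le> s \<Longrightarrow> s \<le> t \<Longrightarrow> t \<le> b \<Longrightarrow> (r' has_integral (r t - r s)) {s..t}"
    and N: "negligible N" and bd: "\<And>t. t \<in> {a..b} - N \<Longrightarrow> norm (r' t - F (r t)) \<le> \<gamma> t"
    and \<gamma>: "\<gamma> integrable_on {a..b}"
  shows "norm (r b) \<le> norm (r a) + integral {a..b} \<gamma>"
proof -
  interpret F: bounded_linear F by fact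
  obtain K where K: "\<And>x. norm (F x) \<le> norm x * K" "K \<ge> 0" using F.nonneg_bounded by blast
  have "continuous_on {a..b} r"
  proof -
    have "r' integrable_on {a..b}" using r[of a b] \<open>a \<le> b\<close> by (auto simp: integrable_on_def)
    then have "continuous_on {a..b} (\<lambda>t. integral {a..t} r' + r a)"
      by (intro continuous_intros indefinite_integral_continuous_1)
    moreover have "integral {a..t} r' + r a = r t" if "t \<in> {a..b}" for t
      using r[of a t] that by (simp add: integral_unique)
    ultimately show ?thesis by (rule continuous_on_eq)
  qed
  then have uc: "uniformly_continuous_on {a..b} r" and "compact (r ` {a..b})"
    by (auto intro: compact_uniformly_continuous compact_continuous_image)
  then obtain M where M: "\<And>t. t \<in> {a..b} \<Longrightarrow> norm (r t) \<le> M" "M > 0"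
    by (metis bounded_pos compact_imp_bounded imageI)
  define \<psi> where "\<psi> t = norm (r t) - integral {a..t} \<gamma>" for t
  have "\<psi> b \<le> \<psi> a"
  proof (rule decreasing_if_small_increments[OF \<open>a \<le> b\<close>])
    fix \<epsilon> :: real assume \<epsilon>: "\<epsilon> > 0"
    define \<epsilon>' where "\<epsilon>' = \<epsilon> / (2 * (K + 1))"
    have "\<epsilon>' > 0" using \<epsilon> K by (simp add: \<epsilon>'_def)
    obtain \<delta>1 where "\<delta>1 > 0" and \<delta>1: "\<And>s t. s \<in> {a..b} \<Longrightarrow> t \<in> {a..b} \<Longrightarrow> \<bar>t - s\<bar> < \<delta>1 \<Longrightarrow> norm (r t - r s) < \<epsilon>'"
      using uc \<open>\<epsilon>' > 0\<close> unfolding uniformly_continuous_on_def dist_norm real_norm_def by meson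
    define \<delta> where "\<delta> = min \<delta>1 (\<epsilon> / (2 * (K\<^sup>2 * M + 1)))"
    have pos: "K\<^sup>2 * M + 1 > 0" using M K by (simp add: add_nonneg_pos)
    have "\<delta> > 0" using \<open>\<delta>1 > 0\<close> \<epsilon> pos by (simp add: \<delta>_def)
    moreover have "\<psi> t \<le> \<psi> s + \<epsilon> * (t - s)" if st: "a \<le> s" "s \<le> t" "t \<le> b" "t - s < \<delta>" for s t
    proof -
      have \<gamma>st: "\<gamma> integrable_on {s..t}" using \<gamma> st by (auto intro: integrable_on_subinterval)
      have I: "((\<lambda>u. r' u - F (r s)) has_integral (r t - r s - (t - s) *\<^sub>R F (r s))) {s..t}"
        using has_integral_diff[OF r[of s t] has_integral_const_real[of "F (r s)" s t]] st by simp
      \<comment> \<open>On the null set nothing is known about the integrand, so it is replaced there by \<open>0\<close>.\<close>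
      define g where "g u = (if u \<in> N then 0 else r' u - F (r s))" for u
      have g: "(g has_integral (r t - r s - (t - s) *\<^sub>R F (r s))) {s..t}"
        by (rule has_integral_spike[OF N _ I]) (auto simp: g_def)
      have gbd: "norm (g u) \<le> (if u \<in> N then K * \<epsilon>' else \<gamma> u + K * \<epsilon>')" if u: "u \<in> {s..t}" for u
      proof (cases "u \<in> N")
        case False
        have "norm (r' u - F (r s)) \<le> norm (r' u - F (r u)) + norm (F (r u - r s))"
          using norm_triangle_ineq[of "r' u - F (r u)" "F (r u - r s)"] by (simp add: F.diff)
        also have "norm (r' u - F (r u)) \<le> \<gamma> u" using u st False by (intro bd) auto
        also have "norm (F (r u - r s)) \<le> norm (r u - r s) * K" by (rule K)
        also have "\<dots> \<le> \<epsilon>' * K"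
          using u st K by (intro mult_right_mono less_imp_le[OF \<delta>1]) (auto simp: \<delta>_def)
        finally show ?thesis using False by (simp add: g_def mult.commute)
      qed (use K \<open>\<epsilon>' > 0\<close> in \<open>auto simp: g_def\<close>)
      have h: "((\<lambda>u. if u \<in> N then K * \<epsilon>' else \<gamma> u + K * \<epsilon>') has_integral
          integral {s..t} \<gamma> + (t - s) * (K * \<epsilon>')) {s..t}"
        by (rule has_integral_spike[OF N, rotated])
          (use has_integral_add[OF integrable_integral[OF \<gamma>st] has_integral_const_real[of "K * \<epsilon>'" s t]] st
            in auto)
      have "norm (integral {s..t} g) \<le> integral {s..t} (\<lambda>u. if u \<in> N then K * \<epsilon>' else \<gamma> u + K * \<epsilon>')"
        by (rule integral_norm_bound_integral) (use g h gbd in auto)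
      then have 1: "norm (r t - r s - (t - s) *\<^sub>R F (r s)) \<le> integral {s..t} \<gamma> + (t - s) * (K * \<epsilon>')"
        by (simp only: integral_unique[OF g] integral_unique[OF h])
      have 2: "norm (r s + (t - s) *\<^sub>R F (r s)) \<le> (1 + K\<^sup>2 * (t - s)\<^sup>2) * norm (r s)"
        by (rule dissipative_step[OF diss]) (use K st in \<open>auto simp: mult.commute\<close>)
      have 3: "K\<^sup>2 * (t - s)\<^sup>2 * norm (r s) \<le> (\<epsilon> / 2) * (t - s)"
      proof -
        have "K\<^sup>2 * (t - s)\<^sup>2 * norm (r s) \<le> K\<^sup>2 * (t - s)\<^sup>2 * M"
          using M st by (intro mult_left_mono) auto
        also have "\<dots> = (t - s) * ((t - s) * (K\<^sup>2 * M))" by (simp add: power2_eq_square)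
        also have "\<dots> \<le> (t - s) * (\<epsilon> / 2)"
        proof (rule mult_left_mono)
          have "(t - s) * (K\<^sup>2 * M) \<le> \<epsilon> / (2 * (K\<^sup>2 * M + 1)) * (K\<^sup>2 * M)"
            using st M by (intro mult_right_mono) (auto simp: \<delta>_def)
          also have "\<dots> \<le> \<epsilon> / 2" using \<epsilon> pos by (simp add: field_simps)
          finally show "(t - s) * (K\<^sup>2 * M) \<le> \<epsilon> / 2" .
        qed (use st in simp)
        finally show ?thesis by (simp only: mult.commute)
      qed
      have 4: "K * \<epsilon>' \<le> \<epsilon> / 2" using \<epsilon> K by (simp add: \<epsilon>'_def field_simps)
      have "norm (r t) \<le> norm (r t - r s - (t - s) *\<^sub>R F (r s)) + norm (r s + (t - s) *\<^sub>R F (r s))"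
        using norm_triangle_ineq[of "r t - r s - (t - s) *\<^sub>R F (r s)" "r s + (t - s) *\<^sub>R F (r s)"] by simp
      also have "\<dots> \<le> integral {s..t} \<gamma> + (t - s) * (\<epsilon> / 2) + (norm (r s) + (\<epsilon> / 2) * (t - s))"
        using 1 2 3 mult_left_mono[OF 4, of "t - s"] st by (auto simp: algebra_simps)
      finally have "norm (r t) \<le> norm (r s) + integral {s..t} \<gamma> + \<epsilon> * (t - s)" by (simp add: algebra_simps)
      moreover have "integral {a..s} \<gamma> + integral {s..t} \<gamma> = integral {a..t} \<gamma>"
        using st \<gamma> by (intro Henstock_Kurzweil_Integration.integral_combine) (auto intro: integrable_on_subinterval)
      ultimately show ?thesis by (simp add: \<psi>_def)
    qed
    ultimately show "\<exists>\<delta>>0. \<forall>s t. a \<le> s \<longrightarrow> s \<le> t \<longrightarrow> t \<le> b \<longrightarrow> t - s < \<delta> \<longrightarrow> \<psi> t \<le> \<psi> s + \<epsilon> * (t - s)"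
      by blast
  qed
  then show ?thesis by (simp add: \<psi>_def)
qed

lemma norm_power2_has_derivative:
  fixes q :: "real \<Rightarrow> 'a::real_inner"
  assumes "(q has_vector_derivative d) (at t within S)"
  shows "((\<lambda>t. (norm (q t))\<^sup>2) has_real_derivative 2 * inner d (q t)) (at t within S)"
proof -
  have "((\<lambda>t. inner (q t) (q t)) has_derivative (\<lambda>h. inner (q t) (h *\<^sub>R d) + inner (h *\<^sub>R d) (q t))) (at t within S)"
    using assms unfolding has_vector_derivative_def by (intro derivative_intros)
  then show ?thesis
    unfolding power2_norm_eq_inner has_field_derivative_def
    by (rule has_derivative_eq_rhs) (auto simp: inner_commute)
qed

lemma decreasing_on_interval:
  fixes f :: "real \<Rightarrow> real"
  assumes "0 \<le> t" and f: "\<And>s. s \<in> {0..t} \<Longrightarrow> (f has_real_derivative f' s) (at s within {0..t})"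
    and "\<And>s. s \<in> {0..t} \<Longrightarrow> f' s \<le> 0"
  shows "f t \<le> f 0"
proof (rule DERIV_nonpos_imp_decreasing_open[OF \<open>0 \<le> t\<close>])
  fix x assume x: "0 < x" "x < t"
  then have "(f has_real_derivative f' x) (at x)"
    using f[of x] at_within_interior[of x "{0..t}"] by simp
  then show "\<exists>y. (f has_real_derivative y) (at x) \<and> y \<le> 0" using assms(3)[of x] x by auto
next
  show "continuous_on {0..t} f" using f by (intro DERIV_continuous_on) auto
qed

lemma decreasing_if_derivative_nonpos:
  fixes f :: "real \<Rightarrow> real"
  assumes "0 \<le> t" and f: "\<And>s. 0 \<le> s \<Longrightarrow> (f has_real_derivative f' s) (at s within {0..})"
    and "\<And>s. 0 \<le> s \<Longrightarrow> f' s \<le> 0"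
  shows "f t \<le> f 0"
proof (rule decreasing_on_interval[OF \<open>0 \<le> t\<close>])
  show "(f has_real_derivative f' s) (at s within {0..t})" if "s \<in> {0..t}" for s
    by (rule has_field_derivative_subset[OF f]) (use that in auto)
qed (use assms(3) in auto)

section \<open>Inverses of strictly positive self-adjoint operators\<close>

text \<open>
  Replacing \<open>u\<close> by \<open>-i u\<close> turns the imaginary part of the complex identity into a real part.
\<close>

lemma linear_operator_weak_iff:
  assumes A: "linear_operator A"
  shows "(\<forall>u\<in>dom A. cinner (the (A u)) x = cinner u w) \<longleftrightarrow>
    (\<forall>u\<in>dom A. inner (the (A u)) x = inner u w)" (is "?l \<longleftrightarrow> ?r")
proof
  assume ?l then show ?r by (simp add: inner_eq_Re_cinner)
next
  assume r: ?r
  show ?l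
  proof
    fix u assume u: "u \<in> dom A"
    have "complex_vector.subspace (dom A)" using A by (simp add: linear_operator_def)
    then have "- \<i> *\<^sub>C u \<in> dom A" using u by (rule complex_vector.subspace_scale)
    moreover have "the (A (- \<i> *\<^sub>C u)) = - \<i> *\<^sub>C the (A u)"
      using A u unfolding linear_operator_def by blast
    ultimately have "inner (the (A u)) (\<i> *\<^sub>C x) = inner u (\<i> *\<^sub>C w)"
      using r by (metis complex_cnj_i inner_scaleC_right)
    then show "cinner (the (A u)) x = cinner u w" using r u by (intro cinner_eqI) auto
  qed
qed

lemma linear_operator_inverse:
  fixes R :: "'a::complex_inner \<Rightarrow> 'a"
  assumes A: "linear_operator A" and AR: "\<And>x y. A x = Some y \<longleftrightarrow> x = R y"
  shows "R (x + y) = R x + R y" "R (c *\<^sub>C x) = c *\<^sub>C R x" "R (r *\<^sub>R x) = r *\<^sub>R R x"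
proof -
  have S: "A (R y) = Some y" for y using AR by blast
  have D: "R y \<in> dom A" for y using S by blast
  have sub: "complex_vector.subspace (dom A)" using A by (simp add: linear_operator_def)
  have "the (A (R x + R y)) = x + y"
    using A D S unfolding linear_operator_def by (metis option.sel)
  moreover have "R x + R y \<in> dom A"
    using sub D D by (rule complex_vector.subspace_add)
  ultimately show "R (x + y) = R x + R y" by (metis AR domIff option.collapse)
  have "the (A (c *\<^sub>C R x)) = c *\<^sub>C x \<and> c *\<^sub>C R x \<in> dom A" for c x
    using A D[of x] S[of x] complex_vector.subspace_scale[OF sub D[of x], of c] unfolding linear_operator_def
    by (metis option.sel)
  then show scC: "R (c *\<^sub>C x) = c *\<^sub>C R x" for c x by (metis AR domIff option.collapse)
  show "R (r *\<^sub>R x) = r *\<^sub>R R x" using scC[of "complex_of_real r" x] by (simp add: scaleC_of_real)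
qed

lemma self_adjoint_inverse_symmetric:
  fixes R :: "'a::complex_inner \<Rightarrow> 'a"
  assumes A: "self_adjoint A" and AR: "\<And>x y. A x = Some y \<longleftrightarrow> x = R y"
  shows "inner (R x) y = inner x (R y)"
proof -
  have "A (R x) = Some x" "A (R y) = Some y" using AR by blast+
  with A have "\<forall>u\<in>dom A. cinner (the (A u)) (R y) = cinner u y" by (simp add: self_adjoint_def)
  with \<open>A (R x) = Some x\<close> have "cinner x (R y) = cinner (R x) y" by force
  then show ?thesis by (simp add: inner_eq_Re_cinner)
qed

text \<open>
  Coercivity makes \<open>A\<close> injective with closed range, and a vector orthogonal to the range lies in the
  kernel of \<open>A\<^sup>* = A\<close>, hence vanishes.
\<close>

theorem strictly_positive_inverse:
  fixes A :: "'a::complex_hilbert operator"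
  assumes A: "self_adjoint A" and pos: "strictly_positive A"
  obtains R m where "bounded_linear R" "\<And>c x. R (c *\<^sub>C x) = c *\<^sub>C R x"
    "\<And>x y. A x = Some y \<longleftrightarrow> x = R y" "\<And>x y. inner (R x) y = inner x (R y)"
    "m > 0" "\<And>x. m * (norm (R x))\<^sup>2 \<le> inner (R x) x"
proof -
  have lin: "linear_operator A" using A by (simp add: self_adjoint_def)
  have graph: "A x = Some w \<longleftrightarrow> (\<forall>u\<in>dom A. inner (the (A u)) x = inner u w)" for x w
    using A linear_operator_weak_iff[OF lin] by (simp add: self_adjoint_def)
  obtain m where m: "m > 0" "\<And>x. x \<in> dom A \<Longrightarrow> m * (norm x)\<^sup>2 \<le> inner (the (A x)) x"
    using pos by (auto simp: strictly_positive_def inner_eq_Re_cinner)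
  have bound: "m * norm x \<le> norm y" if "A x = Some y" for x y
  proof -
    have "m * (norm x)\<^sup>2 \<le> inner y x" using m(2)[of x] that by auto
    also have "\<dots> \<le> norm y * norm x" by (rule norm_cauchy_schwarz)
    finally show ?thesis by (cases "x = 0") (auto simp: power2_eq_square)
  qed
  have comb: "A (a *\<^sub>R x + b *\<^sub>R x') = Some (a *\<^sub>R y + b *\<^sub>R y')" if "A x = Some y" "A x' = Some y'" for a b x x' y y'
  proof -
    have "\<forall>u\<in>dom A. inner (the (A u)) (a *\<^sub>R x + b *\<^sub>R x') = inner u (a *\<^sub>R y + b *\<^sub>R y')"
      using that unfolding graph by (simp add: inner_add_right)
    then show ?thesis unfolding graph .
  qed
  have diff: "A (x - x') = Some (y - y')" if "A x = Some y" "A x' = Some y'" for x x' y y'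
    using comb[OF that, of 1 "-1"] by simp
  define W where "W = {y. \<exists>x. A x = Some y}"
  have "subspace W" unfolding subspace_def
  proof (intro conjI ballI allI)
    have "A 0 = Some 0" unfolding graph by simp
    then show "0 \<in> W" by (auto simp: W_def)
  next
    fix x y assume "x \<in> W" "y \<in> W"
    then show "x + y \<in> W" using comb[of _ x _ y 1 1] by (auto simp: W_def)
  next
    fix c x assume "x \<in> W"
    then show "c *\<^sub>R x \<in> W" using comb[of _ x _ x c 0] by (auto simp: W_def)
  qed
  then have "closure W = UNIV"
  proof (rule dense_subspaceI)
    fix y assume "\<And>v. v \<in> W \<Longrightarrow> inner v y = 0"
    then have "inner (the (A u)) y = inner u 0" if "u \<in> dom A" for u
      using that by (force simp: W_def)
    then have "A y = Some 0" unfolding graph by blast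
    from bound[OF this] have "m * norm y \<le> 0" by simp
    with m(1) show "y = 0" by (simp add: mult_le_0_iff)
  qed
  moreover have "closed W"
    unfolding closed_sequential_limits
  proof (intro allI impI, elim conjE)
    fix y l assume "\<forall>n. y n \<in> W" and yl: "y \<longlonglongrightarrow> l"
    then obtain x where x: "\<And>n. A (x n) = Some (y n)" unfolding W_def mem_Collect_eq by metis
    have "Cauchy x"
    proof (rule CauchyI)
      fix e :: real assume "e > 0"
      then have "e * m > 0" using m by simp
      with yl obtain N where N: "\<And>j k. j \<ge> N \<Longrightarrow> k \<ge> N \<Longrightarrow> norm (y j - y k) < e * m"
        using CauchyD[OF LIMSEQ_imp_Cauchy] by meson
      have "norm (x j - x k) < e" if "j \<ge> N" "k \<ge> N" for j k
      proof -
        have "m * norm (x j - x k) < m * e" using bound[OF diff[OF x x]] N[OF that] by (metis le_less_trans mult.commute)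
        then show ?thesis using m by simp
      qed
      then show "\<exists>N. \<forall>j\<ge>N. \<forall>k\<ge>N. norm (x j - x k) < e" by blast
    qed
    then obtain p where xp: "x \<longlonglongrightarrow> p" using Cauchy_convergent_iff convergent_def by blast
    have "inner (the (A u)) p = inner u l" if "u \<in> dom A" for u
    proof (rule LIMSEQ_unique)
      show "(\<lambda>n. inner (the (A u)) (x n)) \<longlonglongrightarrow> inner (the (A u)) p" by (intro tendsto_intros xp)
      have "inner (the (A u)) (x n) = inner u (y n)" for n using x that unfolding graph by blast
      then show "(\<lambda>n. inner (the (A u)) (x n)) \<longlonglongrightarrow> inner u l" by (simp add: tendsto_inner[OF tendsto_const yl])
    qed
    then have "A p = Some l" unfolding graph by blast
    then show "l \<in> W" by (auto simp: W_def)
  qed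
  ultimately have "W = UNIV" by simp
  then have "\<forall>y. \<exists>x. A x = Some y" by (auto simp: W_def)
  then have "\<exists>R. \<forall>y. A (R y) = Some y" by (rule choice)
  then obtain R where R: "\<And>y. A (R y) = Some y" by blast
  have AR: "A x = Some y \<longleftrightarrow> x = R y" for x y
  proof
    assume "A x = Some y"
    from bound[OF diff[OF this R[of y]]] have "m * norm (x - R y) \<le> 0" by simp
    with m(1) show "x = R y" by (simp add: mult_le_0_iff)
  qed (simp add: R)
  note lR = linear_operator_inverse[of A R, OF lin AR]
  have "m * (norm (R y))\<^sup>2 \<le> inner (R y) y" for y
    using m(2)[of "R y"] R[of y] by (auto simp: inner_commute)
  moreover have "bounded_linear R"
  proof (rule bounded_linear_intro[where K = "1 / m"])
    show "norm (R y) \<le> norm y * (1 / m)" for y using bound[OF R] m by (simp add: field_simps)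
  qed (use lR in auto)
  ultimately show thesis
    by (intro that[of R m] lR(2) AR self_adjoint_inverse_symmetric[of A R, OF A AR] m(1))
qed

section \<open>Square roots\<close>

text \<open>
  For \<open>Y = 1 - R\<close>, the operators \<open>1 - W\<^sub>n\<close> tend to the square root of \<open>R\<close>, because \<open>W = (Y + W\<^sup>2) / 2\<close>
  says \<open>(1 - W)\<^sup>2 = 1 - Y\<close>.
\<close>

primrec sqrt_iter :: "('a::real_vector \<Rightarrow> 'a) \<Rightarrow> nat \<Rightarrow> 'a \<Rightarrow> 'a" where
  "sqrt_iter Y 0 = (\<lambda>x. 0)"
| "sqrt_iter Y (Suc n) = (\<lambda>x. (1/2) *\<^sub>R (Y x + sqrt_iter Y n (sqrt_iter Y n x)))"

text \<open>
  The same iteration for the number \<open>Y = 1\<close>.  It increases to \<open>1\<close> and majorizes the operator iteration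
  when \<open>\<parallel>Y\<parallel> \<le> 1\<close>.
\<close>

primrec sqrt_iter_bound :: "nat \<Rightarrow> real" where
  "sqrt_iter_bound 0 = 0"
| "sqrt_iter_bound (Suc n) = (1 + (sqrt_iter_bound n)\<^sup>2) / 2"

lemma sqrt_iter_bound_props:
  "0 \<le> sqrt_iter_bound n" "sqrt_iter_bound n \<le> 1" "sqrt_iter_bound n \<le> sqrt_iter_bound (Suc n)"
proof -
  have "0 \<le> sqrt_iter_bound n \<and> sqrt_iter_bound n \<le> 1"
    by (induction n) (auto simp: power_le_one)
  then show "0 \<le> sqrt_iter_bound n" "sqrt_iter_bound n \<le> 1" by auto
  have "0 \<le> (1 - sqrt_iter_bound n)\<^sup>2" by simp
  then show "sqrt_iter_bound n \<le> sqrt_iter_bound (Suc n)" by (simp add: power2_eq_square algebra_simps)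
qed

lemma sqrt_iter_props:
  fixes Y :: "'a::real_inner \<Rightarrow> 'a"
  assumes Y: "bounded_linear Y" and c: "\<And>x. norm (Y x) \<le> norm x"
    and sym: "\<And>x y. inner (Y x) y = inner x (Y y)"
  shows bounded_linear_sqrt_iter: "bounded_linear (sqrt_iter Y n)"
    and norm_sqrt_iter: "norm (sqrt_iter Y n x) \<le> sqrt_iter_bound n * norm x"
    and sqrt_iter_commute: "bounded_linear D \<Longrightarrow> (\<And>x. D (Y x) = Y (D x)) \<Longrightarrow> D (sqrt_iter Y n x) = sqrt_iter Y n (D x)"
    and sqrt_iter_symmetric: "inner (sqrt_iter Y n x) y = inner x (sqrt_iter Y n y)"
proof -
  show "bounded_linear (sqrt_iter Y n)"
    by (induction n)
      (auto intro!: bounded_linear_const_scaleR bounded_linear_add Y bounded_linear_zero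
        intro: bounded_linear_compose)
  show "norm (sqrt_iter Y n x) \<le> sqrt_iter_bound n * norm x"
  proof (induction n arbitrary: x)
    case (Suc n)
    have "norm (sqrt_iter Y n (sqrt_iter Y n x)) \<le> sqrt_iter_bound n * (sqrt_iter_bound n * norm x)"
      using Suc sqrt_iter_bound_props(1) by (meson mult_left_mono order_trans)
    then have "norm (Y x + sqrt_iter Y n (sqrt_iter Y n x)) \<le> norm x + (sqrt_iter_bound n)\<^sup>2 * norm x"
      using c[of x] norm_triangle_mono by (metis mult.assoc power2_eq_square)
    then show ?case by (simp add: distrib_right)
  qed simp
  show "D (sqrt_iter Y n x) = sqrt_iter Y n (D x)" if D: "bounded_linear D" "\<And>x. D (Y x) = Y (D x)"
  proof -
    interpret D: bounded_linear D by fact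
    show ?thesis by (induction n arbitrary: x) (auto simp: D.zero D.scaleR D.add D(2))
  qed
  show "inner (sqrt_iter Y n x) y = inner x (sqrt_iter Y n y)"
    by (induction n arbitrary: x y) (auto simp: inner_add_left inner_add_right sym)
qed

text \<open>
  All iterates commute, so
  \<open>W\<^sub>n\<^sub>+\<^sub>2 - W\<^sub>n\<^sub>+\<^sub>1 = (W\<^sub>n\<^sub>+\<^sub>1\<^sup>2 - W\<^sub>n\<^sup>2) / 2 = (W\<^sub>n\<^sub>+\<^sub>1 + W\<^sub>n) (W\<^sub>n\<^sub>+\<^sub>1 - W\<^sub>n) / 2\<close>, and the scalar iteration satisfies
  the same identity.
\<close>

lemma sqrt_iter_increment:
  fixes Y :: "'a::real_inner \<Rightarrow> 'a"
  assumes Y: "bounded_linear Y" and c: "\<And>x. norm (Y x) \<le> norm x"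
    and sym: "\<And>x y. inner (Y x) y = inner x (Y y)"
  shows "norm (sqrt_iter Y (Suc n) x - sqrt_iter Y n x) \<le> (sqrt_iter_bound (Suc n) - sqrt_iter_bound n) * norm x"
proof (induction n arbitrary: x)
  case 0
  then show ?case using norm_sqrt_iter[OF assms, of 1 x] by simp
next
  case (Suc n)
  let ?W = "sqrt_iter Y" and ?w = sqrt_iter_bound
  interpret W: bounded_linear "?W k" for k by (rule bounded_linear_sqrt_iter[OF assms])
  have "Y (?W k x) = ?W k (Y x)" for k x by (rule sqrt_iter_commute[OF assms Y]) simp
  then have comm: "?W k (?W l x) = ?W l (?W k x)" for k l x
    by (intro sqrt_iter_commute[OF assms] W.bounded_linear_axioms) simp
  let ?d = "?W (Suc n) x - ?W n x"
  have "?W (Suc (Suc n)) x - ?W (Suc n) x = (1/2) *\<^sub>R (?W (Suc n) (?W (Suc n) x) - ?W n (?W n x))"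
    by (simp only: sqrt_iter.simps(2)[of Y "Suc n"] sqrt_iter.simps(2)[of Y n, THEN fun_cong, of x]
        scaleR_diff_right[symmetric]) simp
  also have "?W (Suc n) (?W (Suc n) x) - ?W n (?W n x) = ?W (Suc n) ?d + ?W n ?d"
    using comm[of n "Suc n" x] by (simp only: W.diff) simp
  finally have "norm (?W (Suc (Suc n)) x - ?W (Suc n) x) = norm (?W (Suc n) ?d + ?W n ?d) / 2"
    by simp
  also have "\<dots> \<le> (?w (Suc n) * norm ?d + ?w n * norm ?d) / 2"
    by (intro divide_right_mono norm_triangle_mono norm_sqrt_iter[OF assms]) auto
  also have "\<dots> = (?w (Suc n) + ?w n) / 2 * norm ?d" by (simp add: algebra_simps)
  also have "\<dots> \<le> (?w (Suc n) + ?w n) / 2 * ((?w (Suc n) - ?w n) * norm x)"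
  proof (rule mult_left_mono)
    show "norm ?d \<le> (?w (Suc n) - ?w n) * norm x" by (rule Suc.IH)
    have "0 \<le> ?w n" "0 \<le> ?w (Suc n)" by (rule sqrt_iter_bound_props(1))+
    then show "0 \<le> (?w (Suc n) + ?w n) / 2" by (simp del: sqrt_iter_bound.simps)
  qed
  also have "\<dots> = (?w (Suc (Suc n)) - ?w (Suc n)) * norm x"
    unfolding sqrt_iter_bound.simps(2)[of "Suc n"] sqrt_iter_bound.simps(2)[of n]
    by (simp add: power2_eq_square field_simps)
  finally show ?case .
qed

text \<open>
  The last hypothesis is \<open>\<parallel>1 - R\<parallel> \<le> 1\<close> in disguise.  The increments of the iteration are then
  dominated by a convergent telescoping series.
\<close>

theorem bounded_positive_square_root:
  fixes R :: "'a::{real_inner,banach} \<Rightarrow> 'a"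
  assumes R: "bounded_linear R" and sym: "\<And>x y. inner (R x) y = inner x (R y)"
    and le: "\<And>x. (norm (R x))\<^sup>2 \<le> 2 * inner (R x) x"
  shows "\<exists>Q. bounded_linear Q \<and> (\<forall>x. Q (Q x) = R x) \<and> (\<forall>x y. inner (Q x) y = inner x (Q y)) \<and>
    (\<forall>x. 0 \<le> inner (Q x) x) \<and>
    (\<forall>D. bounded_linear D \<longrightarrow> (\<forall>x. D (R x) = R (D x)) \<longrightarrow> (\<forall>x. D (Q x) = Q (D x)))"
proof -
  interpret R: bounded_linear R by fact
  define Y where "Y x = x - R x" for x
  have Y: "bounded_linear Y" unfolding Y_def by (intro bounded_linear_intros R)
  have Yc: "norm (Y x) \<le> norm x" for x
  proof (rule power2_le_imp_le)
    have "(norm (Y x))\<^sup>2 = (norm x)\<^sup>2 - 2 * inner (R x) x + (norm (R x))\<^sup>2"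
      by (simp add: Y_def power2_norm_eq_inner inner_diff inner_commute algebra_simps)
    then show "(norm (Y x))\<^sup>2 \<le> (norm x)\<^sup>2" using le[of x] by simp
  qed simp
  have Ysym: "inner (Y x) y = inner x (Y y)" for x y by (simp add: Y_def inner_diff sym)
  note Yp = Y Yc Ysym
  let ?W = "sqrt_iter Y" and ?w = sqrt_iter_bound
  have inc: "norm (?W (n + k) x - ?W n x) \<le> (?w (n + k) - ?w n) * norm x" for n k x
  proof (induction k)
    case (Suc k)
    have "norm (?W (n + Suc k) x - ?W n x) \<le> norm (?W (Suc (n + k)) x - ?W (n + k) x) + norm (?W (n + k) x - ?W n x)"
      by (metis add_Suc_right diff_add_cancel norm_triangle_ineq add_diff_eq)
    also have "\<dots> \<le> (?w (Suc (n + k)) - ?w (n + k)) * norm x + (?w (n + k) - ?w n) * norm x"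
      by (intro add_mono Suc sqrt_iter_increment[OF Yp])
    also have "\<dots> = (?w (n + Suc k) - ?w n) * norm x" by (simp only: add_Suc_right) (simp add: algebra_simps)
    finally show ?case .
  qed simp
  have "incseq ?w" using sqrt_iter_bound_props(3) by (rule incseq_SucI)
  then have "convergent ?w"
    using Bseq_mono_convergent[of ?w] sqrt_iter_bound_props
    by (metis BseqI' abs_of_nonneg incseq_def real_norm_def)
  then have wC: "Cauchy ?w" by (rule convergent_Cauchy)
  have "Cauchy (\<lambda>n. ?W n x)" for x
  proof (rule CauchyI')
    fix e :: real assume e: "e > 0"
    then have "e / (norm x + 1) > 0" by (simp add: add_nonneg_pos)
    then obtain N where N: "\<And>m n. m \<ge> N \<Longrightarrow> n \<ge> N \<Longrightarrow> norm (?w m - ?w n) < e / (norm x + 1)"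
      using CauchyD[OF wC] by meson
    have "norm (?W m x - ?W n x) < e" if "m \<ge> N" "n > m" for m n
    proof -
      have "norm (?W n x - ?W m x) \<le> (?w n - ?w m) * norm x" using inc[of m "n - m" x] that by simp
      also have "\<dots> \<le> e / (norm x + 1) * norm x"
        using N[of n m] that by (intro mult_right_mono) auto
      also have "\<dots> < e"
      proof -
        have "norm x + 1 > 0" by (simp add: add_nonneg_pos)
        then show ?thesis using e by (simp add: field_simps)
      qed
      finally show ?thesis by (simp add: norm_minus_commute)
    qed
    then show "\<exists>M. \<forall>m\<ge>M. \<forall>n>m. dist (?W m x) (?W n x) < e" unfolding dist_norm by blast
  qed
  then have "\<forall>x. \<exists>l. (\<lambda>n. ?W n x) \<longlonglongrightarrow> l" using Cauchy_convergent_iff convergent_def by blast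
  then obtain W where W: "\<And>x. (\<lambda>n. ?W n x) \<longlonglongrightarrow> W x" by metis
  interpret Wn: bounded_linear "?W k" for k by (rule bounded_linear_sqrt_iter[OF Yp])
  have nWn: "norm (?W n x) \<le> norm x" for n x
    using norm_sqrt_iter[OF Yp, of n x] mult_right_mono[OF sqrt_iter_bound_props(2)[of n] norm_ge_zero[of x]] by simp
  have nW: "norm (W x) \<le> norm x" for x
    by (rule LIMSEQ_le_const2[OF tendsto_norm[OF W]]) (use nWn in auto)
  have lW: "bounded_linear W"
  proof (rule bounded_linear_intro[where K = 1])
    show "W (x + y) = W x + W y" for x y
      by (rule LIMSEQ_unique[OF W]) (simp add: Wn.add tendsto_add[OF W W])
    show "W (r *\<^sub>R x) = r *\<^sub>R W x" for r x
      by (rule LIMSEQ_unique[OF W]) (simp add: Wn.scaleR tendsto_scaleR[OF tendsto_const W])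
  qed (use nW in auto)
  interpret W: bounded_linear W by fact
  have WW: "(\<lambda>n. ?W n (?W n x)) \<longlonglongrightarrow> W (W x)" for x
  proof -
    have "(\<lambda>n. ?W n (?W n x - W x)) \<longlonglongrightarrow> 0"
      by (rule Lim_null_comparison[where g = "\<lambda>n. norm (?W n x - W x)"])
        (use nWn tendsto_norm_zero[OF LIM_zero[OF W[of x]]] in auto)
    from tendsto_add[OF this W[of "W x"]] show ?thesis by (simp add: Wn.diff)
  qed
  have fixW: "2 *\<^sub>R W x = Y x + W (W x)" for x
  proof -
    have "(\<lambda>n. ?W (Suc n) x) \<longlonglongrightarrow> (1/2) *\<^sub>R (Y x + W (W x))"
      unfolding sqrt_iter.simps by (intro tendsto_intros WW)
    then have "W x = (1/2) *\<^sub>R (Y x + W (W x))" using W LIMSEQ_Suc LIMSEQ_unique by blast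
    then have "2 *\<^sub>R W x = 2 *\<^sub>R (1/2) *\<^sub>R (Y x + W (W x))" by (rule arg_cong)
    then show ?thesis by simp
  qed
  define Q where "Q x = x - W x" for x
  show ?thesis
  proof (intro exI[of _ Q] conjI allI impI)
    show "bounded_linear Q" unfolding Q_def by (intro bounded_linear_intros lW)
    show "Q (Q x) = R x" for x
      using fixW[of x] by (simp add: Q_def W.diff Y_def scaleR_2 algebra_simps)
    have "inner (W x) y = inner x (W y)" for x y
    proof (rule LIMSEQ_unique)
      show "(\<lambda>n. inner (?W n x) y) \<longlonglongrightarrow> inner (W x) y" by (intro tendsto_intros W)
      show "(\<lambda>n. inner (?W n x) y) \<longlonglongrightarrow> inner x (W y)"
        unfolding sqrt_iter_symmetric[OF Yp] by (intro tendsto_intros W)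
    qed
    then show "inner (Q x) y = inner x (Q y)" for x y by (simp add: Q_def inner_diff)
    have "inner (W x) x \<le> inner x x" for x
      using norm_cauchy_schwarz[of "W x" x] mult_right_mono[OF nW norm_ge_zero, of x x]
      by (simp add: power2_norm_eq_inner[symmetric] power2_eq_square)
    then show "0 \<le> inner (Q x) x" for x by (simp add: Q_def inner_diff)
    show "D (Q x) = Q (D x)" if D: "bounded_linear D" "\<forall>x. D (R x) = R (D x)" for D x
    proof -
      interpret D: bounded_linear D by fact
      have "D (Y x) = Y (D x)" for x by (simp add: Y_def D.diff D(2))
      then have "D (?W n x) = ?W n (D x)" for n by (rule sqrt_iter_commute[OF Yp D(1)])
      then have "D (W x) = W (D x)" using D.tendsto[OF W[of x]] W[of "D x"] LIMSEQ_unique by simp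
      then show ?thesis by (simp add: Q_def D.diff)
    qed

  qed
qed

text \<open>
  The degenerate case of the Cauchy-Schwarz inequality for the form \<open>\<langle>Q x, y\<rangle>\<close>, tested with
  \<open>z = Q y\<close>.
\<close>

lemma positive_form_zero:
  fixes Q :: "'a::real_inner \<Rightarrow> 'a"
  assumes "bounded_linear Q" and sym: "\<And>x y. inner (Q x) y = inner x (Q y)"
    and pos: "\<And>x. 0 \<le> inner (Q x) x" and y: "inner (Q y) y = 0"
  shows "Q y = 0"
proof -
  interpret Q: bounded_linear Q by fact
  define z where "z = Q y"
  define b where "b = inner z z"
  define k where "k = inner (Q z) z"
  have q: "0 \<le> 2 * t * b + t\<^sup>2 * k" for t
  proof -
    have "inner (Q (y + t *\<^sub>R z)) (y + t *\<^sub>R z) = inner (Q y) y + 2 * t * b + t\<^sup>2 * k"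
      by (simp add: Q.add Q.scaleR inner_add_left inner_add_right sym[of z y] power2_eq_square
          b_def k_def) (simp add: z_def algebra_simps)
    then show ?thesis using pos[of "y + t *\<^sub>R z"] y by simp
  qed
  have "k \<ge> 0" unfolding k_def by (rule pos)
  have "b = 0"
  proof (rule ccontr)
    assume "b \<noteq> 0"
    then have "b > 0" unfolding b_def by (metis inner_ge_zero less_eq_real_def)
    \<comment> \<open>For small negative \<open>t\<close> the linear term of \<open>2 t b + t\<^sup>2 k\<close> dominates.\<close>
    define t where "t = - b / (k + 1)"
    have "t < 0" "t * (k + 1) = - b" using \<open>b > 0\<close> \<open>k \<ge> 0\<close> by (auto simp: t_def field_simps)
    have "2 * t * b + t\<^sup>2 * k = t * (2 * b + t * k)" by (simp add: power2_eq_square algebra_simps)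
    also have "t * k = - b - t" using \<open>t * (k + 1) = - b\<close> by (simp add: algebra_simps)
    finally have "0 \<le> t * (b - t)" using q[of t] by (simp add: algebra_simps)
    then show False using \<open>t < 0\<close> \<open>b > 0\<close> by (simp add: zero_le_mult_iff)
  qed
  then show ?thesis by (simp add: b_def z_def)
qed

text \<open>
  For \<open>y = Q x - Q' x\<close> the two nonnegative numbers \<open>\<langle>Q y, y\<rangle>\<close> and \<open>\<langle>Q' y, y\<rangle>\<close> add up to
  \<open>\<langle>(Q\<^sup>2 - Q'\<^sup>2) x, y\<rangle> = 0\<close>.
\<close>

lemma bounded_positive_square_root_unique:
  fixes Q Q' :: "'a::real_inner \<Rightarrow> 'a"
  assumes Q: "bounded_linear Q" "\<And>x y. inner (Q x) y = inner x (Q y)" "\<And>x. 0 \<le> inner (Q x) x"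
    and Q': "bounded_linear Q'" "\<And>x. 0 \<le> inner (Q' x) x"
    and comm: "\<And>x. Q' (Q x) = Q (Q' x)" and sq: "\<And>x. Q' (Q' x) = Q (Q x)"
    and inj: "\<And>x. Q x = 0 \<Longrightarrow> x = 0"
  shows "Q x = Q' x"
proof -
  interpret Q: bounded_linear Q by fact
  interpret Q': bounded_linear Q' by fact
  define y where "y = Q x - Q' x"
  have "Q y + Q' y = 0" by (simp add: y_def Q.diff Q'.diff comm sq)
  then have "inner (Q y) y + inner (Q' y) y = 0" by (metis inner_add_left inner_zero_left)
  then have "inner (Q y) y = 0" using Q(3)[of y] Q'(2)[of y] by simp
  then have "Q y = 0" by (rule positive_form_zero[OF Q])
  then have "y = 0" by (rule inj)
  then show ?thesis by (simp add: y_def)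
qed

definition inverse_operator :: "('a \<Rightarrow> 'a) \<Rightarrow> 'a operator" where
  "inverse_operator Q = (\<lambda>x. if x \<in> range Q then Some (inv Q x) else None)"

lemma inverse_operator_iff:
  assumes "inj Q"
  shows "inverse_operator Q x = Some y \<longleftrightarrow> x = Q y"
proof (cases "x \<in> range Q")
  case True
  then show ?thesis using assms by (auto simp: inverse_operator_def inv_f_f)
qed (auto simp: inverse_operator_def)

lemma dense_range_symmetric:
  fixes Q :: "'a::{real_inner,banach} \<Rightarrow> 'a"
  assumes Q: "bounded_linear Q" and sym: "\<And>x y. inner (Q x) y = inner x (Q y)" and inj: "inj Q"
  shows "closure (range Q) = UNIV"
proof (rule dense_subspaceI)
  interpret Q: bounded_linear Q by fact
  show "subspace (range Q)"
    by (simp add: linear_subspace_image Q.linear_axioms)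
  fix y assume *: "\<And>v. v \<in> range Q \<Longrightarrow> inner v y = 0"
  have "inner v (Q y) = inner v 0" for v using *[of "Q v"] by (simp add: sym)
  then have "Q y = Q 0" unfolding Q.zero by (rule eq_if_inner_eq)
  then show "y = 0" by (rule injD[OF inj])
qed

lemma self_adjoint_inverse_operator:
  fixes Q :: "'a::complex_hilbert \<Rightarrow> 'a"
  assumes Q: "bounded_linear Q" and sc: "\<And>c x. Q (c *\<^sub>C x) = c *\<^sub>C Q x"
    and sym: "\<And>x y. inner (Q x) y = inner x (Q y)" and inj: "inj Q"
  shows "self_adjoint (inverse_operator Q)"
proof -
  interpret Q: bounded_linear Q by fact
  note iff = inverse_operator_iff[OF inj]
  have dm: "dom (inverse_operator Q) = range Q"
    by (auto simp: inverse_operator_def dom_def split: if_splits)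
  have val': "inverse_operator Q (Q y) = Some y" for y by (simp add: iff)
  have val: "the (inverse_operator Q (Q y)) = y" for y by (simp add: val')
  have lin: "linear_operator (inverse_operator Q)"
    unfolding linear_operator_def dm
  proof (intro conjI ballI allI)
    show "complex_vector.subspace (range Q)"
      unfolding complex_vector.subspace_def
      by (auto intro: rev_image_eqI[of 0] simp: Q.zero simp flip: Q.add sc)
  qed (auto simp: val simp flip: Q.add sc)
  have "closure (range Q) = UNIV" by (rule dense_range_symmetric[OF Q sym inj])
  moreover have "inverse_operator Q x = Some w \<longleftrightarrow>
      (\<forall>u\<in>dom (inverse_operator Q). inner (the (inverse_operator Q u)) x = inner u w)" for x w
  proof -
    have "(\<forall>u\<in>dom (inverse_operator Q). inner (the (inverse_operator Q u)) x = inner u w)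
        \<longleftrightarrow> (\<forall>v. inner v x = inner v (Q w))" unfolding dm by (simp add: val sym)
    also have "\<dots> \<longleftrightarrow> x = Q w" using eq_if_inner_eq[of x "Q w"] by blast
    finally show ?thesis by (simp only: iff)
  qed
  ultimately show ?thesis
    using lin unfolding self_adjoint_def linear_operator_weak_iff[OF lin] by (simp only: dm) simp
qed

text \<open>
  If \<open>Q\<close> is the positive square root of \<open>A\<^sup>-\<^sup>1\<close>, then \<open>Q\<^sup>-\<^sup>1\<close> is a positive self-adjoint square root of
  \<open>A\<close>.  It is the only one: any other such \<open>S\<close> is a bijection from its domain onto the space, and
  \<open>S\<^sup>-\<^sup>1\<close> is a bounded positive square root of \<open>A\<^sup>-\<^sup>1\<close>, hence equal to \<open>Q\<close>.
\<close>

theorem sqrt_operator_inverse: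
  fixes A :: "'a::complex_hilbert operator"
  assumes A: "self_adjoint A" "strictly_positive A"
  obtains Q where "bounded_linear Q" "\<And>c x. Q (c *\<^sub>C x) = c *\<^sub>C Q x"
    "\<And>x y. inner (Q x) y = inner x (Q y)" "inj Q"
    "\<And>x y. A x = Some y \<longleftrightarrow> x = Q (Q y)"
    "\<And>x y. sqrt_operator A x = Some y \<longleftrightarrow> x = Q y"
proof -
  obtain R m where R: "bounded_linear R" "\<And>c x. R (c *\<^sub>C x) = c *\<^sub>C R x"
    and AR: "\<And>x y. A x = Some y \<longleftrightarrow> x = R y" and Rsym: "\<And>x y. inner (R x) y = inner x (R y)"
    and m: "m > 0" "\<And>x. m * (norm (R x))\<^sup>2 \<le> inner (R x) x"
    by (rule strictly_positive_inverse[OF A]) blast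
  interpret R: bounded_linear R by fact
  have Rpos: "0 \<le> inner (R x) x" for x
    using m(2)[of x] m(1) by (meson mult_nonneg_nonneg less_imp_le order_trans zero_le_power2)
  have Rinj: "x = y" if "R x = R y" for x y using AR that by (metis option.inject)
  \<comment> \<open>The scaling achieves \<open>\<parallel>R' x\<parallel>\<^sup>2 \<le> \<langle>R' x, x\<rangle>\<close>; it is undone by the factor \<open>1 / \<surd>m\<close> in \<open>Q\<close>.\<close>
  define R' where "R' x = m *\<^sub>R R x" for x
  have R'bl: "bounded_linear R'" unfolding R'_def by (intro bounded_linear_const_scaleR R)
  have R'sym: "inner (R' x) y = inner x (R' y)" for x y by (simp add: R'_def Rsym)
  have R'le: "(norm (R' x))\<^sup>2 \<le> 2 * inner (R' x) x" for x
  proof -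
    have "(norm (R' x))\<^sup>2 = m * (m * (norm (R x))\<^sup>2)" using m by (simp add: R'_def power2_eq_square)
    also have "\<dots> \<le> m * inner (R x) x" using m by (intro mult_left_mono) auto
    finally have "(norm (R' x))\<^sup>2 \<le> inner (R' x) x" by (simp add: R'_def)
    moreover have "0 \<le> inner (R' x) x" using Rpos[of x] m(1) by (simp add: R'_def)
    ultimately show ?thesis by linarith
  qed
  obtain Q0 where Q0: "bounded_linear Q0" "\<And>x. Q0 (Q0 x) = R' x"
    "\<And>x y. inner (Q0 x) y = inner x (Q0 y)" "\<And>x. 0 \<le> inner (Q0 x) x"
    and Q0comm: "\<forall>D. bounded_linear D \<longrightarrow> (\<forall>x. D (R' x) = R' (D x)) \<longrightarrow> (\<forall>x. D (Q0 x) = Q0 (D x))"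
    using bounded_positive_square_root[OF R'bl R'sym R'le] by blast
  interpret Q0: bounded_linear Q0 by fact
  define Q where "Q x = (1 / sqrt m) *\<^sub>R Q0 x" for x
  have Qbl: "bounded_linear Q" unfolding Q_def by (intro bounded_linear_const_scaleR Q0)
  interpret Q: bounded_linear Q by fact
  have QQ: "Q (Q x) = R x" for x using m by (simp add: Q_def Q0.scaleR Q0(2) R'_def)
  have Qsym: "inner (Q x) y = inner x (Q y)" for x y by (simp add: Q_def Q0(3))
  have Qpos: "0 \<le> inner (Q x) x" for x using m Q0(4) by (simp add: Q_def)
  have Qcomm: "D (Q x) = Q (D x)" if "bounded_linear D" "\<And>x. D (R x) = R (D x)" for D x
  proof -
    interpret D: bounded_linear D by fact
    have "\<forall>x. D (R' x) = R' (D x)" by (simp add: R'_def D.scaleR that(2))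
    then have "D (Q0 x) = Q0 (D x)" using Q0comm that(1) by blast
    then show ?thesis by (simp add: Q_def D.scaleR)
  qed
  have Qsc: "Q (c *\<^sub>C x) = c *\<^sub>C Q x" for c x
    by (rule Qcomm[OF bounded_linear_scaleC, symmetric]) (simp add: R(2))
  have Qinj0: "x = 0" if "Q x = 0" for x using QQ[of x] that by (metis Q.zero R.zero Rinj)
  have Qinj: "inj Q" by (rule injI) (metis QQ Rinj)
  note Qiff = inverse_operator_iff[OF Qinj]
  let ?S = "inverse_operator Q"
  have comp: "(S \<circ>\<^sub>m S) x = Some y \<longleftrightarrow> (\<exists>z. S x = Some z \<and> S z = Some y)" for S :: "'a operator" and x y
    by (simp add: map_comp_def split: option.split)
  have "sqrt_operator A = ?S"
    unfolding sqrt_operator_def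
  proof (rule the_equality, intro conjI)
    show "self_adjoint ?S" by (rule self_adjoint_inverse_operator[OF Qbl Qsc Qsym Qinj])
    have val: "the (?S (Q y)) = y" for y using Qiff[of "Q y" y] by simp
    show "positive_operator ?S"
      unfolding positive_operator_def inner_eq_Re_cinner[symmetric]
    proof
      fix x assume "x \<in> dom ?S"
      then obtain y where "x = Q y" by (auto simp: Qiff)
      then show "0 \<le> inner (the (?S x)) x" using Qpos[of y] by (simp add: val inner_commute)
    qed
    have "(?S \<circ>\<^sub>m ?S) x = Some y \<longleftrightarrow> A x = Some y" for x y
      unfolding comp Qiff AR by (auto simp: QQ)
    then show "?S \<circ>\<^sub>m ?S = A" by (metis ext not_Some_eq)
  next
    fix S assume S: "self_adjoint S \<and> positive_operator S \<and> S \<circ>\<^sub>m S = A"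
    then have lin: "linear_operator S" by (simp add: self_adjoint_def)
    have SS: "(\<exists>z. S x = Some z \<and> S z = Some y) \<longleftrightarrow> x = R y" for x y
      using S AR comp[of S x y] by simp
    define Q' where "Q' y = the (S (R y))" for y
    have SR: "S (R y) = Some (Q' y) \<and> S (Q' y) = Some y" for y
      using SS[of "R y" y] by (auto simp: Q'_def)
    have Siff: "S x = Some y \<longleftrightarrow> x = Q' y" for x y
    proof
      assume x: "S x = Some y"
      have "complex_vector.subspace (dom S)" using lin by (simp add: linear_operator_def)
      then have "S 0 \<noteq> None" using complex_vector.subspace_0 by blast
      have ad: "\<forall>x\<in>dom S. \<forall>y\<in>dom S. the (S (x + y)) = the (S x) + the (S y) \<and> x + y \<in> dom S"
        and sc: "\<forall>x\<in>dom S. the (S ((-1) *\<^sub>C x)) = (-1) *\<^sub>C the (S x) \<and> (-1) *\<^sub>C x \<in> dom S"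
        using lin by (auto simp: linear_operator_def complex_vector.subspace_add complex_vector.subspace_scale
            simp del: complex_vector.scale_minus_left)
      have m1: "(-1) *\<^sub>C v = - (v :: 'a)" for v
        using scaleC_of_real[of "-1" v] by simp
      have "the (S (x - Q' y)) = 0" "x - Q' y \<in> dom S"
        using ad sc x SR[of y] unfolding m1 by (metis add.right_inverse diff_conv_add_uminus domI option.sel,
            metis diff_conv_add_uminus domI)
      then have "S (x - Q' y) = Some 0" by force
      moreover have "S 0 = Some 0"
        using ad \<open>S 0 \<noteq> None\<close> by (metis add_cancel_right_right domI domIff option.collapse)
      ultimately have "x - Q' y = R 0" using SS by blast
      then show "x = Q' y" by (simp add: R.zero)
    qed (use SR in blast)
    note lQ' = linear_operator_inverse[of S Q', OF lin Siff]
    have Q'sym: "inner (Q' x) y = inner x (Q' y)" for x y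
      by (rule self_adjoint_inverse_symmetric[of S]) (use S Siff in auto)
    have Q'Q': "Q' (Q' y) = R y" for y using SR Siff by metis
    have Q'pos: "0 \<le> inner (Q' y) y" for y
    proof -
      have "Q' y \<in> dom S" "the (S (Q' y)) = y" using SR by auto
      then have "0 \<le> inner y (Q' y)"
        using S unfolding positive_operator_def inner_eq_Re_cinner by metis
      then show ?thesis by (simp add: inner_commute)
    qed
    have "bounded_linear Q'"
    proof (rule bounded_linear_intro)
      fix y
      have "m * norm (R y) \<le> norm y"
      proof -
        have "m * (norm (R y))\<^sup>2 \<le> norm (R y) * norm y"
          using m(2)[of y] norm_cauchy_schwarz[of "R y" y] by linarith
        then show ?thesis by (cases "R y = 0") (auto simp: power2_eq_square)
      qed
      then have "norm (R y) \<le> norm y / m" using m by (simp add: field_simps)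
      have "(norm (Q' y))\<^sup>2 = inner (R y) y"
        unfolding power2_norm_eq_inner Q'sym[of y "Q' y"] Q'Q' by (rule inner_commute)
      also have "\<dots> \<le> norm (R y) * norm y" by (rule norm_cauchy_schwarz)
      also have "\<dots> \<le> norm y / m * norm y" by (rule mult_right_mono) (fact, simp)
      also have "\<dots> = (norm y * (1 / sqrt m))\<^sup>2" using m by (simp add: power2_eq_square)
      finally show "norm (Q' y) \<le> norm y * (1 / sqrt m)"
        by (rule power2_le_imp_le) (use m in simp)
    qed (use lQ' in auto)
    moreover have "Q' (Q x) = Q (Q' x)" for x
      by (rule Qcomm[OF \<open>bounded_linear Q'\<close>]) (simp flip: Q'Q')
    ultimately have "Q x = Q' x" for x
      using bounded_positive_square_root_unique[of Q Q' x, OF Qbl Qsym Qpos \<open>bounded_linear Q'\<close> Q'pos]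
      by (simp add: Q'Q' QQ Qinj0)
    then have "S x = Some y \<longleftrightarrow> ?S x = Some y" for x y unfolding Siff Qiff by simp
    then show "S = ?S" by (intro ext) (metis not_Some_eq)
  qed
  then have "sqrt_operator A x = Some y \<longleftrightarrow> x = Q y" for x y by (simp add: Qiff)
  moreover have "A x = Some y \<longleftrightarrow> x = Q (Q y)" for x y by (simp add: AR QQ)
  ultimately show thesis by (intro that[OF Qbl Qsc Qsym Qinj])
qed

section \<open>The unitary group\<close>

lemma inner_skew_symmetric:
  fixes G :: "'a::complex_inner \<Rightarrow> 'a"
  assumes sc: "\<And>c x. G (c *\<^sub>C x) = c *\<^sub>C G x" and sym: "\<And>x y. inner (G x) y = inner x (G y)"
    and c: "Re c = 0"
  shows "inner (c *\<^sub>C G x) x = 0"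
proof -
  have "cnj c = - c" using c by (simp add: complex_eq_iff)
  have "inner (c *\<^sub>C G x) x = inner (c *\<^sub>C x) (G x)" by (simp only: sc[symmetric] sym)
  also have "\<dots> = inner (G x) (c *\<^sub>C x)" by (rule inner_commute)
  also have "\<dots> = inner (cnj c *\<^sub>C G x) x" by (rule inner_scaleC_right)
  also have "\<dots> = - inner (c *\<^sub>C G x) x"
    by (simp only: \<open>cnj c = - c\<close> complex_vector.scale_minus_left inner_minus_left)
  finally show ?thesis by simp
qed

text \<open>
  With \<open>A = R\<^sup>-\<^sup>1\<close>, the operator \<open>G = (R + \<epsilon>)\<^sup>-\<^sup>1 = A (1 + \<epsilon> A)\<^sup>-\<^sup>1\<close> is the Yosida approximation of \<open>A\<close>.
\<close>

lemma shifted_inverse: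
  fixes R :: "'a::complex_hilbert \<Rightarrow> 'a"
  assumes R: "bounded_linear R" and sc: "\<And>c x. R (c *\<^sub>C x) = c *\<^sub>C R x"
    and sym: "\<And>x y. inner (R x) y = inner x (R y)" and pos: "\<And>x. 0 \<le> inner (R x) x" and "\<epsilon> > 0"
  shows "\<exists>G. bounded_linear G \<and> (\<forall>c x. G (c *\<^sub>C x) = c *\<^sub>C G x) \<and>
    (\<forall>x y. inner (G x) y = inner x (G y)) \<and> (\<forall>x. R (G x) + \<epsilon> *\<^sub>R G x = x) \<and>
    (\<forall>x. G (R x + \<epsilon> *\<^sub>R x) = x)"
proof -
  interpret R: bounded_linear R by fact
  define T where "T x = R x + \<epsilon> *\<^sub>R x" for x
  let ?A = "\<lambda>x. Some (T x)"
  have scR: "c *\<^sub>C \<epsilon> *\<^sub>R x = \<epsilon> *\<^sub>R c *\<^sub>C x" for c and x :: 'a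
    by (simp add: scaleC_scaleC mult.commute flip: scaleC_of_real)
  have Tsym: "inner (T x) y = inner x (T y)" for x y by (simp add: T_def inner_add_left inner_add_right sym)
  have Tsc: "T (c *\<^sub>C x) = c *\<^sub>C T x" for c x by (simp add: T_def sc scR scaleC_add_right)
  have lin: "linear_operator ?A"
    unfolding linear_operator_def dom_def
    by (simp add: Tsc) (simp add: T_def R.add algebra_simps complex_vector.subspace_UNIV)
  have "self_adjoint ?A"
    unfolding self_adjoint_def linear_operator_weak_iff[OF lin]
  proof (intro conjI lin allI)
    show "closure (dom ?A) = UNIV" by (simp add: dom_def)
    fix x w
    have "(\<forall>u\<in>dom ?A. inner (the (Some (T u))) x = inner u w) \<longleftrightarrow> (\<forall>u. inner u (T x) = inner u w)"
      by (simp add: dom_def Tsym)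
    also have "\<dots> \<longleftrightarrow> T x = w" using eq_if_inner_eq[of "T x" w] by blast
    finally show "(Some (T x) = Some w) = (\<forall>u\<in>dom ?A. inner (the (Some (T u))) x = inner u w)" by simp
  qed
  moreover have "strictly_positive ?A"
    unfolding strictly_positive_def inner_eq_Re_cinner[symmetric]
  proof (intro exI[of _ \<epsilon>] conjI ballI)
    show "\<epsilon> * (norm x)\<^sup>2 \<le> inner (the (Some (T x))) x" for x
      using pos[of x] by (simp add: T_def inner_add_left power2_norm_eq_inner)
  qed fact
  ultimately obtain G m where G: "bounded_linear G" "\<And>c x. G (c *\<^sub>C x) = c *\<^sub>C G x"
    "\<And>x y. Some (T x) = Some y \<longleftrightarrow> x = G y" "\<And>x y. inner (G x) y = inner x (G y)"
    and "m > 0" "\<And>x. m * (norm (G x))\<^sup>2 \<le> inner (G x) x"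
    by (rule strictly_positive_inverse) blast
  have "T (G y) = y" "G (T y) = y" for y using G(3)[of "G y" y] G(3)[of y "T y"] by simp_all
  then show ?thesis using G unfolding T_def by (intro exI[of _ G]) simp
qed

text \<open>
  The curve is \<open>u(t) = e\<^sup>i\<^sup>t\<^sup>A x\<close> with \<open>A = R\<^sup>-\<^sup>1\<close>; writing its equation as \<open>(R u)' = i u\<close> allows every \<open>x\<close>.
  It is the limit of the curves \<open>e\<^sup>i\<^sup>t\<^sup>G x\<close> for the Yosida approximations \<open>G\<close> of \<open>A\<close>: two of these with
  parameters \<open>\<epsilon>\<close>, \<open>\<delta>\<close> have generators that differ by \<open>(\<delta> - \<epsilon>) G\<^sub>\<epsilon> G\<^sub>\<delta>\<close>, which is \<open>O(\<bar>\<epsilon> - \<delta>\<bar>)\<close> on the range of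
  \<open>R\<^sup>2\<close> since \<open>\<parallel>G R\<parallel> \<le> 1\<close>.  This range is dense and all the curves are isometric in \<open>x\<close>.
\<close>

theorem unitary_orbit:
  fixes R :: "'a::complex_hilbert \<Rightarrow> 'a"
  assumes R: "bounded_linear R" and sc: "\<And>c x. R (c *\<^sub>C x) = c *\<^sub>C R x"
    and sym: "\<And>x y. inner (R x) y = inner x (R y)" and pos: "\<And>x. 0 \<le> inner (R x) x" and inj: "inj R"
  shows "\<exists>u. u 0 = x \<and> (\<forall>t\<ge>0. norm (u t) \<le> norm x \<and>
    ((\<lambda>t. R (u t)) has_vector_derivative \<i> *\<^sub>C u t) (at t within {0..}))"
proof -
  interpret R: bounded_linear R by fact
  define \<epsilon> where "\<epsilon> n = 1 / real (Suc n)" for n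
  have \<epsilon>: "\<epsilon> n > 0" for n by (simp add: \<epsilon>_def)
  have \<epsilon>0: "\<epsilon> \<longlonglongrightarrow> 0" unfolding \<epsilon>_def using LIMSEQ_inverse_real_of_nat by (simp add: inverse_eq_divide)
  have "\<forall>n. \<exists>G. bounded_linear G \<and> (\<forall>c x. G (c *\<^sub>C x) = c *\<^sub>C G x) \<and>
    (\<forall>x y. inner (G x) y = inner x (G y)) \<and> (\<forall>x. R (G x) + \<epsilon> n *\<^sub>R G x = x) \<and>
    (\<forall>x. G (R x + \<epsilon> n *\<^sub>R x) = x)"
    using shifted_inverse[OF R sc sym pos \<epsilon>] by blast
  from choice[OF this] obtain G where G: "\<And>n. bounded_linear (G n)" "\<And>n c x. G n (c *\<^sub>C x) = c *\<^sub>C G n x"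
    "\<And>n x y. inner (G n x) y = inner x (G n y)" "\<And>n x. R (G n x) + \<epsilon> n *\<^sub>R G n x = x"
    "\<And>n x. G n (R x + \<epsilon> n *\<^sub>R x) = x" by blast
  interpret G: bounded_linear "G n" for n by (rule G)
  have GR: "G n (R x) = R (G n x)" for n x
  proof -
    have "G n (R x) = G n (R (R (G n x) + \<epsilon> n *\<^sub>R G n x))" by (simp only: G(4))
    also have "\<dots> = G n (R (R (G n x)) + \<epsilon> n *\<^sub>R R (G n x))" by (simp only: R.add R.scaleR)
    finally show ?thesis by (simp only: G(5))
  qed
  define F where "F n x = \<i> *\<^sub>C G n x" for n x
  have F: "bounded_linear (F n)" for n
    unfolding F_def by (rule bounded_linear_compose[OF bounded_linear_scaleC G(1)])
  have Fskew: "inner (F n x) x = 0" for n x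
    unfolding F_def by (rule inner_skew_symmetric) (auto simp: G)
  define E where "E n t x = operator_exp (F n) t x" for n t x
  have E': "((\<lambda>t. E n t x) has_vector_derivative F n (E n t x)) (at t within S)" for n t x S
    unfolding E_def by (rule operator_exp_has_vector_derivative[OF F])
  have Enorm: "norm (E n t x) \<le> norm x" if "t \<ge> 0" for n t x
  proof -
    have "(norm (E n t x))\<^sup>2 \<le> (norm (E n 0 x))\<^sup>2"
      by (rule decreasing_if_derivative_nonpos[OF that norm_power2_has_derivative[OF E']])
        (simp add: Fskew)
    then show ?thesis by (simp add: E_def)
  qed
  have ER: "E n t (R x) = R (E n t x)" for n t x
    unfolding E_def by (rule operator_exp_commute[OF F R]) (simp add: F_def GR sc)
  have contr: "norm (G n (R z)) \<le> norm z" for n z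
  proof -
    define g where "g = G n z"
    have z: "z = R g + \<epsilon> n *\<^sub>R g" unfolding g_def by (simp only: G(4))
    have "(norm (R g))\<^sup>2 \<le> (norm z)\<^sup>2"
    proof -
      have "(norm z)\<^sup>2 = (norm (R g))\<^sup>2 + 2 * \<epsilon> n * inner (R g) g + (norm (\<epsilon> n *\<^sub>R g))\<^sup>2"
        unfolding z power2_norm_eq_inner by (simp add: inner_add inner_commute algebra_simps)
      moreover have "0 \<le> 2 * \<epsilon> n * inner (R g) g" using \<epsilon>[of n] pos[of g] by simp
      ultimately show ?thesis by simp
    qed
    then show ?thesis by (simp add: GR g_def)
  qed
  have GG: "G m v - G n v = (\<epsilon> n - \<epsilon> m) *\<^sub>R G m (G n v)" for m n v
  proof -
    have "G m v = G m (R (G n v) + \<epsilon> m *\<^sub>R G n v + (\<epsilon> n - \<epsilon> m) *\<^sub>R G n v)"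
      by (rule arg_cong[where f = "G m"]) (simp add: G(4) scaleR_diff_left)
    also have "\<dots> = G n v + (\<epsilon> n - \<epsilon> m) *\<^sub>R G m (G n v)"
      by (simp only: G.add[of m "R (G n v) + \<epsilon> m *\<^sub>R G n v"] G(5) G.scaleR)
    finally show ?thesis by simp
  qed
  have diff: "norm (E m t (R (R y)) - E n t (R (R y))) \<le> t * (\<bar>\<epsilon> n - \<epsilon> m\<bar> * norm y)"
    if "t \<ge> 0" for m n t y
  proof -
    define r where "r t = E m t (R (R y)) - E n t (R (R y))" for t
    define r' where "r' t = F m (E m t (R (R y))) - F n (E n t (R (R y)))" for t
    interpret F: bounded_linear "F k" for k by (rule F)
    have "norm (r t) \<le> norm (r 0) + integral {0..t} (\<lambda>s. \<bar>\<epsilon> n - \<epsilon> m\<bar> * norm y)"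
    proof (rule dissipative_energy_estimate[OF F[of m] _ that])
      show "inner (F m x) x \<le> 0" for x by (simp add: Fskew)
      show "(r' has_integral r b - r a) {a..b}" if "a \<le> b" for a b
        using that unfolding r_def r'_def
        by (intro fundamental_theorem_of_calculus has_vector_derivative_diff E')
      show "negligible ({} :: real set)" by simp
      fix s assume "s \<in> {0..t} - {}"
      then have "s \<ge> 0" by simp
      let ?v = "E n s y"
      have "r' s - F m (r s) = F m (E n s (R (R y))) - F n (E n s (R (R y)))"
        by (simp add: r'_def r_def F.diff)
      also have "\<dots> = \<i> *\<^sub>C (\<epsilon> n - \<epsilon> m) *\<^sub>R G m (R (G n (R ?v)))"
        unfolding F_def complex_vector.scale_right_diff_distrib[symmetric] GG by (simp only: ER GR)
      finally have "norm (r' s - F m (r s)) = \<bar>\<epsilon> n - \<epsilon> m\<bar> * norm (G m (R (G n (R ?v))))"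
        by (simp add: norm_scaleC)
      also have "norm (G m (R (G n (R ?v)))) \<le> norm y"
        using contr contr Enorm[OF \<open>s \<ge> 0\<close>] by (rule order_trans[OF _ order_trans])
      finally show "norm (r' s - F m (r s)) \<le> \<bar>\<epsilon> n - \<epsilon> m\<bar> * norm y" by (simp add: mult_left_mono)
    qed (rule integrable_const_ivl)
    moreover have "r 0 = 0" by (simp add: r_def E_def)
    ultimately show ?thesis using \<open>t \<ge> 0\<close> by (simp add: r_def mult_ac)
  qed
  have dense: "\<exists>y. norm (x - R (R y)) < e" if "e > 0" for e
  proof -
    have "closure (range (\<lambda>y. R (R y))) = UNIV"
    proof (rule dense_range_symmetric)
      show "bounded_linear (\<lambda>y. R (R y))" by (rule bounded_linear_compose[OF R R])
      show "inj (\<lambda>y. R (R y))" using inj by (auto simp: inj_def)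
    qed (simp add: sym)
    then have "x \<in> closure (range (\<lambda>y. R (R y)))" by simp
    with that obtain y where "dist (R (R y)) x < e" unfolding closure_approachable by blast
    then show ?thesis by (auto simp: dist_norm norm_minus_commute)
  qed
  define u where "u t = lim (\<lambda>n. E n t x)" for t
  have unif: "uniform_limit {0..T} (\<lambda>n t. E n t x) u sequentially" for T
  proof -
    have "uniformly_Cauchy_on {0..T} (\<lambda>n t. E n t x)"
      unfolding uniformly_Cauchy_on_def
    proof (intro allI impI)
      fix e :: real assume "e > 0"
      then obtain y where y: "norm (x - R (R y)) < e / 4" using dense[of "e / 4"] by auto
      define \<delta> where "\<delta> = e / (2 * (\<bar>T\<bar> * norm y + 1))"
      have pos: "\<bar>T\<bar> * norm y + 1 > 0" by (simp add: add_nonneg_pos)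
      then have "\<delta> > 0" using \<open>e > 0\<close> by (simp add: \<delta>_def)
      obtain N where N: "\<And>m n. m \<ge> N \<Longrightarrow> n \<ge> N \<Longrightarrow> \<bar>\<epsilon> n - \<epsilon> m\<bar> < \<delta>"
        using CauchyD[OF LIMSEQ_imp_Cauchy[OF \<epsilon>0] \<open>\<delta> > 0\<close>] unfolding real_norm_def by blast
      have "dist (E m t x) (E n t x) < e" if t: "t \<in> {0..T}" and mn: "m \<ge> N" "n \<ge> N" for t m n
      proof -
        have "t \<ge> 0" using t by simp
        have split: "E k t x = E k t (x - R (R y)) + E k t (R (R y))" for k
          by (simp add: E_def operator_exp_diff[OF F])
        have "E m t x - E n t x = E m t (x - R (R y)) + (E m t (R (R y)) - E n t (R (R y))) - E n t (x - R (R y))"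
          by (simp only: split[of m] split[of n]) simp
        then have "norm (E m t x - E n t x) \<le> norm (E m t (x - R (R y)))
            + norm (E m t (R (R y)) - E n t (R (R y))) + norm (E n t (x - R (R y)))"
          by (metis norm_triangle_ineq norm_triangle_ineq4 order_trans add_right_mono)
        also have "\<dots> \<le> norm (x - R (R y)) + t * (\<bar>\<epsilon> n - \<epsilon> m\<bar> * norm y) + norm (x - R (R y))"
          by (intro add_mono Enorm diff \<open>t \<ge> 0\<close>)
        also have "t * (\<bar>\<epsilon> n - \<epsilon> m\<bar> * norm y) \<le> \<bar>T\<bar> * (\<delta> * norm y)"
          using t N[OF mn] by (intro mult_mono) auto
        also have "\<dots> \<le> e / 2"
        proof -
          have "\<bar>T\<bar> * (\<delta> * norm y) = e / 2 * ((\<bar>T\<bar> * norm y) / (\<bar>T\<bar> * norm y + 1))"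
            by (simp add: \<delta>_def)
          also have "(\<bar>T\<bar> * norm y) / (\<bar>T\<bar> * norm y + 1) \<le> 1" using pos by (simp add: divide_le_eq)
          finally show ?thesis using \<open>e > 0\<close> by (simp add: mult_left_mono)
        qed
        finally show ?thesis using y by (simp add: dist_norm)
      qed
      then show "\<exists>M. \<forall>t\<in>{0..T}. \<forall>m\<ge>M. \<forall>n\<ge>M. dist (E m t x) (E n t x) < e" by blast
    qed
    then have "uniformly_convergent_on {0..T} (\<lambda>n t. E n t x)" by (rule Cauchy_uniformly_convergent)
    then show ?thesis unfolding uniformly_convergent_uniform_limit_iff u_def .
  qed
  have lim: "(\<lambda>n. E n t x) \<longlonglongrightarrow> u t" if "t \<ge> 0" for t
    using tendsto_uniform_limitI[OF unif[of t], of t] that by simp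
  show ?thesis
  proof (intro exI[of _ u] conjI allI impI)
    show "u 0 = x" using lim[of 0] by (simp add: E_def LIMSEQ_const_iff)
    fix t :: real assume t: "t \<ge> 0"
    show "norm (u t) \<le> norm x"
      by (rule LIMSEQ_le_const2[OF tendsto_norm[OF lim[OF t]]]) (use Enorm[OF t] in auto)
    let ?S = "{0..t + 1}"
    have "((\<lambda>t. R (u t)) has_vector_derivative \<i> *\<^sub>C u t) (at t within ?S)"
    proof (rule has_vector_derivative_uniform_limit)
      show "((\<lambda>t. R (E n t x) + \<epsilon> n *\<^sub>R E n t x) has_vector_derivative \<i> *\<^sub>C E n s x) (at s within ?S)" for n s
      proof -
        have "((\<lambda>t. R (E n t x) + \<epsilon> n *\<^sub>R E n t x) has_vector_derivative
            R (F n (E n s x)) + \<epsilon> n *\<^sub>R F n (E n s x)) (at s within ?S)"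
          by (intro has_vector_derivative_add R.has_vector_derivative
              bounded_linear.has_vector_derivative[OF bounded_linear_scaleR_right] E')
        moreover have "R (F n v) + \<epsilon> n *\<^sub>R F n v = \<i> *\<^sub>C v" for v
        proof -
          have "R (F n v) + \<epsilon> n *\<^sub>R F n v = \<i> *\<^sub>C (R (G n v) + \<epsilon> n *\<^sub>R G n v)"
            by (simp add: F_def sc scaleC_add_right scaleC_scaleC mult.commute flip: scaleC_of_real)
          then show ?thesis by (simp only: G(4))
        qed
        ultimately show ?thesis by simp
      qed
      show "uniform_limit ?S (\<lambda>n s. \<i> *\<^sub>C E n s x) (\<lambda>s. \<i> *\<^sub>C u s) sequentially"
        by (rule bounded_linear.uniform_limit[OF bounded_linear_scaleC unif])
      show "(\<lambda>n. R (E n s x) + \<epsilon> n *\<^sub>R E n s x) \<longlonglongrightarrow> R (u s)" if "s \<in> ?S" for s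
      proof -
        have "s \<ge> 0" using that by simp
        from tendsto_add[OF R.tendsto[OF lim[OF this]] tendsto_scaleR[OF \<epsilon>0 lim[OF this]]]
        show ?thesis by simp
      qed
    qed (use t in auto)
    moreover have "at t within ?S = at t within {0..}"
      by (rule at_within_nhd[of t "{..<t+1}"]) (use t in auto)
    ultimately show "((\<lambda>t. R (u t)) has_vector_derivative \<i> *\<^sub>C u t) (at t within {0..})" by simp
  qed
qed

section \<open>Strongly continuous semigroups\<close>

text \<open>
  Baire's theorem: one of the closed sets \<open>{x. \<forall>n. \<parallel>T\<^sub>n x\<parallel> \<le> k}\<close> contains a ball.
\<close>

lemma uniform_boundedness:
  fixes T :: "nat \<Rightarrow> 'a::banach \<Rightarrow> 'b::real_normed_vector"
  assumes T: "\<And>n. bounded_linear (T n)" and bd: "\<And>x. \<exists>k. \<forall>n. norm (T n x) \<le> k"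
  shows "\<exists>k. \<forall>n x. norm (T n x) \<le> k * norm x"
proof -
  interpret T: bounded_linear "T n" for n by (rule T)
  define F where "F k = {x. \<forall>n. norm (T n x) \<le> real k}" for k
  have clF: "closed (F k)" for k
  proof -
    have "closed {x. norm (T n x) \<le> real k}" for n
      by (intro closed_Collect_le continuous_intros T.continuous_on continuous_on_id)
    then show ?thesis unfolding F_def Collect_all_eq by blast
  qed
  have "x \<in> (\<Union>k. F k)" for x
  proof -
    obtain k where k: "\<forall>n. norm (T n x) \<le> k" using bd by blast
    obtain j where j: "k \<le> real j" using real_arch_simple by blast
    have "x \<in> F j" unfolding F_def using k j by (auto intro: order_trans)
    then show ?thesis by blast
  qed
  then have un: "(\<Union>k. F k) = UNIV" by blast
  have "\<exists>k. interior (F k) \<noteq> {}"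
  proof (rule ccontr)
    assume "\<not> ?thesis"
    then have "\<And>S. S \<in> range F \<Longrightarrow> closedin euclidean S \<and> euclidean interior_of S = {}"
      using clF by auto
    then have "euclidean interior_of \<Union> (range F) = {}"
      by (intro Baire_category_alt) (auto simp: completely_metrizable_space_euclidean)
    then show False using un by simp
  qed
  then obtain k x0 where "x0 \<in> interior (F k)" by blast
  then obtain r where "r > 0" and r: "ball x0 r \<subseteq> F k" unfolding mem_interior by blast
  have "norm (T n x) \<le> (4 * real k / r) * norm x" for n x
  proof (cases "x = 0")
    case False
    define s where "s = r / (2 * norm x)"
    have "s > 0" using False \<open>r > 0\<close> by (simp add: s_def)
    have "norm (s *\<^sub>R x) < r" using False \<open>r > 0\<close> by (simp add: s_def)
    then have "x0 + s *\<^sub>R x \<in> F k" "x0 \<in> F k" using r \<open>r > 0\<close> by (auto simp: dist_norm)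
    then have "norm (T n (x0 + s *\<^sub>R x)) \<le> real k" "norm (T n x0) \<le> real k" by (auto simp: F_def)
    then have "norm (T n (x0 + s *\<^sub>R x) - T n x0) \<le> real k + real k"
      using norm_triangle_ineq4 by (meson add_mono order_trans)
    then have "s * norm (T n x) \<le> 2 * real k" using \<open>s > 0\<close> by (simp add: T.add T.scaleR)
    then have "r * norm (T n x) \<le> 4 * real k * norm x" using False by (simp add: s_def field_simps)
    then show ?thesis using \<open>r > 0\<close> by (simp add: field_simps)
  qed (simp add: T.zero)
  then show ?thesis by blast
qed

text \<open>
  Otherwise \<open>T\<^sub>t\<close> is unbounded along some sequence \<open>t\<^sub>n \<rightarrow> 0\<close>, although \<open>T\<^sub>t x \<rightarrow> x\<close> along it for every \<open>x\<close>.
\<close>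

lemma C0_semigroup_bounded_near_0:
  fixes T :: "real \<Rightarrow> 'a::complex_hilbert \<Rightarrow> 'a"
  assumes T: "C0_semigroup T"
  shows "\<exists>\<delta>>0. \<exists>K. \<forall>t x. 0 \<le> t \<longrightarrow> t \<le> \<delta> \<longrightarrow> norm (T t x) \<le> K * norm x"
proof (rule ccontr)
  assume neg: "\<not> ?thesis"
  have "\<exists>t x. 0 \<le> t \<and> t \<le> 1 / real (Suc n) \<and> real n * norm x < norm (T t x)" for n
    using neg by (metis not_less of_nat_0_less_iff zero_less_Suc zero_less_divide_1_iff)
  then have "\<forall>n. \<exists>p. 0 \<le> fst p \<and> fst p \<le> 1 / real (Suc n) \<and> real n * norm (snd p) < norm (T (fst p) (snd p))"
    by auto
  from choice[OF this] obtain p where p: "\<And>n. 0 \<le> fst (p n)" "\<And>n. fst (p n) \<le> 1 / real (Suc n)"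
    "\<And>n. real n * norm (snd (p n)) < norm (T (fst (p n)) (snd (p n)))" by blast
  define t where "t n = fst (p n)" for n
  have "(\<lambda>n. 1 / real (Suc n)) \<longlonglongrightarrow> 0"
    using LIMSEQ_inverse_real_of_nat by (simp add: inverse_eq_divide)
  then have t0: "t \<longlonglongrightarrow> 0"
    using p(1,2) by (intro tendsto_sandwich[OF _ _ tendsto_const, of 0 t]) (auto simp: t_def)
  have "\<exists>k. \<forall>n x. norm (T (t n) x) \<le> k * norm x"
  proof (rule uniform_boundedness)
    show "bounded_linear (T (t n))" for n
      using T p(1) by (simp add: C0_semigroup_def bounded_clinear_def t_def)
    fix x
    have "continuous (at 0 within {0..}) (\<lambda>t. T t x)"
      unfolding continuous_within at_within_Ici_at_right using T by (simp add: C0_semigroup_def)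
    then have "(\<lambda>n. T (t n) x) \<longlonglongrightarrow> T 0 x"
    proof (rule continuous_within_tendsto_compose'[OF _ _ t0])
      show "t n \<in> {0..}" for n using p(1) by (simp add: t_def)
    qed
    then have "Bseq (\<lambda>n. T (t n) x)" by (intro convergent_imp_Bseq) (auto simp: convergent_def)
    then show "\<exists>k. \<forall>n. norm (T (t n) x) \<le> k" unfolding Bseq_def by blast
  qed
  then obtain k where k: "\<And>n x. norm (T (t n) x) \<le> k * norm x" by blast
  obtain n where "k < real n" using reals_Archimedean2 by blast
  have "norm (T (t n) (snd (p n))) \<le> real n * norm (snd (p n))"
    using k[of n "snd (p n)"] \<open>k < real n\<close> mult_right_mono[of k "real n" "norm (snd (p n))"] by simp
  then show False using p(3)[of n] by (simp add: t_def)
qed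

text \<open>
  The definition of the generator concerns right derivatives.  For the left derivative,
  \<open>T\<^sub>t x - T\<^sub>t\<^sub>-\<^sub>s x = T\<^sub>t\<^sub>-\<^sub>s (T\<^sub>s x - x)\<close>, and the operators \<open>T\<^sub>t\<^sub>-\<^sub>s\<close> are bounded uniformly for small \<open>s\<close>.
\<close>

lemma C0_semigroup_orbit_derivative:
  fixes T :: "real \<Rightarrow> 'a::complex_hilbert \<Rightarrow> 'a"
  assumes T: "C0_semigroup T" and y: "((\<lambda>t. (T t x - x) /\<^sub>R t) \<longlongrightarrow> y) (at_right 0)" and t: "t \<ge> 0"
  shows "((\<lambda>t. T t x) has_vector_derivative T t y) (at t within {0..})"
    and "((\<lambda>s. (T s (T t x) - T t x) /\<^sub>R s) \<longlongrightarrow> T t y) (at_right 0)"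
proof -
  have Tbl: "bounded_linear (T s)" if "s \<ge> 0" for s
    using T that by (simp add: C0_semigroup_def bounded_clinear_def)
  have Tadd: "T (s + r) v = T s (T r v)" if "s \<ge> 0" "r \<ge> 0" for s r v
    using T that by (simp add: C0_semigroup_def o_def)
  have T0: "T 0 v = v" for v using T by (simp add: C0_semigroup_def)
  interpret Tt: bounded_linear "T t" by (rule Tbl[OF t])
  have "((\<lambda>s. T t ((T s x - x) /\<^sub>R s)) \<longlongrightarrow> T t y) (at_right 0)"
    by (rule Tt.tendsto[OF y])
  moreover have "\<forall>\<^sub>F s in at_right 0. T t ((T s x - x) /\<^sub>R s) = (T s (T t x) - T t x) /\<^sub>R s"
    using eventually_at_right_less[of "0::real"]
  proof eventually_elim
    case (elim s)
    then have "T s (T t x) = T t (T s x)" using Tadd[of s t x] Tadd[of t s x] t by (simp add: add.commute)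
    then show ?case by (simp add: Tt.diff Tt.scaleR)
  qed
  ultimately show "((\<lambda>s. (T s (T t x) - T t x) /\<^sub>R s) \<longlongrightarrow> T t y) (at_right 0)"
    by (rule Lim_transform_eventually)
  obtain \<delta> K where "\<delta> > 0" and K: "\<And>s v. 0 \<le> s \<Longrightarrow> s \<le> \<delta> \<Longrightarrow> norm (T s v) \<le> K * norm v"
    using C0_semigroup_bounded_near_0[OF T] by blast
  define \<delta>' where "\<delta>' = min \<delta> t"
  have \<delta>': "0 \<le> \<delta>'" "\<delta>' \<le> t" "\<delta>' \<le> \<delta>" using \<open>\<delta> > 0\<close> t by (auto simp: \<delta>'_def)
  obtain K' where K': "\<And>v. norm (T (t - \<delta>') v) \<le> norm v * K'" "K' \<ge> 0"
    using bounded_linear.nonneg_bounded[OF Tbl[of "t - \<delta>'"]] \<delta>' by auto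
  obtain K'' where K'': "\<And>v. norm (T t v) \<le> norm v * K''" "K'' \<ge> 0"
    using Tt.nonneg_bounded by blast
  define M where "M = max K'' (K' * \<bar>K\<bar>) + 1"
  have "M > 0" using K'' by (simp add: M_def max_def)
  have Mt: "norm (T t v) \<le> M * norm v" for v
  proof -
    have "norm v * K'' \<le> M * norm v" using mult_right_mono[of K'' M "norm v"] by (simp add: M_def mult.commute)
    then show ?thesis using K''(1)[of v] by linarith
  qed
  have Ms: "norm (T (t - s) v) \<le> M * norm v" if "0 \<le> s" "s \<le> \<delta>'" for s v
  proof -
    have "T (t - s) v = T (t - \<delta>') (T (\<delta>' - s) v)" using Tadd[of "t - \<delta>'" "\<delta>' - s" v] that \<delta>' by simp
    then have "norm (T (t - s) v) \<le> norm (T (\<delta>' - s) v) * K'" using K' by simp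
    also have "\<dots> \<le> (\<bar>K\<bar> * norm v) * K'"
    proof (rule mult_right_mono[OF _ K'(2)])
      have "norm (T (\<delta>' - s) v) \<le> K * norm v" using that \<delta>' by (intro K) auto
      also have "\<dots> \<le> \<bar>K\<bar> * norm v" by (intro mult_right_mono) auto
      finally show "norm (T (\<delta>' - s) v) \<le> \<bar>K\<bar> * norm v" .
    qed
    also have "\<dots> = (K' * \<bar>K\<bar>) * norm v" by simp
    also have "\<dots> \<le> M * norm v" by (intro mult_right_mono) (auto simp: M_def)
    finally show ?thesis .
  qed
  have small: "\<exists>d>0. \<forall>s. 0 \<le> s \<longrightarrow> s < d \<longrightarrow> norm (T s x - x - s *\<^sub>R y) \<le> e * s \<and> norm (T s y - y) \<le> e"
    if "e > 0" for e
  proof -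
    have "\<forall>\<^sub>F s in at_right 0. dist ((T s x - x) /\<^sub>R s) y < e" using y that by (rule tendstoD)
    moreover have "((\<lambda>s. T s y) \<longlongrightarrow> y) (at_right 0)" using T by (simp add: C0_semigroup_def)
    then have "\<forall>\<^sub>F s in at_right 0. dist (T s y) y < e" using that by (rule tendstoD)
    ultimately have "\<forall>\<^sub>F s in at_right 0. dist ((T s x - x) /\<^sub>R s) y < e \<and> dist (T s y) y < e"
      by (rule eventually_conj)
    then obtain d where "d > 0" and d: "\<And>s. 0 < s \<Longrightarrow> s < d \<Longrightarrow> dist ((T s x - x) /\<^sub>R s) y < e \<and> dist (T s y) y < e"
      unfolding eventually_at_right_field by blast
    have "norm (T s x - x - s *\<^sub>R y) \<le> e * s \<and> norm (T s y - y) \<le> e" if s: "0 \<le> s" "s < d" for s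
    proof (cases "s = 0")
      case False
      then have "s > 0" using s by simp
      have "T s x - x - s *\<^sub>R y = s *\<^sub>R ((T s x - x) /\<^sub>R s - y)" using \<open>s > 0\<close> by (simp add: scaleR_diff_right)
      then have "norm (T s x - x - s *\<^sub>R y) = s * norm ((T s x - x) /\<^sub>R s - y)" using \<open>s > 0\<close> by simp
      also have "\<dots> \<le> s * e" using d[OF \<open>s > 0\<close> s(2)] \<open>s > 0\<close> by (intro mult_left_mono) (auto simp: dist_norm)
      finally show ?thesis using d[OF \<open>s > 0\<close> s(2)] by (simp add: dist_norm mult.commute)
    qed (use \<open>e > 0\<close> in \<open>simp add: T0\<close>)
    then show ?thesis using \<open>d > 0\<close> by blast
  qed
  show "((\<lambda>t. T t x) has_vector_derivative T t y) (at t within {0..})"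
    unfolding has_vector_derivative_def has_derivative_within_alt
  proof (intro conjI allI impI bounded_linear_scaleR_left)
    fix e :: real assume "e > 0"
    define e' where "e' = e / (2 * M)"
    have "e' > 0" using \<open>e > 0\<close> \<open>M > 0\<close> by (simp add: e'_def)
    then obtain d where "d > 0" and d: "\<And>s. 0 \<le> s \<Longrightarrow> s < d \<Longrightarrow>
        norm (T s x - x - s *\<^sub>R y) \<le> e' * s \<and> norm (T s y - y) \<le> e'" using small by blast
    show "\<exists>d>0. \<forall>s\<in>{0..}. norm (s - t) < d \<longrightarrow> norm (T s x - T t x - (s - t) *\<^sub>R T t y) \<le> e * norm (s - t)"
    proof (intro exI[of _ "if t = 0 then d else min d \<delta>'"] conjI ballI impI)
      show "(if t = 0 then d else min d \<delta>') > 0" using \<open>d > 0\<close> \<open>\<delta> > 0\<close> t by (simp add: \<delta>'_def)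
      fix s :: real assume s: "s \<in> {0..}" "norm (s - t) < (if t = 0 then d else min d \<delta>')"
      show "norm (T s x - T t x - (s - t) *\<^sub>R T t y) \<le> e * norm (s - t)"
      proof (cases "s \<ge> t")
        case True
        define r where "r = s - t"
        have r: "0 \<le> r" "r < d" "s = t + r" using True s by (auto simp: r_def split: if_splits)
        have "T s x - T t x - (s - t) *\<^sub>R T t y = T t (T r x - x - r *\<^sub>R y)"
          using Tadd[OF t r(1), of x] by (simp add: r(3) Tt.diff Tt.scaleR)
        then have "norm (T s x - T t x - (s - t) *\<^sub>R T t y) \<le> M * norm (T r x - x - r *\<^sub>R y)" using Mt by simp
        also have "\<dots> \<le> M * (e' * r)" using d[OF r(1,2)] \<open>M > 0\<close> by (intro mult_left_mono) auto
        also have "\<dots> \<le> e * r" using \<open>M > 0\<close> \<open>e > 0\<close> r by (simp add: e'_def)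
        finally show ?thesis using r by simp
      next
        case False
        define r where "r = t - s"
        have r: "0 \<le> r" "r < d" "r \<le> \<delta>'" "t = s + r" "s = t - r" using False s by (auto simp: r_def split: if_splits)
        have "s \<ge> 0" using s by simp
        interpret Ts: bounded_linear "T s" by (rule Tbl) fact
        interpret Tr: bounded_linear "T r" by (rule Tbl) fact
        have "T s x - T t x - (s - t) *\<^sub>R T t y = - T s (T r x - x - r *\<^sub>R y + r *\<^sub>R (y - T r y))"
          using Tadd[OF \<open>s \<ge> 0\<close> r(1), of x] Tadd[OF \<open>s \<ge> 0\<close> r(1), of y]
          by (simp add: r(4) Ts.diff Ts.add Ts.scaleR scaleR_diff_right)
        then have "norm (T s x - T t x - (s - t) *\<^sub>R T t y) \<le> M * norm (T r x - x - r *\<^sub>R y + r *\<^sub>R (y - T r y))"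
          using Ms[OF r(1,3)] by (simp add: r(5)[symmetric])
        also have "\<dots> \<le> M * (e' * r + r * e')"
        proof (intro mult_left_mono norm_triangle_mono)
          show "norm (T r x - x - r *\<^sub>R y) \<le> e' * r" using d[OF r(1,2)] by simp
          have "r * norm (y - T r y) \<le> r * e'"
            using d[OF r(1,2)] r(1) by (intro mult_left_mono) (auto simp: norm_minus_commute)
          then show "norm (r *\<^sub>R (y - T r y)) \<le> r * e'" using r(1) by simp
        qed (use \<open>M > 0\<close> in simp)
        also have "\<dots> = (2 * M * e') * r" by (simp add: algebra_simps)
        also have "2 * M * e' = e" using \<open>M > 0\<close> by (simp add: e'_def)
        finally show ?thesis using r(1) by (simp add: r_def)
      qed
    qed
  qed
qed

section \<open>The damped semigroups\<close>

text \<open>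
  \<open>Q\<close> stands for \<open>A\<^sub>0\<^sup>-\<^sup>1\<^sup>/\<^sup>2\<close> and \<open>R = Q\<^sup>2\<close> for \<open>A\<^sub>0\<^sup>-\<^sup>1\<close>.  A vector of \<open>D(A\<^sub>0)\<close> is written \<open>R a\<close>, with
  \<open>\<parallel>a\<parallel> = \<parallel>R a\<parallel>\<^sub>1\<close>, and a vector of \<open>D(A\<^sub>0\<^sup>2)\<close> is written \<open>R (R a)\<close>.  \<open>B\<close> stands for \<open>C\<^sup>* C\<close>; the numbers
  \<open>K\<close>, \<open>K1\<close> and \<open>\<rho>\<close> bound \<open>B\<close>, \<open>A\<^sub>0 B A\<^sub>0\<^sup>-\<^sup>1\<close> and \<open>Q\<close>.
\<close>

locale damped_system =
  fixes Q B :: "'a::complex_hilbert \<Rightarrow> 'a" and K K1 \<rho> :: real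
  assumes Q: "bounded_linear Q" and Qsc: "\<And>c x. Q (c *\<^sub>C x) = c *\<^sub>C Q x"
    and Qsym: "\<And>x y. inner (Q x) y = inner x (Q y)" and Qinj: "inj Q"
    and Q_norm: "\<And>x. norm (Q x) \<le> \<rho> * norm x" and \<rho>: "\<rho> \<ge> 1"
    and B: "bounded_linear B" and Bsc: "\<And>c x. B (c *\<^sub>C x) = c *\<^sub>C B x"
    and B_pos: "\<And>x. 0 \<le> inner (B x) x"
    and B_norm: "\<And>x. norm (B x) \<le> K * norm x" and K: "K \<ge> 0"
    and B_regular: "\<And>a. \<exists>b. B (Q (Q a)) = Q (Q b) \<and> norm b \<le> K1 * norm a" and K1: "K1 \<ge> 0"
begin

sublocale Q: bounded_linear Q by (rule Q)
sublocale B: bounded_linear B by (rule B)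

definition R where "R x = Q (Q x)"

lemma R_bounded_linear: "bounded_linear R"
  unfolding R_def by (rule bounded_linear_compose[OF Q Q])

sublocale R: bounded_linear R by (rule R_bounded_linear)

lemma R_scaleC: "R (c *\<^sub>C x) = c *\<^sub>C R x"
  by (simp add: R_def Qsc)

lemma R_symmetric: "inner (R x) y = inner x (R y)"
  by (simp add: R_def Qsym)

lemma R_pos: "0 \<le> inner (R x) x"
  using inner_ge_zero[of "Q x"] by (simp add: R_def Qsym)

lemma R_inj: "inj R"
  using Qinj by (auto simp: R_def inj_def)

lemma R_eq_iff [simp]: "R x = R y \<longleftrightarrow> x = y"
  using R_inj by (auto dest: injD)

lemma R_norm: "norm (R x) \<le> \<rho>\<^sup>2 * norm x"
proof -
  have "norm (R x) \<le> \<rho> * (\<rho> * norm x)"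
    unfolding R_def using Q_norm[of x] \<rho> by (intro order_trans[OF Q_norm] mult_left_mono) auto
  then show ?thesis by (simp add: power2_eq_square mult.assoc)
qed

definition orbit_const where "orbit_const = K1 + 2 * K * (1 + K * \<rho>\<^sup>2)"

lemma orbit_const_nonneg: "orbit_const \<ge> 0"
  using K K1 by (simp add: orbit_const_def)

end

text \<open>
  \<open>T\<close> is generated by \<open>G = c A\<^sub>0 - B\<close>, where \<open>c = i\<close> or \<open>c = -i\<close>.
\<close>

locale damped_semigroup = damped_system +
  fixes c :: complex and T :: "real \<Rightarrow> 'a \<Rightarrow> 'a"
  assumes c: "c * c = -1" and T: "C0_semigroup T"
    and generator: "\<And>x y. ((\<lambda>t. (T t x - x) /\<^sub>R t) \<longlongrightarrow> y) (at_right 0) \<longleftrightarrow>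
      (\<exists>a. x = R a \<and> y = c *\<^sub>C a - B x)"
begin

lemma Re_c: "Re c = 0" and cmod_c [simp]: "cmod c = 1" and c_c: "c *\<^sub>C c *\<^sub>C x = - (x :: 'a)"
proof -
  have "c = \<i> \<or> c = - \<i>" using c square_eq_iff[of c \<i>] by simp
  then show "Re c = 0" "cmod c = 1" by auto
  show "c *\<^sub>C c *\<^sub>C x = - x" unfolding scaleC_scaleC c using scaleC_of_real[of "-1" x] by simp
qed

lemma T_bounded_linear: "t \<ge> 0 \<Longrightarrow> bounded_linear (T t)"
  using T by (simp add: C0_semigroup_def bounded_clinear_def)

lemma T_add: "s \<ge> 0 \<Longrightarrow> t \<ge> 0 \<Longrightarrow> T (s + t) x = T s (T t x)"
  using T unfolding C0_semigroup_def by auto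

lemma orbit:
  assumes "t \<ge> 0"
  shows "\<exists>a'. T t (R a) = R a' \<and> T t (c *\<^sub>C a - B (R a)) = c *\<^sub>C a' - B (R a') \<and>
    ((\<lambda>t. T t (R a)) has_vector_derivative c *\<^sub>C a' - B (R a')) (at t within {0..})"
proof -
  have "((\<lambda>t. (T t (R a) - R a) /\<^sub>R t) \<longlongrightarrow> c *\<^sub>C a - B (R a)) (at_right 0)"
    unfolding generator by blast
  from C0_semigroup_orbit_derivative[OF T this assms]
  have "((\<lambda>t. T t (R a)) has_vector_derivative T t (c *\<^sub>C a - B (R a))) (at t within {0..})"
    and "\<exists>a'. T t (R a) = R a' \<and> T t (c *\<^sub>C a - B (R a)) = c *\<^sub>C a' - B (T t (R a))"
    unfolding generator by blast+
  then show ?thesis by force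
qed

lemma dissipative: "inner (c *\<^sub>C a - B (R a)) (R a) = - inner (B (R a)) (R a)"
proof -
  have "inner (c *\<^sub>C a) (R a) = inner (c *\<^sub>C R a) a" by (simp add: R_symmetric flip: R_scaleC)
  also have "\<dots> = 0" by (rule inner_skew_symmetric[OF R_scaleC R_symmetric Re_c])
  finally show ?thesis by (simp add: inner_diff_left)
qed

lemma range_R_dense: "closure (range R) = UNIV"
  by (rule dense_range_symmetric[OF R_bounded_linear R_symmetric R_inj])

lemma orbit_energy:
  assumes "t \<ge> 0"
  shows "((\<lambda>t. (norm (T t (R a)))\<^sup>2) has_real_derivative - 2 * inner (B (T t (R a))) (T t (R a)))
    (at t within {0..})"
proof -
  obtain a' where "T t (R a) = R a'"
    "((\<lambda>t. T t (R a)) has_vector_derivative c *\<^sub>C a' - B (R a')) (at t within {0..})"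
    using orbit[OF assms, of a] by (elim exE conjE) (rule that; assumption)
  with norm_power2_has_derivative[OF this(2)] show ?thesis by (simp add: dissipative)
qed

text \<open>
  The energy of an orbit in \<open>D(A\<^sub>0)\<close> decreases, and \<open>D(A\<^sub>0)\<close> is dense.
\<close>

lemma contraction:
  assumes t: "t \<ge> 0"
  shows "norm (T t x) \<le> norm x"
proof (rule eq_on_dense[OF range_R_dense])
  show "continuous_on UNIV (\<lambda>x. norm (T t x))"
    by (intro continuous_intros linear_continuous_on T_bounded_linear t)
  fix x assume "x \<in> range R"
  then obtain a where "x = R a" by blast
  have "T 0 x = x" using T by (simp add: C0_semigroup_def)
  have "(norm (T t (R a)))\<^sup>2 \<le> (norm (T 0 (R a)))\<^sup>2"
    by (rule decreasing_if_derivative_nonpos[OF t orbit_energy]) (simp_all add: B_pos)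
  then show "norm (T t x) \<le> norm x" using \<open>T 0 x = x\<close> \<open>x = R a\<close> by simp
qed (intro continuous_intros)

text \<open>
  \<open>T\<close> is a contraction that commutes with \<open>G\<close>, and \<open>\<parallel>G x\<parallel>\<close> differs from \<open>\<parallel>x\<parallel>\<^sub>1\<close> by at most \<open>K \<parallel>x\<parallel>\<close>.
  So \<open>\<parallel>x\<parallel>\<^sub>1\<close> increases at most by \<open>2 K \<parallel>x\<parallel>\<close>, whatever the time.  The growth is additive, which is
  what allows many successive applications of semigroups with different generators.
\<close>

lemma orbit_dom:
  assumes t: "t \<ge> 0"
  shows "\<exists>a'. T t (R a) = R a' \<and> T t (c *\<^sub>C a - B (R a)) = c *\<^sub>C a' - B (R a') \<and>
    norm a' \<le> norm a + 2 * K * norm (R a)"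
proof -
  obtain a' where a': "T t (R a) = R a'" "T t (c *\<^sub>C a - B (R a)) = c *\<^sub>C a' - B (R a')"
    using orbit[OF t, of a] by (elim exE conjE) (rule that; assumption)
  have "norm a' = norm (c *\<^sub>C a')" by (simp add: norm_scaleC)
  also have "c *\<^sub>C a' = T t (c *\<^sub>C a - B (R a)) + B (R a')" by (simp add: a')
  also have "norm \<dots> \<le> norm (c *\<^sub>C a - B (R a)) + K * norm (R a)"
  proof (rule norm_triangle_mono)
    show "norm (T t (c *\<^sub>C a - B (R a))) \<le> norm (c *\<^sub>C a - B (R a))" by (rule contraction[OF t])
    have "norm (B (R a')) \<le> K * norm (R a')" by (rule B_norm)
    also have "\<dots> \<le> K * norm (R a)"
      using contraction[OF t, of "R a"] K by (intro mult_left_mono) (auto simp: a')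
    finally show "norm (B (R a')) \<le> K * norm (R a)" .
  qed
  also have "norm (c *\<^sub>C a - B (R a)) \<le> norm a + K * norm (R a)"
    using norm_triangle_ineq4[of "c *\<^sub>C a" "B (R a)"] B_norm[of "R a"] by (simp add: norm_scaleC)
  finally show ?thesis using a' by auto
qed



text \<open>
  For \<open>x \<in> D(A\<^sub>0\<^sup>2)\<close> also \<open>G x\<close> is in \<open>D(A\<^sub>0)\<close>, because \<open>B\<close> maps \<open>D(A\<^sub>0)\<close> to itself.  Hence
  \<open>q = A\<^sub>0 T\<^sub>t x\<close> is a differentiable curve, with \<open>q' = A\<^sub>0 T\<^sub>t G x\<close>.
\<close>

lemma orbit_dom2:
  obtains q q' where
    "\<And>t. t \<ge> 0 \<Longrightarrow> T t (R (R a)) = R (q t)"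
    "\<And>t. t \<ge> 0 \<Longrightarrow> (q has_vector_derivative q' t) (at t within {0..})"
    "\<And>t. t \<ge> 0 \<Longrightarrow> R (q' t) = c *\<^sub>C q t - B (R (q t))"
    "\<And>t. t \<ge> 0 \<Longrightarrow> norm (q t) \<le> norm (R a) + 2 * K * norm (R (R a))"
    "\<And>t. t \<ge> 0 \<Longrightarrow> norm (q' t) \<le> norm a + orbit_const * norm (R a)"
proof -
  obtain b where b: "B (R (R a)) = R b" "norm b \<le> K1 * norm (R a)"
    using B_regular[of "R a"] unfolding R_def by blast
  define g where "g = c *\<^sub>C a - b"
  have Gx: "c *\<^sub>C R a - B (R (R a)) = R g" by (simp add: g_def b R.diff R_scaleC)
  have "\<forall>t. \<exists>q. t \<ge> 0 \<longrightarrow> T t (R (R a)) = R q \<and> T t (R g) = c *\<^sub>C q - B (R q) \<and>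
      norm q \<le> norm (R a) + 2 * K * norm (R (R a))"
    using orbit_dom[of _ "R a"] unfolding Gx by blast
  from choice[OF this] obtain q where q: "\<And>t. t \<ge> 0 \<Longrightarrow> T t (R (R a)) = R (q t)"
    "\<And>t. t \<ge> 0 \<Longrightarrow> T t (R g) = c *\<^sub>C q t - B (R (q t))"
    "\<And>t. t \<ge> 0 \<Longrightarrow> norm (q t) \<le> norm (R a) + 2 * K * norm (R (R a))" by blast
  have "\<forall>t. \<exists>q'. t \<ge> 0 \<longrightarrow> T t (R g) = R q' \<and> T t (c *\<^sub>C g - B (R g)) = c *\<^sub>C q' - B (R q') \<and>
      norm q' \<le> norm g + 2 * K * norm (R g)"
    using orbit_dom[of _ g] by blast
  from choice[OF this] obtain q' where q': "\<And>t. t \<ge> 0 \<Longrightarrow> T t (R g) = R (q' t)"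
    "\<And>t. t \<ge> 0 \<Longrightarrow> T t (c *\<^sub>C g - B (R g)) = c *\<^sub>C q' t - B (R (q' t))"
    "\<And>t. t \<ge> 0 \<Longrightarrow> norm (q' t) \<le> norm g + 2 * K * norm (R g)" by blast
  have deriv: "((\<lambda>t. T t (R a)) has_vector_derivative T t (c *\<^sub>C a - B (R a))) (at t within {0..})"
    if "t \<ge> 0" for t a
    using orbit[OF that, of a] by force
  \<comment> \<open>\<open>q\<close> is recovered from the orbits of \<open>x\<close> and of \<open>G x\<close>, both differentiable.\<close>
  have qeq: "q t = - (c *\<^sub>C (T t (R g) + B (T t (R (R a)))))" if "t \<ge> 0" for t
    using q[OF that] c_c[of "q t"] by simp
  have "(q has_vector_derivative q' t) (at t within {0..})" if t: "t \<ge> 0" for t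
  proof -
    have "((\<lambda>t. - (c *\<^sub>C (T t (R g) + B (T t (R (R a)))))) has_vector_derivative
        - (c *\<^sub>C (T t (c *\<^sub>C g - B (R g)) + B (T t (R g))))) (at t within {0..})"
      using deriv[OF t, of g] deriv[OF t, of "R a"] unfolding Gx
      by (intro has_vector_derivative_minus bounded_linear.has_vector_derivative[OF bounded_linear_scaleC]
          has_vector_derivative_add B.has_vector_derivative)
    moreover have "- (c *\<^sub>C (T t (c *\<^sub>C g - B (R g)) + B (T t (R g)))) = q' t"
      using q'[OF t] c_c[of "q' t"] by simp
    ultimately have "((\<lambda>t. - (c *\<^sub>C (T t (R g) + B (T t (R (R a)))))) has_vector_derivative q' t)
        (at t within {0..})" by simp
    then show ?thesis
      by (rule has_vector_derivative_transform[rotated 2]) (use t qeq in auto)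
  qed
  moreover have "R (q' t) = c *\<^sub>C q t - B (R (q t))" if "t \<ge> 0" for t
    using q(2)[OF that] q'(1)[OF that] by simp
  moreover have "norm (q' t) \<le> norm a + orbit_const * norm (R a)" if "t \<ge> 0" for t
  proof -
    have "norm g \<le> norm a + K1 * norm (R a)"
      using norm_triangle_ineq4[of "c *\<^sub>C a" b] b(2) by (simp add: g_def norm_scaleC)
    moreover have "norm (R g) \<le> norm (R a) + K * (\<rho>\<^sup>2 * norm (R a))"
    proof -
      have "norm (R g) \<le> norm (c *\<^sub>C R a) + norm (B (R (R a)))"
        unfolding Gx[symmetric] by (rule norm_triangle_ineq4)
      also have "norm (B (R (R a))) \<le> K * norm (R (R a))" by (rule B_norm)
      also have "\<dots> \<le> K * (\<rho>\<^sup>2 * norm (R a))" by (intro mult_left_mono R_norm K)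
      finally show ?thesis by (simp add: norm_scaleC)
    qed
    then have "2 * K * norm (R g) \<le> 2 * K * (norm (R a) + K * (\<rho>\<^sup>2 * norm (R a)))"
      using K by (intro mult_left_mono) auto
    ultimately have "norm (q' t) \<le> norm a + K1 * norm (R a) + 2 * K * (norm (R a) + K * (\<rho>\<^sup>2 * norm (R a)))"
      using q'(3)[OF that] by linarith
    then show ?thesis by (simp add: orbit_const_def algebra_simps)
  qed
  ultimately show thesis using that q(1,3) by blast
qed

text \<open>
  \<open>c A\<^sub>0\<^sup>2 T\<^sub>t x = A\<^sub>0 T\<^sub>t G x + A\<^sub>0 B T\<^sub>t x\<close> reduces the growth of \<open>\<parallel>x\<parallel>\<^sub>2\<close> to that of \<open>\<parallel>G x\<parallel>\<^sub>1\<close> and \<open>\<parallel>x\<parallel>\<^sub>1\<close>.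
\<close>

lemma semigroup_dom2_growth:
  assumes t: "t \<ge> 0"
  shows "\<exists>a'. T t (R (R a)) = R (R a') \<and> norm (R a') \<le> norm (R a) + 2 * K * norm (R (R a)) \<and>
    norm a' \<le> norm a + orbit_const * norm (R a) + K1 * (norm (R a) + 2 * K * norm (R (R a)))"
proof -
  obtain q q' where q: "\<And>t. t \<ge> 0 \<Longrightarrow> T t (R (R a)) = R (q t)"
    "\<And>t. t \<ge> 0 \<Longrightarrow> R (q' t) = c *\<^sub>C q t - B (R (q t))"
    "\<And>t. t \<ge> 0 \<Longrightarrow> norm (q t) \<le> norm (R a) + 2 * K * norm (R (R a))"
    "\<And>t. t \<ge> 0 \<Longrightarrow> norm (q' t) \<le> norm a + orbit_const * norm (R a)"
    by (rule orbit_dom2[of a]) blast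
  obtain b where b: "B (R (q t)) = R b" "norm b \<le> K1 * norm (q t)"
    using B_regular[of "q t"] unfolding R_def by blast
  define a' where "a' = - (c *\<^sub>C (q' t + b))"
  have "R a' = - (c *\<^sub>C (R (q' t) + R b))" by (simp add: a'_def R.neg R_scaleC R.add)
  also have "\<dots> = q t" using q(2)[OF t] c_c[of "q t"] by (simp add: b)
  finally have Ra': "R a' = q t" .
  have "norm a' \<le> norm (q' t) + norm b" by (simp add: a'_def norm_scaleC norm_triangle_ineq)
  also have "\<dots> \<le> (norm a + orbit_const * norm (R a)) + K1 * (norm (R a) + 2 * K * norm (R (R a)))"
    using q(3)[OF t] K1 by (intro add_mono q(4)[OF t] order_trans[OF b(2)] mult_left_mono)
  finally show ?thesis using Ra' q(1,3)[OF t] by (intro exI[of _ a']) simp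
qed

end

section \<open>Exponential stability from observability\<close>

context damped_semigroup
begin

text \<open>
  Let \<open>z\<close> be the undamped and \<open>q\<close> the damped orbit of \<open>x\<close>, and \<open>w = z - q\<close>.  The dissipated energy
  \<open>\<parallel>x\<parallel>\<^sup>2 - \<parallel>q(t)\<parallel>\<^sup>2 = 2 \<integral> \<parallel>C q\<parallel>\<^sup>2\<close> controls \<open>w\<close>, whose source is \<open>B q = C\<^sup>* C q\<close>, hence it controls the
  observed energy \<open>\<integral> \<parallel>C z\<parallel>\<^sup>2\<close>.
\<close>

lemma damped_decay:
  fixes C :: "'a \<Rightarrow> 'b::complex_hilbert"
  assumes C: "bounded_linear C" and BC: "\<And>x y. inner (B x) y = inner (C x) (C y)"
    and \<gamma>: "\<And>x. norm (C x) \<le> \<gamma> * norm x" "\<gamma> \<ge> 0"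
    and \<tau>: "\<tau> > 0" and k: "k > 0"
    and obs: "\<And>u. (\<And>t. t \<ge> 0 \<Longrightarrow> ((\<lambda>t. R (u t)) has_vector_derivative c *\<^sub>C u t) (at t within {0..})) \<Longrightarrow>
      k\<^sup>2 * (norm (R (u 0)))\<^sup>2 \<le> integral {0..\<tau>} (\<lambda>t. (norm (C (R (u t))))\<^sup>2)"
    and ex: "\<And>a. \<exists>u. u 0 = a \<and> (\<forall>t\<ge>0. ((\<lambda>t. R (u t)) has_vector_derivative c *\<^sub>C u t) (at t within {0..}))"
  shows "\<exists>\<kappa>. 0 \<le> \<kappa> \<and> \<kappa> < 1 \<and> (\<forall>x. norm (T \<tau> x) \<le> \<kappa> * norm x)"
proof -
  interpret C: bounded_linear C by fact
  have B_le: "norm (B x) \<le> \<gamma> * norm (C x)" for x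
  proof -
    have "norm (B x) * norm (B x) = inner (C x) (C (B x))"
      by (simp flip: BC power2_norm_eq_inner power2_eq_square)
    also have "\<dots> \<le> norm (C x) * norm (C (B x))" by (rule norm_cauchy_schwarz)
    also have "\<dots> \<le> norm (C x) * (\<gamma> * norm (B x))" by (intro mult_left_mono \<gamma>) auto
    finally have "norm (B x) * norm (B x) \<le> (\<gamma> * norm (C x)) * norm (B x)" by (simp add: mult_ac)
    then show ?thesis using \<gamma>(2) by (cases "B x = 0") auto
  qed
  define K' where "K' = 1 + \<tau> * (\<gamma>\<^sup>2 * \<gamma>\<^sup>2 * exp \<tau>)"
  have "0 \<le> \<tau> * (\<gamma>\<^sup>2 * \<gamma>\<^sup>2 * exp \<tau>)" using \<tau> by (intro mult_nonneg_nonneg) auto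
  then have K': "K' \<ge> 1" by (simp add: K'_def)
  define \<kappa> where "\<kappa> = sqrt (max 0 (1 - k\<^sup>2 / K'))"
  have key: "norm (T \<tau> (R a)) \<le> \<kappa> * norm (R a)" for a
  proof -
    obtain u where u0: "u 0 = a"
      and u: "\<And>t. t \<ge> 0 \<Longrightarrow> ((\<lambda>t. R (u t)) has_vector_derivative c *\<^sub>C u t) (at t within {0..})"
      using ex[of a] by blast
    define q where "q t = T t (R a)" for t
    define w where "w t = R (u t) - q t" for t
    have q0: "q 0 = R a" using T by (simp add: q_def C0_semigroup_def)
    have q': "((\<lambda>t. (norm (q t))\<^sup>2) has_real_derivative - 2 * (norm (C (q t)))\<^sup>2) (at t within {0..})" if "t \<ge> 0" for t
      using orbit_energy[OF that, of a] unfolding q_def by (simp add: BC power2_norm_eq_inner)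
    have w': "((\<lambda>t. (norm (w t))\<^sup>2) has_real_derivative 2 * inner (B (q t)) (w t)) (at t within {0..})"
      if t: "t \<ge> 0" for t
    proof -
      obtain a' where a': "T t (R a) = R a'"
        "((\<lambda>t. T t (R a)) has_vector_derivative c *\<^sub>C a' - B (R a')) (at t within {0..})"
        using orbit[OF t, of a] by (elim exE conjE) (rule that; assumption)
      have "(w has_vector_derivative c *\<^sub>C u t - (c *\<^sub>C a' - B (R a'))) (at t within {0..})"
        unfolding w_def q_def by (intro has_vector_derivative_diff u[OF t] a'(2))
      from norm_power2_has_derivative[OF this]
      have "((\<lambda>t. (norm (w t))\<^sup>2) has_real_derivative 2 * inner (c *\<^sub>C u t - (c *\<^sub>C a' - B (R a'))) (w t)) (at t within {0..})" .
      moreover have "inner (c *\<^sub>C u t - (c *\<^sub>C a' - B (R a'))) (w t) = inner (B (q t)) (w t)"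
      proof -
        have w: "w t = R (u t - a')" by (simp add: w_def q_def a' R.diff)
        have skew: "inner (c *\<^sub>C v) (R v) = 0" for v
          using dissipative[of v] by (simp add: inner_diff_left)
        have "c *\<^sub>C u t - (c *\<^sub>C a' - B (R a')) = c *\<^sub>C (u t - a') + B (q t)"
          by (simp add: complex_vector.scale_right_diff_distrib q_def a')
        then show ?thesis by (simp only: inner_add_left w skew)
      qed
      ultimately show ?thesis by simp
    qed
    have w2: "(norm (w t))\<^sup>2 \<le> exp t * (\<gamma>\<^sup>2 / 2) * ((norm (R a))\<^sup>2 - (norm (q t))\<^sup>2)" if t: "t \<ge> 0" for t
    proof -
      \<comment> \<open>The weight \<open>e\<^sup>-\<^sup>t\<close> absorbs \<open>\<parallel>w\<parallel>\<^sup>2\<close> from \<open>2 \<langle>B q, w\<rangle> \<le> \<parallel>B q\<parallel>\<^sup>2 + \<parallel>w\<parallel>\<^sup>2\<close>, and the loss of \<open>\<parallel>q\<parallel>\<^sup>2\<close> absorbs \<open>\<parallel>B q\<parallel>\<^sup>2\<close>.\<close>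
      define f where "f t = exp (- t) * (norm (w t))\<^sup>2 + \<gamma>\<^sup>2 / 2 * (norm (q t))\<^sup>2" for t
      have "f t \<le> f 0"
      proof (rule decreasing_if_derivative_nonpos[OF t])
        fix s :: real assume s: "s \<ge> 0"
        show "(f has_real_derivative exp (- s) * (2 * inner (B (q s)) (w s)) - exp (- s) * (norm (w s))\<^sup>2
            + \<gamma>\<^sup>2 / 2 * (- 2 * (norm (C (q s)))\<^sup>2)) (at s within {0..})"
        proof -
          have "((\<lambda>t. exp (- t)) has_real_derivative - exp (- s)) (at s within {0..})"
            by (auto intro!: derivative_eq_intros)
          from DERIV_add[OF DERIV_mult[OF this w'[OF s]] DERIV_cmult[OF q'[OF s], of "\<gamma>\<^sup>2 / 2"]]
          show ?thesis unfolding f_def by (rule DERIV_cong) (simp add: mult.commute)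
        qed
        have "2 * inner (B (q s)) (w s) \<le> (norm (B (q s)))\<^sup>2 + (norm (w s))\<^sup>2"
          using norm_cauchy_schwarz[of "B (q s)" "w s"] sum_squares_bound[of "norm (B (q s))" "norm (w s)"] by linarith
        also have "(norm (B (q s)))\<^sup>2 \<le> (\<gamma> * norm (C (q s)))\<^sup>2" by (intro power_mono B_le) auto
        finally have "exp (- s) * (2 * inner (B (q s)) (w s)) \<le> exp (- s) * ((\<gamma> * norm (C (q s)))\<^sup>2 + (norm (w s))\<^sup>2)"
          by simp
        also have "\<dots> \<le> (\<gamma> * norm (C (q s)))\<^sup>2 + exp (- s) * (norm (w s))\<^sup>2"
          using s mult_right_mono[of "exp (- s)" 1 "(\<gamma> * norm (C (q s)))\<^sup>2"] by (simp add: distrib_left)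
        finally show "exp (- s) * (2 * inner (B (q s)) (w s)) - exp (- s) * (norm (w s))\<^sup>2
            + \<gamma>\<^sup>2 / 2 * (- 2 * (norm (C (q s)))\<^sup>2) \<le> 0" by (simp add: power_mult_distrib)
      qed
      then have "exp (- t) * (norm (w t))\<^sup>2 \<le> (\<gamma>\<^sup>2 / 2) * ((norm (R a))\<^sup>2 - (norm (q t))\<^sup>2)"
        by (simp add: f_def w_def u0 q0 right_diff_distrib)
      then have "exp t * (exp (- t) * (norm (w t))\<^sup>2) \<le> exp t * ((\<gamma>\<^sup>2 / 2) * ((norm (R a))\<^sup>2 - (norm (q t))\<^sup>2))"
        by simp
      then show ?thesis by (simp add: mult.assoc[symmetric] exp_minus)
    qed
    define D where "D = (norm (R a))\<^sup>2 - (norm (q \<tau>))\<^sup>2"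
    have D_ge: "(norm (R a))\<^sup>2 - (norm (q t))\<^sup>2 \<le> D" if "t \<in> {0..\<tau>}" for t
    proof -
      have "q \<tau> = T (\<tau> - t) (q t)"
        using T_add[of "\<tau> - t" t "R a"] that by (simp add: q_def)
      then have "norm (q \<tau>) \<le> norm (q t)" using contraction[of "\<tau> - t"] that by simp
      then show ?thesis by (simp add: D_def power_mono)
    qed
    have "D \<ge> 0" using contraction[of \<tau> "R a"] \<tau> by (simp add: D_def q_def power_mono)
    have Cz: "(norm (C (R (u t))))\<^sup>2 \<le> 2 * (norm (C (q t)))\<^sup>2 + \<gamma>\<^sup>2 * \<gamma>\<^sup>2 * exp \<tau> * D" if t: "t \<in> {0..\<tau>}" for t
    proof -
      have "C (R (u t)) = C (q t) + C (w t)" by (simp add: w_def C.diff)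
      then have "(norm (C (R (u t))))\<^sup>2 \<le> (norm (C (q t)) + norm (C (w t)))\<^sup>2"
        by (simp add: norm_triangle_ineq power_mono)
      also have "\<dots> \<le> 2 * (norm (C (q t)))\<^sup>2 + 2 * (norm (C (w t)))\<^sup>2"
        using sum_squares_bound[of "norm (C (q t))" "norm (C (w t))"] by (simp add: power2_sum)
      finally have 1: "(norm (C (R (u t))))\<^sup>2 \<le> 2 * (norm (C (q t)))\<^sup>2 + 2 * (norm (C (w t)))\<^sup>2" .
      have "(norm (C (w t)))\<^sup>2 \<le> (\<gamma> * norm (w t))\<^sup>2" by (intro power_mono \<gamma>) auto
      then have 2: "(norm (C (w t)))\<^sup>2 \<le> \<gamma>\<^sup>2 * (norm (w t))\<^sup>2" by (simp add: power_mult_distrib)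
      have 3: "(norm (w t))\<^sup>2 \<le> exp \<tau> * (\<gamma>\<^sup>2 / 2) * D"
      proof (rule order_trans[OF w2])
        show "exp t * (\<gamma>\<^sup>2 / 2) * ((norm (R a))\<^sup>2 - (norm (q t))\<^sup>2) \<le> exp \<tau> * (\<gamma>\<^sup>2 / 2) * D"
          using t by (intro mult_mono' mult_right_mono D_ge[OF t] mult_nonneg_nonneg)
            (auto simp: q_def contraction power_mono)
      qed (use t in simp)
      have "\<gamma>\<^sup>2 * (norm (w t))\<^sup>2 \<le> \<gamma>\<^sup>2 * (exp \<tau> * (\<gamma>\<^sup>2 / 2) * D)" by (intro mult_left_mono 3) simp
      with 1 2 show ?thesis by (simp add: mult_ac)
    qed
    have int_q: "((\<lambda>t. 2 * (norm (C (q t)))\<^sup>2) has_integral D) {0..\<tau>}"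
    proof -
      have "((\<lambda>t. - (norm (q t))\<^sup>2) has_vector_derivative 2 * (norm (C (q t)))\<^sup>2) (at t within {0..\<tau>})"
        if "t \<in> {0..\<tau>}" for t
      proof -
        have "((\<lambda>t. - (norm (q t))\<^sup>2) has_real_derivative 2 * (norm (C (q t)))\<^sup>2) (at t within {0..\<tau>})"
          using that DERIV_minus[OF q'[of t]] by (auto elim!: has_field_derivative_subset)
        then show ?thesis by (simp add: has_real_derivative_iff_has_vector_derivative)
      qed
      then have "((\<lambda>t. 2 * (norm (C (q t)))\<^sup>2) has_integral (- (norm (q \<tau>))\<^sup>2 - - (norm (q 0))\<^sup>2)) {0..\<tau>}"
        using \<tau> by (intro fundamental_theorem_of_calculus) auto
      then show ?thesis by (simp add: D_def q0)
    qed
    have int_c: "((\<lambda>t. 2 * (norm (C (q t)))\<^sup>2 + \<gamma>\<^sup>2 * \<gamma>\<^sup>2 * exp \<tau> * D) has_integral K' * D) {0..\<tau>}"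
      using has_integral_add[OF int_q has_integral_const_real[of "\<gamma>\<^sup>2 * \<gamma>\<^sup>2 * exp \<tau> * D" 0 \<tau>]] \<tau>
      by (simp add: K'_def algebra_simps)
    have "continuous_on {0..\<tau>} (\<lambda>t. R (u t))"
    proof -
      have "continuous_on {0..} (\<lambda>t. R (u t))"
        unfolding continuous_on_eq_continuous_within
        using u has_vector_derivative_continuous by fastforce
      then show ?thesis by (rule continuous_on_subset) auto
    qed
    then have "continuous_on {0..\<tau>} (\<lambda>t. (norm (C (R (u t))))\<^sup>2)"
      by (intro continuous_intros C.continuous_on)
    then have "(\<lambda>t. (norm (C (R (u t))))\<^sup>2) integrable_on {0..\<tau>}" by (rule integrable_continuous_real)
    then have "integral {0..\<tau>} (\<lambda>t. (norm (C (R (u t))))\<^sup>2) \<le> K' * D"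
      by (rule has_integral_le[OF integrable_integral int_c Cz])
    then have "k\<^sup>2 * (norm (R a))\<^sup>2 \<le> K' * D" using obs[OF u] u0 by simp
    then have "(norm (q \<tau>))\<^sup>2 \<le> (1 - k\<^sup>2 / K') * (norm (R a))\<^sup>2"
      using K' by (simp add: D_def field_simps)
    also have "\<dots> \<le> (\<kappa> * norm (R a))\<^sup>2"
      by (simp add: \<kappa>_def power_mult_distrib mult_right_mono)
    finally show ?thesis unfolding q_def by (rule power2_le_imp_le) (simp add: \<kappa>_def)
  qed
  have "norm (T \<tau> x) \<le> \<kappa> * norm x" for x
  proof (rule eq_on_dense[OF range_R_dense])
    show "continuous_on UNIV (\<lambda>x. norm (T \<tau> x))"
      using \<tau> by (intro continuous_intros linear_continuous_on T_bounded_linear) simp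
    show "continuous_on UNIV (\<lambda>x. \<kappa> * norm x)" by (intro continuous_intros)
  qed (use key in auto)
  moreover have "\<kappa> < 1" using k K' by (simp add: \<kappa>_def)
  moreover have "0 \<le> \<kappa>" by (simp add: \<kappa>_def)
  ultimately show ?thesis by blast
qed

end

section \<open>Finite-dimensional subspaces\<close>

lemma finite_orthonormal_basis:
  fixes B :: "'a::real_inner set"
  assumes "finite B"
  shows "\<exists>E. finite E \<and> span E = span B \<and>
    (\<forall>x. \<forall>v\<in>span B. inner (x - (\<Sum>e\<in>E. inner x e *\<^sub>R e)) v = 0)"
proof -
  obtain C where C: "finite C" "span C = span B" "pairwise orthogonal C"
    using basis_orthogonal[OF assms] by blast
  define f where "f e = (1 / norm e) *\<^sub>R e" for e :: 'a
  define E where "E = f ` (C - {0})"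
  have inj: "inj_on f (C - {0})"
  proof (rule inj_onI, rule ccontr)
    fix a b assume ab: "a \<in> C - {0}" "b \<in> C - {0}" "f a = f b" "a \<noteq> b"
    then have "inner a b = 0" using C(3) by (auto simp: pairwise_def orthogonal_def)
    then have "inner (f a) (f b) = 0" by (simp add: f_def)
    then have "f a = 0" using ab(3) by simp
    then show False using ab by (simp add: f_def)
  qed
  have spanE: "span E = span B"
  proof -
    have "E \<subseteq> span C" by (auto simp: E_def f_def intro: span_scale span_base)
    moreover have "C \<subseteq> span E"
    proof
      fix a assume "a \<in> C"
      show "a \<in> span E"
      proof (cases "a = 0")
        case False
        then have "f a \<in> span E" using \<open>a \<in> C\<close> by (auto simp: E_def intro!: span_base)
        then have "norm a *\<^sub>R f a \<in> span E" by (rule span_scale)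
        then show ?thesis using False by (simp add: f_def)
      qed (simp add: span_zero)
    qed
    ultimately show ?thesis using C(2) by (metis span_eq)
  qed
  have orth: "inner (x - (\<Sum>e\<in>E. inner x e *\<^sub>R e)) d = 0" if "d \<in> E" for x d
  proof -
    have "inner e d = 0" if e: "e \<in> E" "e \<noteq> d" for e
    proof -
      obtain a b where ab: "a \<in> C" "b \<in> C" "e = f a" "d = f b"
        using e(1) \<open>d \<in> E\<close> unfolding E_def by blast
      then have "inner a b = 0" using e(2) C(3) by (auto simp: pairwise_def orthogonal_def)
      then show ?thesis by (simp add: ab f_def)
    qed
    then have "(\<Sum>e\<in>E. inner x e * inner e d) = (\<Sum>e\<in>{d}. inner x e * inner e d)"
      using \<open>d \<in> E\<close> C(1) by (intro sum.mono_neutral_right) (auto simp: E_def)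
    moreover have "inner d d = 1"
    proof -
      obtain a where "a \<noteq> 0" "d = f a" using \<open>d \<in> E\<close> unfolding E_def by blast
      then have "norm d = 1" by (simp add: f_def)
      then show ?thesis by (simp add: power2_norm_eq_inner[symmetric])
    qed
    ultimately show ?thesis by (simp add: inner_diff_left inner_sum_left)
  qed
  have "inner (x - (\<Sum>e\<in>E. inner x e *\<^sub>R e)) v = 0" if "v \<in> span B" for x v
  proof -
    have "subspace {v. inner (x - (\<Sum>e\<in>E. inner x e *\<^sub>R e)) v = 0}"
      by (auto simp: subspace_def inner_add_right)
    then have "span E \<subseteq> {v. inner (x - (\<Sum>e\<in>E. inner x e *\<^sub>R e)) v = 0}"
      using orth by (intro span_minimal) auto
    then show ?thesis using that spanE by blast
  qed
  moreover have "finite E" using C(1) by (simp add: E_def)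
  ultimately show ?thesis using spanE by blast
qed

text \<open>
  This makes the projections of real inner product spaces available for complex subspaces.
\<close>

lemma complex_span_real:
  fixes B :: "'a::complex_inner set"
  shows "complex_vector.span B = span (B \<union> (\<lambda>x. \<i> *\<^sub>C x) ` B)"
proof (rule antisym)
  let ?S = "span (B \<union> (\<lambda>x. \<i> *\<^sub>C x) ` B)"
  interpret J: bounded_linear "\<lambda>x :: 'a. \<i> *\<^sub>C x" by (rule bounded_linear_scaleC)
  have "(\<lambda>x. \<i> *\<^sub>C x) ` ?S \<subseteq> ?S"
    unfolding linear_span_image[OF J.linear, symmetric] image_Un image_image scaleC_i_i
    by (intro span_minimal) (auto intro: span_base span_neg)
  then have i: "\<i> *\<^sub>C x \<in> ?S" if "x \<in> ?S" for x using that by blast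
  have "c *\<^sub>C x \<in> ?S" if "x \<in> ?S" for c x
  proof -
    have "c *\<^sub>C x = (complex_of_real (Re c) + complex_of_real (Im c) * \<i>) *\<^sub>C x"
      using complex_eq[of c] by (simp add: mult.commute)
    also have "\<dots> = Re c *\<^sub>R x + Im c *\<^sub>R \<i> *\<^sub>C x"
      by (simp only: scaleC_add_left scaleC_of_real flip: scaleC_scaleC)
    finally show ?thesis using that i by (simp add: span_add span_scale)
  qed
  then show "complex_vector.span B \<subseteq> ?S"
    by (intro complex_vector.span_minimal)
      (auto simp: complex_vector.subspace_def span_zero span_add span_base)
  have "r *\<^sub>R x \<in> complex_vector.span B" if "x \<in> complex_vector.span B" for r x
    using complex_vector.span_scale[OF that, of "complex_of_real r"] by (simp add: scaleC_of_real)
  then show "?S \<subseteq> complex_vector.span B"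
    by (intro span_minimal)
      (auto simp: subspace_def complex_vector.span_zero complex_vector.span_add
        intro: complex_vector.span_base complex_vector.span_scale)
qed

section \<open>The Galerkin semigroups\<close>

lemma finite_projection:
  fixes B :: "'a::real_inner set"
  assumes "finite B"
  shows "\<exists>P. bounded_linear P \<and> (\<forall>x. P x \<in> span B) \<and> (\<forall>x. \<forall>v\<in>span B. inner (x - P x) v = 0)"
proof -
  obtain E where E: "finite E" "span E = span B"
    "\<forall>x. \<forall>v\<in>span B. inner (x - (\<Sum>e\<in>E. inner x e *\<^sub>R e)) v = 0"
    using finite_orthonormal_basis[OF assms] by blast
  have "bounded_linear (\<lambda>x. \<Sum>e\<in>E. inner x e *\<^sub>R e)"
    by (intro bounded_linear_sum bounded_linear_compose[OF bounded_linear_scaleR_left bounded_linear_inner_left])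
  moreover have "(\<Sum>e\<in>E. inner x e *\<^sub>R e) \<in> span B" for x
    unfolding E(2)[symmetric] by (intro span_sum span_scale span_base)
  ultimately show ?thesis using E(3) by (intro exI[of _ "\<lambda>x. \<Sum>e\<in>E. inner x e *\<^sub>R e"]) simp
qed

lemma eq_if_orthogonal_in_subspace:
  fixes x y :: "'a::real_inner"
  assumes "subspace V" "x \<in> V" "y \<in> V" "\<And>v. v \<in> V \<Longrightarrow> inner x v = inner y v"
  shows "x = y"
proof -
  have "x - y \<in> V" using assms by (simp add: subspace_diff)
  then have "inner (x - y) (x - y) = 0" using assms(4)[of "x - y"] by (simp only: inner_diff_left diff_self)
  then show ?thesis by simp
qed

text \<open>
  \<open>V\<close> stands for one of the spaces \<open>X\<^sub>h\<close> and \<open>\<delta>\<close> for \<open>M h\<^sup>\<theta>\<close>.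
\<close>

locale galerkin_space = damped_system +
  fixes A0 :: "'a operator" and V :: "'a set" and \<delta> :: real
  assumes sqrt_A0: "\<And>x y. sqrt_operator A0 x = Some y \<longleftrightarrow> x = Q y"
    and V_fd: "finite_dim_subspace V" and V_sub: "V \<subseteq> range Q"
    and approx: "\<And>y. norm (galerkin_proj A0 V (Q y) - Q y) \<le> \<delta> * norm y"
    and \<delta>: "\<delta> \<ge> 0"
begin

text \<open>
  \<open>W = A\<^sub>0\<^sup>1\<^sup>/\<^sup>2 V\<close>.  As \<open>Q\<close> carries the inner product of the space to \<open>\<langle>\<cdot>, \<cdot>\<rangle>\<^sub>1\<^sub>/\<^sub>2\<close>, the Galerkin projection
  is the conjugate by \<open>Q\<close> of the orthogonal projection \<open>PW\<close> onto \<open>W\<close>.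
\<close>

definition W where "W = {w. Q w \<in> V}"

lemma Q_eq_iff [simp]: "Q x = Q y \<longleftrightarrow> x = y"
  using Qinj by (auto dest: injD)

lemma V_eq: "v \<in> V \<longleftrightarrow> (\<exists>w\<in>W. v = Q w)"
  using V_sub by (auto simp: W_def)

lemma V_span: "\<exists>S. finite S \<and> span S = V"
proof -
  obtain S where S: "finite S" "V = complex_vector.span S"
    using V_fd unfolding finite_dim_subspace_def by blast
  then show ?thesis using complex_span_real[of S] by (intro exI[of _ "S \<union> (\<lambda>x. \<i> *\<^sub>C x) ` S"]) simp
qed

lemma V_subspace: "subspace V"
  using V_span subspace_span by metis

lemma W_span: "\<exists>S. finite S \<and> span S = W"
proof -
  obtain S where S: "finite S" "span S = V" using V_span by blast
  have "S \<subseteq> range Q" using V_sub S span_superset by blast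
  then have "Q ` inv Q ` S = S" by (simp add: image_f_inv_f image_image f_inv_into_f subset_iff)
  then have "Q ` span (inv Q ` S) = V"
    using linear_span_image[OF Q.linear, of "inv Q ` S"] S by simp
  then have "W = span (inv Q ` S)" by (auto simp: W_def image_iff)
  then show ?thesis using S by blast
qed

lemma W_subspace: "subspace W"
  using W_span subspace_span by metis

lemma V_scaleC: "v \<in> V \<Longrightarrow> c *\<^sub>C v \<in> V"
  using V_fd unfolding finite_dim_subspace_def by (auto intro: complex_vector.span_scale)

lemma W_scaleC: "w \<in> W \<Longrightarrow> c *\<^sub>C w \<in> W"
  by (simp add: W_def Qsc V_scaleC)

definition PV where "PV = (SOME P. bounded_linear P \<and> (\<forall>x. P x \<in> V) \<and> (\<forall>x. \<forall>v\<in>V. inner (x - P x) v = 0))"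
definition PW where "PW = (SOME P. bounded_linear P \<and> (\<forall>x. P x \<in> W) \<and> (\<forall>x. \<forall>v\<in>W. inner (x - P x) v = 0))"

lemma PV: "bounded_linear PV" "PV x \<in> V" "v \<in> V \<Longrightarrow> inner (PV x) v = inner x v"
proof -
  have "\<exists>P. bounded_linear P \<and> (\<forall>x. P x \<in> V) \<and> (\<forall>x. \<forall>v\<in>V. inner (x - P x) v = 0)"
    using V_span finite_projection by metis
  note * = someI_ex[OF this, folded PV_def]
  show "bounded_linear PV" "PV x \<in> V" using * by blast+
  assume "v \<in> V"
  with * have "inner (x - PV x) v = 0" by blast
  then show "inner (PV x) v = inner x v" by (simp add: inner_diff_left)
qed

lemma PW: "bounded_linear PW" "PW x \<in> W" "w \<in> W \<Longrightarrow> inner (PW x) w = inner x w"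
proof -
  have "\<exists>P. bounded_linear P \<and> (\<forall>x. P x \<in> W) \<and> (\<forall>x. \<forall>v\<in>W. inner (x - P x) v = 0)"
    using W_span finite_projection by metis
  note * = someI_ex[OF this, folded PW_def]
  show "bounded_linear PW" "PW x \<in> W" using * by blast+
  assume "w \<in> W"
  with * have "inner (x - PW x) w = 0" by blast
  then show "inner (PW x) w = inner x w" by (simp add: inner_diff_left)
qed

sublocale PV: bounded_linear PV by (rule PV)
sublocale PW: bounded_linear PW by (rule PW)

lemma PV_id: "v \<in> V \<Longrightarrow> PV v = v"
  by (rule eq_if_orthogonal_in_subspace[OF V_subspace]) (auto simp: PV)

lemma PW_id: "w \<in> W \<Longrightarrow> PW w = w"
  by (rule eq_if_orthogonal_in_subspace[OF W_subspace]) (auto simp: PW)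

lemma norm_PV: "norm (PV x) \<le> norm x"
proof -
  have "norm (PV x) * norm (PV x) = inner x (PV x)"
    using PV(3)[OF PV(2), of x x] by (simp add: power2_norm_eq_inner[symmetric] power2_eq_square)
  also have "\<dots> \<le> norm x * norm (PV x)" by (rule norm_cauchy_schwarz)
  finally show ?thesis by (cases "PV x = 0") auto
qed

abbreviation gproj where "gproj \<equiv> galerkin_proj A0 V"

lemma cinner_half_Q: "cinner_half A0 (Q x) (Q y) = cinner x y"
proof -
  have "sqrt_operator A0 (Q z) = Some z" for z using sqrt_A0 by blast
  then show ?thesis by (simp add: cinner_half_def)
qed

lemma galerkin_proj_Q: "gproj (Q y) = Q (PW y)"
  unfolding galerkin_proj_def
proof (rule the_equality)
  have "cinner (y - PW y) w = 0" if "w \<in> W" for w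
    using PW(3)[OF that, of y] PW(3)[OF W_scaleC[OF that], of y \<i>]
    by (intro complex_eqI) (simp_all add: Im_cinner inner_diff_left flip: inner_eq_Re_cinner)
  then show "Q (PW y) \<in> V \<and> (\<forall>\<phi>\<in>V. cinner_half A0 (Q y - Q (PW y)) \<phi> = 0)"
    using PW(2)[of y] by (auto simp: V_eq cinner_half_Q simp flip: Q.diff)
next
  fix p assume p: "p \<in> V \<and> (\<forall>\<phi>\<in>V. cinner_half A0 (Q y - p) \<phi> = 0)"
  then obtain w where w: "w \<in> W" "p = Q w" by (auto simp: V_eq)
  have "inner w \<psi> = inner (PW y) \<psi>" if "\<psi> \<in> W" for \<psi>
  proof -
    have "cinner_half A0 (Q (y - w)) (Q \<psi>) = 0" using p w that by (auto simp: V_eq Q.diff)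
    then have "inner (y - w) \<psi> = 0" by (simp add: cinner_half_Q inner_eq_Re_cinner)
    then show ?thesis by (simp add: PW(3)[OF that] inner_diff_left)
  qed
  then have "w = PW y" by (rule eq_if_orthogonal_in_subspace[OF W_subspace w(1) PW(2)])
  then show "p = Q (PW y)" by (simp add: w)
qed

lemma galerkin_proj_id: "v \<in> V \<Longrightarrow> gproj v = v"
  by (auto simp: V_eq galerkin_proj_Q PW_id)

text \<open>
  The generator of the discrete semigroup represents the form \<open>c \<langle>v, \<phi>\<rangle>\<^sub>1\<^sub>/\<^sub>2 - \<langle>B v, \<phi>\<rangle>\<close> on \<open>V\<close>.  It is extended
  to the whole space through the orthogonal projection \<open>PV\<close>, so that it becomes a dissipative bounded
  operator commuting with \<open>PV\<close>.  With \<open>D = A\<^sub>0\<^sup>1\<^sup>/\<^sup>2 PV\<close>, which is bounded because \<open>V\<close> has finite dimension,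
  it is \<open>D\<^sup>* c D - PV B PV\<close>.
\<close>

lemma galerkin_operator_exists:
  "\<exists>F. bounded_linear F \<and> (\<forall>x. F x \<in> V) \<and> (\<forall>x. F (PV x) = F x) \<and>
    (\<forall>w\<in>W. \<forall>\<psi>\<in>W. inner (F (Q w)) (Q \<psi>) = inner (c *\<^sub>C w) \<psi> - inner (B (Q w)) (Q \<psi>)) \<and>
    (Re c = 0 \<longrightarrow> (\<forall>x. inner (F x) x \<le> 0))"
proof -
  obtain S where S: "finite S" "span S = V" using V_span by blast
  obtain E where E: "finite E" "span E = V"
    "\<forall>x. \<forall>v\<in>V. inner (x - (\<Sum>e\<in>E. inner x e *\<^sub>R e)) v = 0"
    using finite_orthonormal_basis[OF S(1)] unfolding S(2) by blast
  have PVE: "PV x = (\<Sum>e\<in>E. inner x e *\<^sub>R e)" for x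
  proof (rule eq_if_orthogonal_in_subspace[OF V_subspace PV(2)])
    show "(\<Sum>e\<in>E. inner x e *\<^sub>R e) \<in> V"
      unfolding E(2)[symmetric] by (intro span_sum span_scale span_base)
    fix v assume "v \<in> V"
    then have "inner (x - (\<Sum>e\<in>E. inner x e *\<^sub>R e)) v = 0" "inner (PV x) v = inner x v"
      using E(3) PV(3) by blast+
    then show "inner (PV x) v = inner (\<Sum>e\<in>E. inner x e *\<^sub>R e) v"
      by (simp add: inner_diff_left)
  qed
  define D where "D x = (\<Sum>e\<in>E. inner x e *\<^sub>R inv Q e)" for x
  define D' where "D' y = (\<Sum>e\<in>E. inner y (inv Q e) *\<^sub>R e)" for y
  have D: "bounded_linear D"
    unfolding D_def by (intro bounded_linear_sum bounded_linear_compose[OF bounded_linear_scaleR_left bounded_linear_inner_left])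
  have D': "bounded_linear D'"
    unfolding D'_def by (intro bounded_linear_sum bounded_linear_compose[OF bounded_linear_scaleR_left bounded_linear_inner_left])
  have D'_V: "D' y \<in> V" for y
    unfolding D'_def E(2)[symmetric] by (intro span_sum span_scale span_base)
  have QD: "Q (D x) = PV x" for x
  proof -
    have "Q (inv Q e) = e" if "e \<in> E" for e
    proof -
      have "e \<in> range Q" using that V_sub E(2) span_superset[of E] by blast
      then show ?thesis by (rule f_inv_into_f)
    qed
    then show ?thesis unfolding PVE D_def Q.sum Q.scaleR by (intro sum.cong) auto
  qed
  have adj: "inner (D' y) x = inner y (D x)" for x y
    unfolding D_def D'_def inner_sum_left inner_sum_right by (simp add: inner_commute mult.commute)
  define F where "F x = D' (c *\<^sub>C D x) - PV (B (PV x))" for x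
  have "bounded_linear F"
    unfolding F_def
    by (intro bounded_linear_sub bounded_linear_compose[OF D'] bounded_linear_compose[OF bounded_linear_scaleC] D
        bounded_linear_compose[OF PV(1)] bounded_linear_compose[OF B] PV(1))
  moreover have "F x \<in> V" for x
    unfolding F_def by (intro subspace_diff V_subspace D'_V PV(2))
  moreover have "F (PV x) = F x" for x
  proof -
    have "Q (D (PV x)) = Q (D x)" unfolding QD by (rule PV_id[OF PV(2)])
    then show ?thesis by (simp add: F_def PV_id[OF PV(2)])
  qed
  moreover have "inner (F (Q w)) (Q \<psi>) = inner (c *\<^sub>C w) \<psi> - inner (B (Q w)) (Q \<psi>)" if "w \<in> W" "\<psi> \<in> W" for w \<psi>
  proof -
    have V: "Q w \<in> V" "Q \<psi> \<in> V" using that by (auto simp: W_def)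
    have "Q (D (Q w)) = Q w" "Q (D (Q \<psi>)) = Q \<psi>" unfolding QD using V by (simp_all add: PV_id)
    then have "D (Q w) = w" "D (Q \<psi>) = \<psi>" by simp_all
    then show ?thesis using V by (simp add: F_def inner_diff_left adj PV(3) PV_id)
  qed
  moreover have "inner (F x) x \<le> 0" if "Re c = 0" for x
  proof -
    have "inner (PV (B (PV x))) x = inner (B (PV x)) (PV x)"
      using PV(3)[OF PV(2), of "B (PV x)" x] PV(3)[OF PV(2), of x "B (PV x)"] by (simp add: inner_commute)
    then show ?thesis
      using inner_imaginary_self[OF that, of "D x"] B_pos[of "PV x"] by (simp add: F_def inner_diff_left adj)
  qed
  ultimately show ?thesis by blast
qed

definition F where "F c = (SOME F. bounded_linear F \<and> (\<forall>x. F x \<in> V) \<and> (\<forall>x. F (PV x) = F x) \<and>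
    (\<forall>w\<in>W. \<forall>\<psi>\<in>W. inner (F (Q w)) (Q \<psi>) = inner (c *\<^sub>C w) \<psi> - inner (B (Q w)) (Q \<psi>)) \<and>
    (Re c = 0 \<longrightarrow> (\<forall>x. inner (F x) x \<le> 0)))"

lemma F: "bounded_linear (F c)" "F c x \<in> V" "F c (PV x) = F c x"
  "w \<in> W \<Longrightarrow> \<psi> \<in> W \<Longrightarrow> inner (F c (Q w)) (Q \<psi>) = inner (c *\<^sub>C w) \<psi> - inner (B (Q w)) (Q \<psi>)"
  "Re c = 0 \<Longrightarrow> inner (F c x) x \<le> 0"
  using someI_ex[OF galerkin_operator_exists[of c], folded F_def] by blast+

definition E where "E c t x = operator_exp (F c) t x"

lemma E_derivative: "((\<lambda>t. E c t x) has_vector_derivative F c (E c t x)) (at t within S)"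
  unfolding E_def by (rule operator_exp_has_vector_derivative[OF F(1)])

lemma E_0 [simp]: "E c 0 x = x"
  by (simp add: E_def)

lemma E_diff: "E c t (x - y) = E c t x - E c t y"
  unfolding E_def by (rule operator_exp_diff[OF F(1)])

lemma E_in_V: "x \<in> V \<Longrightarrow> E c t x \<in> V"
proof -
  assume x: "x \<in> V"
  have "F c (PV y) = PV (F c y)" for y using PV_id[OF F(2)] by (simp add: F(3))
  then have "E c t (PV x) = PV (E c t x)" unfolding E_def by (rule operator_exp_commute[OF F(1) PV(1)])
  then show ?thesis using PV(2)[of "E c t x"] by (simp add: PV_id[OF x])
qed

lemma E_contraction:
  assumes "Re c = 0" "t \<ge> 0"
  shows "norm (E c t x) \<le> norm x"
proof -
  have "(norm (E c t x))\<^sup>2 \<le> (norm (E c 0 x))\<^sup>2"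
    by (rule decreasing_if_derivative_nonpos[OF assms(2) norm_power2_has_derivative[OF E_derivative]])
      (simp add: F(5)[OF assms(1)])
  then show ?thesis by simp
qed

text \<open>
  The difference of two discrete solutions has decreasing energy, so the description in the definition
  is unique.
\<close>

lemma discrete_semigroup_eq:
  assumes c: "Re c = 0" and t: "t \<in> {0..\<tau>}"
  shows "discrete_semigroup c A0 B V \<tau> t (Q y) = E c t (gproj (Q y))"
  unfolding discrete_semigroup_def
proof (rule the_equality)
  let ?q = "\<lambda>t. E c t (gproj (Q y))"
  have V: "?q s \<in> V" for s by (rule E_in_V) (use PW(2)[of y] in \<open>simp add: galerkin_proj_Q W_def\<close>)
  have form: "cinner (F c (?q s)) \<phi> = c * cinner_half A0 (?q s) \<phi> - cinner (B (?q s)) \<phi>" if \<phi>: "\<phi> \<in> V" for s \<phi>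
  proof -
    obtain w \<psi> where w: "w \<in> W" "?q s = Q w" and \<psi>: "\<psi> \<in> W" "\<phi> = Q \<psi>" using V[of s] \<phi> by (auto simp: V_eq)
    show ?thesis
      unfolding w(2) \<psi>(2) cinner_half_Q cinner_scaleC_left[symmetric]
      using F(4)[OF w(1) \<psi>(1), of c] F(4)[OF w(1) W_scaleC[OF \<psi>(1)], of c \<i>]
      by (intro complex_eqI) (simp_all add: Im_cinner Qsc flip: inner_eq_Re_cinner)
  qed
  have "discrete_solution c A0 B V \<tau> (Q y) ?q"
    unfolding discrete_solution_def using V form E_derivative
    by (intro conjI exI[of _ "\<lambda>s. F c (?q s)"]) auto
  then show "\<exists>q. discrete_solution c A0 B V \<tau> (Q y) q \<and> ?q t = q t" by blast
  fix v assume "\<exists>q. discrete_solution c A0 B V \<tau> (Q y) q \<and> v = q t"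
  then obtain q q' where q: "q 0 = gproj (Q y)" "\<And>s. s \<in> {0..\<tau>} \<Longrightarrow> q s \<in> V" "v = q t"
    and q': "\<And>s. s \<in> {0..\<tau>} \<Longrightarrow> (q has_vector_derivative q' s) (at s within {0..\<tau>})"
      "\<And>s \<phi>. s \<in> {0..\<tau>} \<Longrightarrow> \<phi> \<in> V \<Longrightarrow> cinner (q' s) \<phi> = c * cinner_half A0 (q s) \<phi> - cinner (B (q s)) \<phi>"
    unfolding discrete_solution_def by blast
  define r where "r s = q s - ?q s" for s
  have "(norm (r t))\<^sup>2 \<le> (norm (r 0))\<^sup>2"
  proof (rule decreasing_on_interval)
    show "0 \<le> t" using t by simp
    fix s assume "s \<in> {0..t}"
    then have s: "s \<in> {0..\<tau>}" using t by simp
    have "(r has_vector_derivative q' s - F c (?q s)) (at s within {0..\<tau>})"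
      unfolding r_def by (intro has_vector_derivative_diff q'(1)[OF s] E_derivative)
    then have "(r has_vector_derivative q' s - F c (?q s)) (at s within {0..t})"
      by (rule has_vector_derivative_within_subset) (use t in auto)
    then show "((\<lambda>s. (norm (r s))\<^sup>2) has_real_derivative 2 * inner (q' s - F c (?q s)) (r s)) (at s within {0..t})"
      by (rule norm_power2_has_derivative)
    obtain w w' where w: "w \<in> W" "q s = Q w" "w' \<in> W" "?q s = Q w'" using q(2)[OF s] V[of s] by (auto simp: V_eq)
    have d: "w - w' \<in> W" using w W_subspace by (simp add: subspace_diff)
    have rs: "r s = Q (w - w')" by (simp only: r_def w Q.diff)
    have "r s \<in> V" using d by (simp add: rs W_def)
    from q'(2)[OF s this] have "inner (q' s) (r s) = inner (c *\<^sub>C w) (w - w') - inner (B (Q w)) (Q (w - w'))"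
      unfolding rs w(2) cinner_half_Q cinner_scaleC_left[symmetric] by (simp add: inner_eq_Re_cinner)
    moreover have "inner (F c (?q s)) (r s) = inner (c *\<^sub>C w') (w - w') - inner (B (Q w')) (Q (w - w'))"
      unfolding w(4) rs by (rule F(4)[OF w(3) d])
    ultimately have "inner (q' s - F c (?q s)) (r s) = inner (c *\<^sub>C (w - w')) (w - w') - inner (B (Q (w - w'))) (Q (w - w'))"
      by (simp add: inner_diff_left complex_vector.scale_right_diff_distrib Q.diff B.diff)
    also have "\<dots> \<le> 0" using inner_imaginary_self[OF c, of "w - w'"] B_pos[of "Q (w - w')"] by linarith
    finally show "2 * inner (q' s - F c (?q s)) (r s) \<le> 0" by simp
  qed
  then show "v = ?q t" by (simp add: r_def q)
qed

lemma discrete_L_eq: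
  assumes "\<tau> \<ge> 0" "v \<in> V"
  shows "discrete_L A0 B V \<tau> v = E (- \<i>) \<tau> (E \<i> \<tau> v)"
proof -
  have eq: "discrete_semigroup c A0 B V \<tau> \<tau> v = E c \<tau> v" if "Re c = 0" "v \<in> V" for c v
    using discrete_semigroup_eq[OF that(1), of \<tau> \<tau>] that(2) assms(1) galerkin_proj_id[OF that(2)]
    by (auto simp: V_eq)
  show ?thesis
    unfolding discrete_L_def o_def using assms(2) by (simp add: eq E_in_V)
qed

text \<open>
  \<open>q = R a\<close> solves \<open>q' = c A\<^sub>0 q + k\<close>, and \<open>\<zeta>\<close> solves the Galerkin equation with source \<open>g\<close>.  The curve
  \<open>e = \<pi> q - \<zeta>\<close> has values in \<open>V\<close>.  Since \<open>\<langle>A\<^sub>0 q, \<phi>\<rangle> = \<langle>q, \<phi>\<rangle>\<^sub>1\<^sub>/\<^sub>2 = \<langle>\<pi> q, \<phi>\<rangle>\<^sub>1\<^sub>/\<^sub>2\<close> for \<open>\<phi> \<in> V\<close>, it satisfies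
  \<open>e' = F e + PV ((\<pi> q' - q') + (k + B q - g) + B (\<pi> q - q))\<close>, and so does its difference to the discrete orbit of
  \<open>e(0)\<close>, which starts at \<open>0\<close>.
\<close>

theorem galerkin_error:
  assumes c: "Re c = 0" and \<tau>: "\<tau> \<ge> 0"
    and a: "\<And>t. t \<in> {0..\<tau>} \<Longrightarrow> (a has_vector_derivative a' t) (at t within {0..\<tau>})"
    and a': "\<And>t. t \<in> {0..\<tau>} \<Longrightarrow> R (a' t) = c *\<^sub>C a t + k t"
    and \<alpha>: "\<And>t. t \<in> {0..\<tau>} \<Longrightarrow> norm (a t) \<le> \<alpha>" "\<And>t. t \<in> {0..\<tau>} \<Longrightarrow> norm (a' t) \<le> \<alpha>'"
    and \<zeta>: "\<And>t. t \<in> {0..\<tau>} \<Longrightarrow> \<zeta> t \<in> V"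
    and \<zeta>': "\<And>s t. 0 \<le> s \<Longrightarrow> s \<le> t \<Longrightarrow> t \<le> \<tau> \<Longrightarrow> (\<zeta>' has_integral (\<zeta> t - \<zeta> s)) {s..t}"
    and N: "negligible N"
    and \<zeta>_V: "\<And>t. t \<in> {0..\<tau>} - N \<Longrightarrow> \<zeta>' t \<in> V"
    and \<zeta>_eq: "\<And>t w \<psi>. t \<in> {0..\<tau>} - N \<Longrightarrow> w \<in> W \<Longrightarrow> \<zeta> t = Q w \<Longrightarrow> \<psi> \<in> W \<Longrightarrow>
      inner (\<zeta>' t) (Q \<psi>) = inner (c *\<^sub>C w) \<psi> - inner (B (Q w)) (Q \<psi>) + inner (g t) (Q \<psi>)"
    and \<gamma>: "\<And>t. t \<in> {0..\<tau>} - N \<Longrightarrow> norm (k t + B (R (a t)) - g t) \<le> \<gamma> t" "\<gamma> integrable_on {0..\<tau>}"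
  shows "norm ((gproj (R (a \<tau>)) - \<zeta> \<tau>) - E c \<tau> (gproj (R (a 0)) - \<zeta> 0))
    \<le> \<tau> * (\<delta> * \<rho> * (\<alpha>' + K * \<alpha>)) + integral {0..\<tau>} \<gamma>"
proof -
  define p where "p t = Q (PW (Q (a t)))" for t
  define p' where "p' t = Q (PW (Q (a' t)))" for t
  have gproj_R: "gproj (R x) = Q (PW (Q x))" for x by (simp add: R_def galerkin_proj_Q)
  have p: "(p has_vector_derivative p' t) (at t within {0..\<tau>})" if "t \<in> {0..\<tau>}" for t
    unfolding p_def p'_def
    by (intro Q.has_vector_derivative PW.has_vector_derivative a that)
  have proj_err: "norm (Q (PW (Q x)) - R x) \<le> \<delta> * \<rho> * norm x" for x
  proof -
    have "norm (Q (PW (Q x)) - R x) \<le> \<delta> * norm (Q x)"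
      using approx[of "Q x"] by (simp add: galerkin_proj_Q R_def)
    also have "\<dots> \<le> \<delta> * (\<rho> * norm x)" by (intro mult_left_mono Q_norm \<delta>)
    finally show ?thesis by (simp add: mult.assoc)
  qed
  define x0 where "x0 = p 0 - \<zeta> 0"
  define r where "r t = (p t - \<zeta> t) - E c t x0" for t
  define r' where "r' t = (p' t - \<zeta>' t) - F c (E c t x0)" for t
  define \<gamma>' where "\<gamma>' t = \<delta> * \<rho> * (\<alpha>' + K * \<alpha>) + \<gamma> t" for t
  interpret Fc: bounded_linear "F c" by (rule F)
  have \<gamma>'_int: "(\<gamma>' has_integral (\<tau> * (\<delta> * \<rho> * (\<alpha>' + K * \<alpha>)) + integral {0..\<tau>} \<gamma>)) {0..\<tau>}"
    unfolding \<gamma>'_def using has_integral_add[OF has_integral_const_real integrable_integral[OF \<gamma>(2)]] \<tau> by simp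
  have "norm (r \<tau>) \<le> norm (r 0) + integral {0..\<tau>} \<gamma>'"
  proof (rule dissipative_energy_estimate[OF F(1)[of c] F(5)[OF c] \<tau> _ N])
    show "(r' has_integral (r t - r s)) {s..t}" if st: "0 \<le> s" "s \<le> t" "t \<le> \<tau>" for s t
    proof -
      have "(p' has_integral (p t - p s)) {s..t}"
        using st by (intro fundamental_theorem_of_calculus has_vector_derivative_within_subset[OF p]) auto
      moreover have "((\<lambda>u. F c (E c u x0)) has_integral (E c t x0 - E c s x0)) {s..t}"
        using st by (intro fundamental_theorem_of_calculus E_derivative)
      ultimately have "(r' has_integral ((p t - p s) - (\<zeta> t - \<zeta> s) - (E c t x0 - E c s x0))) {s..t}"
        unfolding r'_def using \<zeta>'[OF st] by (intro has_integral_diff)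
      then show ?thesis by (simp add: r_def algebra_simps)
    qed
    show "\<gamma>' integrable_on {0..\<tau>}" using \<gamma>'_int by blast
    fix t assume t: "t \<in> {0..\<tau>} - N"
    then have t': "t \<in> {0..\<tau>}" by simp
    obtain w where w: "w \<in> W" "\<zeta> t = Q w" using \<zeta>[OF t'] by (auto simp: V_eq)
    let ?y = "PW (Q (a t))"
    let ?res = "(p' t - R (a' t)) + ((k t + B (R (a t)) - g t) + B (p t - R (a t)))"
    have "r' t - F c (r t) = (p' t - \<zeta>' t) - F c (p t - \<zeta> t)"
      by (simp add: r'_def r_def Fc.diff)
    also have "\<dots> = PV ?res"
    proof (rule eq_if_orthogonal_in_subspace[OF V_subspace _ PV(2)])
      have "p' t \<in> V" using PW(2) by (simp add: p'_def W_def)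
      then show "p' t - \<zeta>' t - F c (p t - \<zeta> t) \<in> V"
        by (intro subspace_diff V_subspace F(2) \<zeta>_V[OF t])
      fix v assume v: "v \<in> V"
      then obtain \<psi> where \<psi>: "\<psi> \<in> W" "v = Q \<psi>" by (auto simp: V_eq)
      have d: "?y - w \<in> W" using PW(2) w W_subspace by (simp add: subspace_diff)
      have "p t - \<zeta> t = Q (?y - w)" by (simp add: p_def w Q.diff)
      then have 1: "inner (F c (p t - \<zeta> t)) v
          = inner (c *\<^sub>C ?y) \<psi> - inner (c *\<^sub>C w) \<psi> - inner (B (p t)) v + inner (B (Q w)) v"
        unfolding \<psi>(2) using F(4)[OF d \<psi>(1), of c]
        by (simp add: p_def Q.diff B.diff inner_diff_left complex_vector.scale_right_diff_distrib)
      have 2: "inner (\<zeta>' t) v = inner (c *\<^sub>C w) \<psi> - inner (B (Q w)) v + inner (g t) v"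
        unfolding \<psi>(2) by (rule \<zeta>_eq[OF t w \<psi>(1)])
      have "inner (c *\<^sub>C ?y) \<psi> = inner ?y (cnj c *\<^sub>C \<psi>)"
        by (simp add: inner_scaleC_right)
      also have "\<dots> = inner (Q (a t)) (cnj c *\<^sub>C \<psi>)" by (rule PW(3)[OF W_scaleC[OF \<psi>(1)]])
      also have "\<dots> = inner (c *\<^sub>C a t) v"
        by (simp add: inner_scaleC_right \<psi>(2) Qsc flip: Qsym)
      finally have 3: "inner (c *\<^sub>C ?y) \<psi> = inner (c *\<^sub>C a t) v" .
      have 4: "inner (R (a' t)) v = inner (c *\<^sub>C a t) v + inner (k t) v"
        by (simp add: a'[OF t'] inner_add_left)
      show "inner (p' t - \<zeta>' t - F c (p t - \<zeta> t)) v = inner (PV ?res) v"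
        unfolding PV(3)[OF v] using 1 2 3 4 by (simp add: inner_diff_left inner_add_left B.diff)
    qed
    finally have "norm (r' t - F c (r t)) \<le> norm ?res" using norm_PV by simp
    also have "\<dots> \<le> \<delta> * \<rho> * \<alpha>' + (\<gamma> t + K * (\<delta> * \<rho> * \<alpha>))"
    proof (intro norm_triangle_mono)
      have \<delta>\<rho>: "\<delta> * \<rho> \<ge> 0" using \<delta> \<rho> by simp
      show "norm (p' t - R (a' t)) \<le> \<delta> * \<rho> * \<alpha>'"
        unfolding p'_def using \<alpha>(2)[OF t'] \<delta>\<rho> by (intro order_trans[OF proj_err] mult_left_mono)
      show "norm (k t + B (R (a t)) - g t) \<le> \<gamma> t" by (rule \<gamma>(1)[OF t])
      have "norm (p t - R (a t)) \<le> \<delta> * \<rho> * \<alpha>"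
        unfolding p_def using \<alpha>(1)[OF t'] \<delta>\<rho> by (intro order_trans[OF proj_err] mult_left_mono)
      then show "norm (B (p t - R (a t))) \<le> K * (\<delta> * \<rho> * \<alpha>)"
        using K by (intro order_trans[OF B_norm] mult_left_mono)
    qed
    finally show "norm (r' t - F c (r t)) \<le> \<gamma>' t" by (simp add: \<gamma>'_def algebra_simps)
  qed
  moreover have "r 0 = 0" by (simp add: r_def x0_def)
  ultimately show ?thesis
    using integral_unique[OF \<gamma>'_int] by (simp add: r_def p_def x0_def gproj_R)
qed

end

section \<open>Measurability of the output error\<close>

lemma AE_lebesgue_on_negligible:
  fixes \<tau> :: real
  assumes "AE t in lebesgue_on {0..\<tau>}. P t"
  obtains N where "negligible N" "\<And>t. t \<in> {0..\<tau>} - N \<Longrightarrow> P t"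
proof -
  from assms obtain N where N: "N \<in> null_sets (lebesgue_on {0..\<tau>})" "{t \<in> space (lebesgue_on {0..\<tau>}). \<not> P t} \<subseteq> N"
    unfolding eventually_ae_filter by blast
  then have "negligible N" by (simp add: negligible_iff_null_sets null_sets_restrict_space)
  then show thesis using that N(2) by (auto simp: space_restrict_space)
qed

text \<open>
  \<open>y\<close> is almost everywhere a limit of functions with finitely many values, and for a constant \<open>b\<close> the
  function \<open>\<parallel>G (v - b)\<parallel>\<close> is continuous; this gives measurability, and \<open>\<parallel>v\<parallel> + \<parallel>y\<parallel>\<close> is a majorant.
\<close>

lemma integrable_norm_image_L1:
  fixes G :: "'b::real_normed_vector \<Rightarrow> 'a::real_normed_vector"
  assumes G: "bounded_linear G" and v: "continuous_on {0..\<tau>} v" and y: "L1_on \<tau> y"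
  shows "(\<lambda>t. norm (G (v t - y t))) integrable_on {0..\<tau>}"
proof -
  interpret G: bounded_linear G by fact
  let ?M = "lebesgue_on {0..\<tau>}"
  obtain s where s: "\<And>n. simple_function ?M (s n)" "AE t in ?M. (\<lambda>n. s n t) \<longlonglongrightarrow> y t"
    using y unfolding L1_on_def by blast
  have yint: "(\<lambda>t. norm (y t)) integrable_on {0..\<tau>}" using y by (simp add: L1_on_def)
  obtain N where N: "negligible N" "\<And>t. t \<in> {0..\<tau>} - N \<Longrightarrow> (\<lambda>n. s n t) \<longlonglongrightarrow> y t"
    using AE_lebesgue_on_negligible[OF s(2)] by blast
  have meas: "(\<lambda>t. norm (G (v t - s n t))) \<in> borel_measurable ?M" for n
  proof (rule measurable_compose_countable'[where f = "\<lambda>b t. norm (G (v t - b))" and g = "s n" and I = "s n ` space ?M"])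
    show "(\<lambda>t. norm (G (v t - b))) \<in> borel_measurable ?M" for b
      by (intro continuous_imp_measurable_on_sets_lebesgue continuous_on_norm G.continuous_on
          continuous_on_diff v continuous_on_const) simp
    show "countable (s n ` space ?M)"
      using simple_functionD(1)[OF s(1)] by (rule countable_finite)
    then show "s n \<in> measurable ?M (count_space (s n ` space ?M))"
      using simple_functionD(2)[OF s(1)] by (simp add: measurable_count_space_eq_countable)
  qed
  have Nsets: "N \<inter> {0..\<tau>} \<in> sets ?M"
    using N(1) by (auto simp: negligible_iff_null_sets sets_restrict_space Int_commute)
  define f where "f n t = (if t \<in> N \<inter> {0..\<tau>} then 0 else norm (G (v t - s n t)))" for n t
  define g where "g t = (if t \<in> N \<inter> {0..\<tau>} then 0 else norm (G (v t - y t)))" for t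
  have "f n \<in> borel_measurable ?M" for n
    unfolding f_def
    using Nsets by (intro measurable_If_set meas measurable_const) (auto simp: space_restrict_space)
  moreover have "(\<lambda>n. f n t) \<longlonglongrightarrow> g t" if "t \<in> space ?M" for t
  proof (cases "t \<in> N")
    case False
    then have "(\<lambda>n. s n t) \<longlonglongrightarrow> y t" using that by (intro N) (simp add: space_restrict_space)
    then have "(\<lambda>n. norm (G (v t - s n t))) \<longlonglongrightarrow> norm (G (v t - y t))"
      by (intro tendsto_intros G.tendsto)
    then show ?thesis using False by (simp add: f_def g_def)
  qed (use that in \<open>simp add: f_def g_def space_restrict_space\<close>)
  ultimately have "g \<in> borel_measurable ?M" by (rule borel_measurable_LIMSEQ_real[rotated])
  obtain K where K: "\<And>x. norm (G x) \<le> norm x * K" "K \<ge> 0" using G.nonneg_bounded by blast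
  have "(\<lambda>t. (norm (v t) + norm (y t)) * K) integrable_on {0..\<tau>}"
    by (intro integrable_on_mult_left integrable_add yint integrable_continuous_real continuous_on_norm v)
  then have "g integrable_on {0..\<tau>}"
  proof (rule measurable_bounded_by_integrable_imp_integrable[OF \<open>g \<in> borel_measurable ?M\<close>])
    fix t assume "t \<in> {0..\<tau>}"
    have "norm (G (v t - y t)) \<le> norm (v t - y t) * K" by (rule K)
    also have "\<dots> \<le> (norm (v t) + norm (y t)) * K" by (intro mult_right_mono norm_triangle_ineq4 K)
    finally show "norm (g t) \<le> (norm (v t) + norm (y t)) * K" using K(2) by (auto simp: g_def)
  qed simp
  then show ?thesis
    by (rule integrable_spike[OF _ N(1)]) (auto simp: g_def)
qed

lemma has_integral_increment:
  fixes f :: "real \<Rightarrow> 'a::banach"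
  assumes z: "\<And>t. t \<in> {0..\<tau>} \<Longrightarrow> (f has_integral (z t - z 0)) {0..t}"
    and st: "0 \<le> s" "s \<le> t" "t \<le> \<tau>"
  shows "(f has_integral (z t - z s)) {s..t}"
proof -
  have t: "(f has_integral (z t - z 0)) {0..t}" and s: "(f has_integral (z s - z 0)) {0..s}"
    using z st by auto
  then have "f integrable_on {s..t}" using st by (auto intro: integrable_on_subinterval)
  then obtain i where i: "(f has_integral i) {s..t}" by blast
  have "(f has_integral (z s - z 0) + i) {0..t}"
    by (rule has_integral_combine[OF st(1,2) s i])
  then have "(z s - z 0) + i = z t - z 0" using t by (rule has_integral_unique)
  then have "i = z t - z s" by (simp add: algebra_simps)
  with i show ?thesis by simp
qed

section \<open>Errors of the discrete observers\<close>

context galerkin_space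
begin

lemma discrete_observer_weak:
  assumes obs: "discrete_observer \<sigma> A0 C V \<tau> y \<zeta>" and BC: "\<And>x. B x = cadjoint C (C x)"
  obtains \<zeta>' N where "negligible N" "\<And>t. t \<in> {0..\<tau>} \<Longrightarrow> \<zeta> t \<in> V"
    "\<And>s t. 0 \<le> s \<Longrightarrow> s \<le> t \<Longrightarrow> t \<le> \<tau> \<Longrightarrow> (\<zeta>' has_integral (\<zeta> t - \<zeta> s)) {s..t}"
    "\<And>t. t \<in> {0..\<tau>} - N \<Longrightarrow> \<zeta>' t \<in> V"
    "\<And>t w \<psi>. t \<in> {0..\<tau>} - N \<Longrightarrow> w \<in> W \<Longrightarrow> \<zeta> t = Q w \<Longrightarrow> \<psi> \<in> W \<Longrightarrow>
      inner (\<zeta>' t) (Q \<psi>) = inner (\<i> *\<^sub>C w) \<psi> - \<sigma> * inner (B (Q w)) (Q \<psi>) + \<sigma> * inner (cadjoint C (y t)) (Q \<psi>)"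
proof -
  obtain \<zeta>' where V: "\<And>t. t \<in> {0..\<tau>} \<Longrightarrow> \<zeta> t \<in> V"
    and int: "\<And>t. t \<in> {0..\<tau>} \<Longrightarrow> (\<zeta>' has_integral (\<zeta> t - \<zeta> 0)) {0..t}"
    and ae: "AE t in lebesgue_on {0..\<tau>}. \<zeta>' t \<in> V \<and> (\<forall>\<phi>\<in>V. cinner (\<zeta>' t) \<phi> =
            \<i> * cinner_half A0 (\<zeta> t) \<phi> - \<sigma> * cinner (cadjoint C (C (\<zeta> t))) \<phi>
            + \<sigma> * cinner (cadjoint C (y t)) \<phi>)"
    using obs unfolding discrete_observer_def by blast
  obtain N where N: "negligible N" and eq: "\<And>t. t \<in> {0..\<tau>} - N \<Longrightarrow> \<zeta>' t \<in> V \<and> (\<forall>\<phi>\<in>V. cinner (\<zeta>' t) \<phi> =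
            \<i> * cinner_half A0 (\<zeta> t) \<phi> - \<sigma> * cinner (cadjoint C (C (\<zeta> t))) \<phi>
            + \<sigma> * cinner (cadjoint C (y t)) \<phi>)"
    using AE_lebesgue_on_negligible[OF ae] by blast
  show thesis
  proof (rule that[OF N V])
    show "(\<zeta>' has_integral (\<zeta> t - \<zeta> s)) {s..t}" if "0 \<le> s" "s \<le> t" "t \<le> \<tau>" for s t
      by (rule has_integral_increment[OF int that])
    show "\<zeta>' t \<in> V" if "t \<in> {0..\<tau>} - N" for t using eq[OF that] by blast
    fix t w \<psi> assume t: "t \<in> {0..\<tau>} - N" and w: "w \<in> W" "\<zeta> t = Q w" and \<psi>: "\<psi> \<in> W"
    have "cinner (\<zeta>' t) (Q \<psi>) = \<i> * cinner_half A0 (\<zeta> t) (Q \<psi>) - \<sigma> * cinner (cadjoint C (C (\<zeta> t))) (Q \<psi>)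
            + \<sigma> * cinner (cadjoint C (y t)) (Q \<psi>)"
      using eq[OF t] \<psi> by (simp add: W_def)
    then have "Re (cinner (\<zeta>' t) (Q \<psi>)) = Re (cinner (\<i> *\<^sub>C w) \<psi>) - \<sigma> * Re (cinner (B (Q w)) (Q \<psi>))
            + \<sigma> * Re (cinner (cadjoint C (y t)) (Q \<psi>))"
      by (simp add: w cinner_half_Q cinner_scaleC_left BC)
    then show "inner (\<zeta>' t) (Q \<psi>) = inner (\<i> *\<^sub>C w) \<psi> - \<sigma> * inner (B (Q w)) (Q \<psi>) + \<sigma> * inner (cadjoint C (y t)) (Q \<psi>)"
      by (simp only: inner_eq_Re_cinner)
  qed
qed

text \<open>
  The output of the system enters the exact equation as \<open>k + B z - C\<^sup>* y = C\<^sup>* (C z - y)\<close> with \<open>k = 0\<close>.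
\<close>

lemma forward_observer_error:
  assumes \<tau>: "\<tau> \<ge> 0" and C: "bounded_linear (cadjoint C)" and BC: "\<And>x. B x = cadjoint C (C x)"
    and a: "\<And>t. t \<in> {0..\<tau>} \<Longrightarrow> (a has_vector_derivative a' t) (at t within {0..\<tau>})"
    and a': "\<And>t. t \<in> {0..\<tau>} \<Longrightarrow> R (a' t) = \<i> *\<^sub>C a t"
    and \<alpha>: "\<And>t. t \<in> {0..\<tau>} \<Longrightarrow> norm (a t) \<le> \<alpha>" "\<And>t. t \<in> {0..\<tau>} \<Longrightarrow> norm (a' t) \<le> \<alpha>'"
    and obs: "discrete_observer 1 A0 C V \<tau> y \<zeta>"
    and int: "(\<lambda>t. norm (cadjoint C (C (R (a t)) - y t))) integrable_on {0..\<tau>}"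
  shows "norm ((gproj (R (a \<tau>)) - \<zeta> \<tau>) - E \<i> \<tau> (gproj (R (a 0)) - \<zeta> 0))
    \<le> \<tau> * (\<delta> * \<rho> * (\<alpha>' + K * \<alpha>)) + integral {0..\<tau>} (\<lambda>t. norm (cadjoint C (C (R (a t)) - y t)))"
proof -
  interpret C': bounded_linear "cadjoint C" by (rule C)
  obtain \<zeta>' N where *: "negligible N" "\<And>t. t \<in> {0..\<tau>} \<Longrightarrow> \<zeta> t \<in> V"
    "\<And>s t. 0 \<le> s \<Longrightarrow> s \<le> t \<Longrightarrow> t \<le> \<tau> \<Longrightarrow> (\<zeta>' has_integral (\<zeta> t - \<zeta> s)) {s..t}"
    "\<And>t. t \<in> {0..\<tau>} - N \<Longrightarrow> \<zeta>' t \<in> V"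
    "\<And>t w \<psi>. t \<in> {0..\<tau>} - N \<Longrightarrow> w \<in> W \<Longrightarrow> \<zeta> t = Q w \<Longrightarrow> \<psi> \<in> W \<Longrightarrow>
      inner (\<zeta>' t) (Q \<psi>) = inner (\<i> *\<^sub>C w) \<psi> - 1 * inner (B (Q w)) (Q \<psi>) + 1 * inner (cadjoint C (y t)) (Q \<psi>)"
    by (rule discrete_observer_weak[OF obs BC]) blast
  show ?thesis
  proof (rule galerkin_error[where a' = a' and k = "\<lambda>_. 0" and \<zeta>' = \<zeta>' and N = N and g = "\<lambda>t. cadjoint C (y t)"])
    show "norm (0 + B (R (a t)) - cadjoint C (y t)) \<le> norm (cadjoint C (C (R (a t)) - y t))" for t
      by (simp add: BC C'.diff)
  qed (use \<tau> a a' \<alpha> * int in simp_all)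
qed

text \<open>
  Reversing time turns the backward observer into a Galerkin equation with \<open>c = -i\<close>, whose damping has
  the right sign.
\<close>

lemma backward_observer_error:
  assumes \<tau>: "\<tau> \<ge> 0" and C: "bounded_linear (cadjoint C)" and BC: "\<And>x. B x = cadjoint C (C x)"
    and a: "\<And>t. t \<in> {0..\<tau>} \<Longrightarrow> (a has_vector_derivative a' t) (at t within {0..\<tau>})"
    and a': "\<And>t. t \<in> {0..\<tau>} \<Longrightarrow> R (a' t) = \<i> *\<^sub>C a t"
    and \<alpha>: "\<And>t. t \<in> {0..\<tau>} \<Longrightarrow> norm (a t) \<le> \<alpha>" "\<And>t. t \<in> {0..\<tau>} \<Longrightarrow> norm (a' t) \<le> \<alpha>'"
    and obs: "discrete_observer (- 1) A0 C V \<tau> y \<zeta>"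
    and int: "(\<lambda>t. norm (cadjoint C (C (R (a t)) - y t))) integrable_on {0..\<tau>}"
  shows "norm ((gproj (R (a 0)) - \<zeta> 0) - E (- \<i>) \<tau> (gproj (R (a \<tau>)) - \<zeta> \<tau>))
    \<le> \<tau> * (\<delta> * \<rho> * (\<alpha>' + K * \<alpha>)) + integral {0..\<tau>} (\<lambda>t. norm (cadjoint C (C (R (a t)) - y t)))"
proof -
  interpret C': bounded_linear "cadjoint C" by (rule C)
  obtain \<zeta>' N where *: "negligible N" "\<And>t. t \<in> {0..\<tau>} \<Longrightarrow> \<zeta> t \<in> V"
    "\<And>s t. 0 \<le> s \<Longrightarrow> s \<le> t \<Longrightarrow> t \<le> \<tau> \<Longrightarrow> (\<zeta>' has_integral (\<zeta> t - \<zeta> s)) {s..t}"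
    "\<And>t. t \<in> {0..\<tau>} - N \<Longrightarrow> \<zeta>' t \<in> V"
    "\<And>t w \<psi>. t \<in> {0..\<tau>} - N \<Longrightarrow> w \<in> W \<Longrightarrow> \<zeta> t = Q w \<Longrightarrow> \<psi> \<in> W \<Longrightarrow>
      inner (\<zeta>' t) (Q \<psi>) = inner (\<i> *\<^sub>C w) \<psi> - (- 1) * inner (B (Q w)) (Q \<psi>) + (- 1) * inner (cadjoint C (y t)) (Q \<psi>)"
    by (rule discrete_observer_weak[OF obs BC]) blast
  let ?\<gamma> = "\<lambda>t. norm (cadjoint C (C (R (a t)) - y t))"
  have img: "(\<lambda>t. \<tau> - t) ` {s..t} = {\<tau> - t..\<tau> - s}" for s t :: real
    by (auto simp: image_iff intro!: bexI[where x = "\<tau> - _"])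
  have refl: "((\<lambda>u. f (\<tau> - u)) has_integral i) {s..t}" if "(f has_integral i) {\<tau> - t..\<tau> - s}"
    for f :: "real \<Rightarrow> 'c::banach" and i s t
  proof -
    have "((\<lambda>u. f ((-1) *\<^sub>R u + \<tau>)) has_integral (1 / \<bar>-1\<bar> ^ DIM(real)) *\<^sub>R i)
        ((\<lambda>x. (1 / (-1)) *\<^sub>R x + -((1 / (-1)) *\<^sub>R \<tau>)) ` cbox (\<tau> - t) (\<tau> - s))"
      by (rule has_integral_affinity) (use that in simp_all)
    then show ?thesis using img[of "\<tau> - t" "\<tau> - s"] by simp
  qed
  define N' where "N' = (\<lambda>t. \<tau> - t) ` N"
  have N': "negligible N'"
    unfolding N'_def by (rule negligible_differentiable_image_negligible[OF _ *(1)]) (auto intro!: derivative_intros)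
  have N'_iff: "\<tau> - t \<in> {0..\<tau>} - N" if "t \<in> {0..\<tau>} - N'" for t
    using that by (force simp: N'_def)
  have int': "((\<lambda>t. ?\<gamma> (\<tau> - t)) has_integral integral {0..\<tau>} ?\<gamma>) {0..\<tau>}"
    by (rule refl) (use int in auto)
  have "norm ((gproj (R (a (\<tau> - \<tau>))) - \<zeta> (\<tau> - \<tau>)) - E (- \<i>) \<tau> (gproj (R (a (\<tau> - 0))) - \<zeta> (\<tau> - 0)))
    \<le> \<tau> * (\<delta> * \<rho> * (\<alpha>' + K * \<alpha>)) + integral {0..\<tau>} (\<lambda>t. ?\<gamma> (\<tau> - t))"
  proof (rule galerkin_error[where a' = "\<lambda>t. - a' (\<tau> - t)" and k = "\<lambda>_. 0" and \<zeta>' = "\<lambda>t. - \<zeta>' (\<tau> - t)"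
        and N = N' and g = "\<lambda>t. cadjoint C (y (\<tau> - t))"])
    show "norm (0 + B (R (a (\<tau> - t))) - cadjoint C (y (\<tau> - t))) \<le> ?\<gamma> (\<tau> - t)" for t
      by (simp add: BC C'.diff)
    fix t assume t: "t \<in> {0..\<tau>}"
    then have t': "\<tau> - t \<in> {0..\<tau>}" by simp
    have "((\<lambda>t. \<tau> - t) has_vector_derivative -1) (at t within {0..\<tau>})"
      by (auto intro!: derivative_eq_intros simp: has_vector_derivative_def fun_eq_iff)
    from vector_diff_chain_within[OF this, of a] a[OF t']
    show "((\<lambda>t. a (\<tau> - t)) has_vector_derivative - a' (\<tau> - t)) (at t within {0..\<tau>})"
      using img[of 0 \<tau>] by (simp add: o_def)
    show "R (- a' (\<tau> - t)) = - \<i> *\<^sub>C a (\<tau> - t) + 0"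
      using a'[OF t'] by (simp add: R.neg complex_vector.scale_minus_left)
    show "\<zeta> (\<tau> - t) \<in> V" by (rule *(2)[OF t'])
    show "norm (a (\<tau> - t)) \<le> \<alpha>" "norm (- a' (\<tau> - t)) \<le> \<alpha>'" using \<alpha>[OF t'] by simp_all
  next
    fix s t assume st: "0 \<le> s" "s \<le> t" "t \<le> \<tau>"
    have "(\<zeta>' has_integral (\<zeta> (\<tau> - s) - \<zeta> (\<tau> - t))) {\<tau> - t..\<tau> - s}" by (rule *(3)) (use st in auto)
    from has_integral_neg[OF refl[OF this]]
    show "((\<lambda>t. - \<zeta>' (\<tau> - t)) has_integral (\<zeta> (\<tau> - t) - \<zeta> (\<tau> - s))) {s..t}" by simp
  next
    fix t assume t: "t \<in> {0..\<tau>} - N'"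
    show "- \<zeta>' (\<tau> - t) \<in> V" using *(4)[OF N'_iff[OF t]] V_subspace by (simp add: subspace_neg)
    fix w \<psi> assume "w \<in> W" "\<zeta> (\<tau> - t) = Q w" "\<psi> \<in> W"
    from *(5)[OF N'_iff[OF t] this]
    show "inner (- \<zeta>' (\<tau> - t)) (Q \<psi>) = inner (- \<i> *\<^sub>C w) \<psi> - inner (B (Q w)) (Q \<psi>) + inner (cadjoint C (y (\<tau> - t))) (Q \<psi>)"
      by (simp add: complex_vector.scale_minus_left)
  qed (use \<tau> N' int' in auto)
  then show ?thesis using integral_unique[OF int'] by simp
qed

end

section \<open>Growth of the powers of \<open>L\<close> in the domains\<close>

locale damped_pair = damped_system Q B K K1 \<rho> +
    P: damped_semigroup Q B K K1 \<rho> \<i> Tp + M: damped_semigroup Q B K K1 \<rho> "- \<i>" Tm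
  for Q B :: "'a::complex_hilbert \<Rightarrow> 'a" and K K1 \<rho> Tp Tm +
  fixes \<tau> \<eta> :: real
  assumes \<tau>: "\<tau> > 0" and \<eta>: "0 \<le> \<eta>" "\<eta> < 1"
    and L_norm: "\<And>x. norm (Tm \<tau> (Tp \<tau> x)) \<le> \<eta> * norm x"
begin

definition L where "L x = Tm \<tau> (Tp \<tau> x)"

text \<open>
  The constants of the growth and consistency estimates.  They are the same for all Galerkin spaces.
\<close>

definition step_const where "step_const = 2 * (orbit_const + K1) + (4 * K * K1 + 2 * K * (orbit_const + K1)) * \<rho>\<^sup>2"
definition graph_const where "graph_const = 1 + 4 * K * \<rho>\<^sup>2 / (1 - \<eta>)"
definition growth_const where "growth_const = step_const * graph_const * \<rho>\<^sup>2"

lemma const_nonneg: "0 \<le> step_const" "0 \<le> graph_const" "0 \<le> growth_const"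
  using K K1 orbit_const_nonneg \<eta> by (auto simp: step_const_def graph_const_def growth_const_def)

text \<open>
  Two applications of the additive growth estimate.
\<close>

lemma L_step:
  "\<exists>b. L (R (R a)) = R (R b) \<and> norm (R b) \<le> norm (R a) + 4 * K * norm (R (R a)) \<and>
    norm b \<le> norm a + step_const * norm (R a)"
proof -
  have \<tau>0: "\<tau> \<ge> 0" using \<tau> by simp
  obtain b where b: "Tp \<tau> (R (R a)) = R (R b)" "norm (R b) \<le> norm (R a) + 2 * K * norm (R (R a))"
    "norm b \<le> norm a + orbit_const * norm (R a) + K1 * (norm (R a) + 2 * K * norm (R (R a)))"
    using P.semigroup_dom2_growth[OF \<tau>0, of a] by blast
  obtain d where d: "Tm \<tau> (R (R b)) = R (R d)" "norm (R d) \<le> norm (R b) + 2 * K * norm (R (R b))"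
    "norm d \<le> norm b + orbit_const * norm (R b) + K1 * (norm (R b) + 2 * K * norm (R (R b)))"
    using M.semigroup_dom2_growth[OF \<tau>0, of b] by blast
  define n1 n2 where "n1 = norm (R a)" and "n2 = norm (R (R a))"
  have n: "n1 \<ge> 0" "n2 \<ge> 0" "n2 \<le> \<rho>\<^sup>2 * n1" by (auto simp: n1_def n2_def R_norm)
  have RRb: "norm (R (R b)) \<le> n2" using P.contraction[OF \<tau>0, of "R (R a)"] by (simp add: b(1) n2_def)
  then have KRRb: "2 * K * norm (R (R b)) \<le> 2 * K * n2" using K by (intro mult_left_mono) auto
  have 1: "norm (R b) \<le> n1 + 2 * K * n2" using b(2) by (simp add: n1_def n2_def)
  have "norm d \<le> norm b + (orbit_const + K1) * norm (R b) + K1 * (2 * K * norm (R (R b)))"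
    using d(3) by (simp add: algebra_simps)
  also have "\<dots> \<le> (norm a + orbit_const * n1 + K1 * (n1 + 2 * K * n2)) + (orbit_const + K1) * (n1 + 2 * K * n2) + K1 * (2 * K * n2)"
    using b(3) 1 RRb K K1 orbit_const_nonneg unfolding n1_def[symmetric] n2_def[symmetric]
    by (intro add_mono mult_left_mono) auto
  also have "\<dots> = norm a + 2 * (orbit_const + K1) * n1 + (4 * K * K1 + 2 * K * (orbit_const + K1)) * n2"
    by (simp add: algebra_simps)
  also have "\<dots> \<le> norm a + 2 * (orbit_const + K1) * n1 + (4 * K * K1 + 2 * K * (orbit_const + K1)) * (\<rho>\<^sup>2 * n1)"
    using n K K1 orbit_const_nonneg by (intro add_mono mult_left_mono) auto
  also have "\<dots> = norm a + step_const * n1" by (simp add: step_const_def algebra_simps)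
  finally have "norm d \<le> norm a + step_const * norm (R a)" by (simp add: n1_def)
  moreover have "norm (R d) \<le> norm (R a) + 4 * K * norm (R (R a))"
    using d(2) 1 KRRb by (simp add: n1_def n2_def)
  ultimately show ?thesis using b(1) d(1) by (auto simp: L_def)
qed

text \<open>
  Because \<open>T\<^sup>\<plusminus>\<close> increase \<open>\<parallel>A\<^sub>0 x\<parallel>\<close> only by a multiple of \<open>\<parallel>x\<parallel>\<close>, and \<open>\<parallel>L\<^sup>n x\<parallel>\<close> is summable, the norms
  \<open>\<parallel>L\<^sup>n x\<parallel>\<^sub>1\<close> stay bounded and \<open>\<parallel>L\<^sup>n x\<parallel>\<^sub>2\<close> grow at most linearly.
\<close>

lemma L_iterates:
  "\<exists>b. (L ^^ n) (R (R a)) = R (R b) \<and> norm (R (R b)) \<le> \<eta> ^ n * norm (R (R a)) \<and>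
    norm (R b) \<le> graph_const * norm (R a) \<and> norm b \<le> (1 + real n * growth_const) * norm a"
proof -
  let ?n1 = "norm (R a)" and ?n2 = "norm (R (R a))"
  have geometric: "norm y \<le> graph_const * ?n1" if "norm y \<le> ?n1 + 4 * K * (\<Sum>j<n. \<eta> ^ j) * ?n2" for y :: 'a and n
  proof -
    have "(\<Sum>j<n. \<eta> ^ j) \<le> 1 / (1 - \<eta>)"
      using \<eta> by (simp add: sum_gp_strict divide_right_mono)
    then have "4 * K * (\<Sum>j<n. \<eta> ^ j) * ?n2 \<le> 4 * K * (1 / (1 - \<eta>)) * (\<rho>\<^sup>2 * ?n1)"
      using K \<eta> by (intro mult_mono mult_left_mono R_norm mult_nonneg_nonneg) (auto intro: sum_nonneg)
    then show ?thesis using that by (simp add: graph_const_def algebra_simps)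
  qed
  have "\<exists>b. (L ^^ n) (R (R a)) = R (R b) \<and> norm (R (R b)) \<le> \<eta> ^ n * ?n2 \<and>
    norm (R b) \<le> ?n1 + 4 * K * (\<Sum>j<n. \<eta> ^ j) * ?n2 \<and> norm b \<le> norm a + real n * step_const * (graph_const * ?n1)"
  proof (induction n)
    case 0
    show ?case by (intro exI[of _ a]) simp
  next
    case (Suc n)
    then obtain b where b: "(L ^^ n) (R (R a)) = R (R b)" "norm (R (R b)) \<le> \<eta> ^ n * ?n2"
      "norm (R b) \<le> ?n1 + 4 * K * (\<Sum>j<n. \<eta> ^ j) * ?n2" "norm b \<le> norm a + real n * step_const * (graph_const * ?n1)" by blast
    obtain d where d: "L (R (R b)) = R (R d)" "norm (R d) \<le> norm (R b) + 4 * K * norm (R (R b))"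
      "norm d \<le> norm b + step_const * norm (R b)" using L_step by blast
    have "norm (R (R d)) \<le> \<eta> * norm (R (R b))" using L_norm[of "R (R b)"] d(1) by (simp add: L_def)
    also have "\<dots> \<le> \<eta> * (\<eta> ^ n * ?n2)" using b(2) \<eta> by (intro mult_left_mono)
    finally have 0: "norm (R (R d)) \<le> \<eta> ^ Suc n * ?n2" by simp
    have "4 * K * norm (R (R b)) \<le> 4 * K * (\<eta> ^ n * ?n2)" using b(2) K by (intro mult_left_mono) auto
    then have 1: "norm (R d) \<le> ?n1 + 4 * K * (\<Sum>j<Suc n. \<eta> ^ j) * ?n2"
      using d(2) b(3) by (simp add: algebra_simps)
    have "norm (R b) \<le> graph_const * ?n1" by (rule geometric[OF b(3)])
    then have "step_const * norm (R b) \<le> step_const * (graph_const * ?n1)" using const_nonneg by (intro mult_left_mono) auto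
    then have "norm d \<le> norm a + real (Suc n) * step_const * (graph_const * ?n1)"
      using d(3) b(4) by (simp add: algebra_simps)
    with 0 1 b(1) d(1) show ?case by auto
  qed
  then obtain b where b: "(L ^^ n) (R (R a)) = R (R b)" "norm (R (R b)) \<le> \<eta> ^ n * ?n2"
    "norm (R b) \<le> ?n1 + 4 * K * (\<Sum>j<n. \<eta> ^ j) * ?n2" "norm b \<le> norm a + real n * step_const * (graph_const * ?n1)" by blast
  have 1: "norm (R b) \<le> graph_const * ?n1" by (rule geometric[OF b(3)])
  have "real n * step_const * (graph_const * ?n1) \<le> real n * step_const * (graph_const * (\<rho>\<^sup>2 * norm a))"
    using const_nonneg by (intro mult_left_mono R_norm) auto
  then have "norm b \<le> (1 + real n * growth_const) * norm a" using b(4) by (simp add: growth_const_def algebra_simps)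
  with 1 b(1,2) show ?thesis by blast
qed

end

locale damped_galerkin = damped_semigroup Q B K K1 \<rho> c T + galerkin_space Q B K K1 \<rho> A0 V \<delta>
  for Q B :: "'a::complex_hilbert \<Rightarrow> 'a" and K K1 \<rho> c T A0 V \<delta>
begin

text \<open>
  \<open>galerkin_error\<close> for \<open>\<zeta> = 0\<close> and the source \<open>k = - B q\<close>, which makes \<open>q\<close> the damped orbit.
\<close>

lemma semigroup_error:
  assumes \<tau>: "\<tau> \<ge> 0"
  shows "norm (gproj (T \<tau> (R (R a))) - E c \<tau> (gproj (R (R a)))) \<le>
    \<tau> * (\<delta> * \<rho> * ((norm a + orbit_const * norm (R a)) + K * (norm (R a) + 2 * K * norm (R (R a)))))"
proof -
  obtain q q' where q: "\<And>t. t \<ge> 0 \<Longrightarrow> T t (R (R a)) = R (q t)"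
    "\<And>t. t \<ge> 0 \<Longrightarrow> (q has_vector_derivative q' t) (at t within {0..})"
    "\<And>t. t \<ge> 0 \<Longrightarrow> R (q' t) = c *\<^sub>C q t - B (R (q t))"
    "\<And>t. t \<ge> 0 \<Longrightarrow> norm (q t) \<le> norm (R a) + 2 * K * norm (R (R a))"
    "\<And>t. t \<ge> 0 \<Longrightarrow> norm (q' t) \<le> norm a + orbit_const * norm (R a)"
    by (rule orbit_dom2[of a]) blast
  have "norm ((gproj (R (q \<tau>)) - 0) - E c \<tau> (gproj (R (q 0)) - 0)) \<le>
    \<tau> * (\<delta> * \<rho> * ((norm a + orbit_const * norm (R a)) + K * (norm (R a) + 2 * K * norm (R (R a)))))
      + integral {0..\<tau>} (\<lambda>_. 0)"
  proof (rule galerkin_error[where a' = q' and k = "\<lambda>t. - B (R (q t))" and \<zeta>' = "\<lambda>_. 0" and N = "{}" and g = "\<lambda>_. 0"])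
    show "(q has_vector_derivative q' t) (at t within {0..\<tau>})" if "t \<in> {0..\<tau>}" for t
      by (rule has_vector_derivative_within_subset[OF q(2)]) (use that in auto)
    show "R (q' t) = c *\<^sub>C q t + - B (R (q t))" if "t \<in> {0..\<tau>}" for t using q(3)[of t] that by simp
    show "0 \<in> V" by (rule subspace_0[OF V_subspace])
    then show "0 \<in> V" .
    show "inner 0 (Q \<psi>) = inner (c *\<^sub>C w) \<psi> - inner (B (Q w)) (Q \<psi>) + inner 0 (Q \<psi>)" if "0 = Q w" for w \<psi>
    proof -
      have "w = 0" using that Q_eq_iff[of 0 w] by (simp add: Q.zero)
      then show ?thesis by (simp add: Q.zero B.zero)
    qed
  qed (use Re_c \<tau> q(4,5) in auto)
  moreover have "R (q 0) = R (R a)" using q(1)[of 0] T by (simp add: C0_semigroup_def)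
  ultimately show ?thesis using q(1)[OF \<tau>] by simp
qed

end

context damped_pair
begin

definition semigroup_const where "semigroup_const = \<tau> * \<rho> * ((1 + orbit_const * \<rho>\<^sup>2) + K * ((1 + 2 * K * \<rho>\<^sup>2) * \<rho>\<^sup>2))"
definition dom2_const where "dom2_const = orbit_const * \<rho>\<^sup>2 + K1 * ((1 + 2 * K * \<rho>\<^sup>2) * \<rho>\<^sup>2)"
definition consistency_const where "consistency_const = semigroup_const * (2 + dom2_const)"

lemma const_nonneg': "0 \<le> semigroup_const" "0 \<le> dom2_const" "0 \<le> consistency_const"
  using K K1 orbit_const_nonneg \<tau> \<rho> by (auto simp: semigroup_const_def dom2_const_def consistency_const_def)

lemma dom_norms:
  "norm (R a) \<le> \<rho>\<^sup>2 * norm a"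
  "norm (R a) + 2 * K * norm (R (R a)) \<le> (1 + 2 * K * \<rho>\<^sup>2) * \<rho>\<^sup>2 * norm a"
proof -
  show 1: "norm (R a) \<le> \<rho>\<^sup>2 * norm a" by (rule R_norm)
  have "2 * K * norm (R (R a)) \<le> 2 * K * (\<rho>\<^sup>2 * norm (R a))" using K by (intro mult_left_mono R_norm) auto
  then have "norm (R a) + 2 * K * norm (R (R a)) \<le> (1 + 2 * K * \<rho>\<^sup>2) * norm (R a)" by (simp add: algebra_simps)
  also have "\<dots> \<le> (1 + 2 * K * \<rho>\<^sup>2) * (\<rho>\<^sup>2 * norm a)" using K by (intro mult_left_mono 1) auto
  finally show "norm (R a) + 2 * K * norm (R (R a)) \<le> (1 + 2 * K * \<rho>\<^sup>2) * \<rho>\<^sup>2 * norm a" by (simp add: mult.assoc)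
qed

end

section \<open>Reconstruction of the initial value\<close>

locale reconstruction = damped_pair Q B K K1 \<rho> Tp Tm \<tau> \<eta> + galerkin_space Q B K K1 \<rho> A0 V \<delta>
  for Q B :: "'a::complex_hilbert \<Rightarrow> 'a" and K K1 \<rho> Tp Tm \<tau> \<eta> A0 V \<delta>
begin

sublocale Pg: damped_galerkin Q B K K1 \<rho> \<i> Tp A0 V \<delta> by unfold_locales
sublocale Mg: damped_galerkin Q B K K1 \<rho> "- \<i>" Tm A0 V \<delta> by unfold_locales

definition Lh where "Lh v = E (- \<i>) \<tau> (E \<i> \<tau> v)"

lemma Lh_in_V: "v \<in> V \<Longrightarrow> Lh v \<in> V"
  by (simp add: Lh_def E_in_V)

lemma Lh_contraction: "norm (Lh v) \<le> norm v"
  unfolding Lh_def using \<tau> by (intro order_trans[OF E_contraction E_contraction]) auto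

lemma Lh_diff: "Lh (u - v) = Lh u - Lh v"
  by (simp add: Lh_def E_diff)

lemma Lh_pow_in_V: "v \<in> V \<Longrightarrow> (Lh ^^ n) v \<in> V"
  by (induction n) (auto intro: Lh_in_V)

lemma Lh_pow_contraction: "norm ((Lh ^^ n) v) \<le> norm v"
  by (induction n) (auto intro: order_trans[OF Lh_contraction])

lemma Lh_pow_diff: "(Lh ^^ n) (u - v) = (Lh ^^ n) u - (Lh ^^ n) v"
  by (induction n) (auto simp: Lh_diff)

lemma discrete_L_pow: "v \<in> V \<Longrightarrow> (discrete_L A0 B V \<tau> ^^ n) v = (Lh ^^ n) v"
proof (induction n)
  case (Suc n)
  have "discrete_L A0 B V \<tau> w = Lh w" if "w \<in> V" for w
    using discrete_L_eq[OF less_imp_le[OF \<tau>] that] by (simp add: Lh_def)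
  then show ?case using Suc by (simp add: Lh_pow_in_V)
qed simp

lemma gproj_in_V: "gproj (Q y) \<in> V"
  using PW(2)[of y] by (simp add: galerkin_proj_Q W_def)

lemma gproj_R_in_V: "gproj (R a) \<in> V"
  unfolding R_def by (rule gproj_in_V)

lemma semigroup_errors:
  "norm (gproj (Tp \<tau> (R (R a))) - E \<i> \<tau> (gproj (R (R a)))) \<le> \<delta> * semigroup_const * norm a"
  "norm (gproj (Tm \<tau> (R (R a))) - E (- \<i>) \<tau> (gproj (R (R a)))) \<le> \<delta> * semigroup_const * norm a"
proof -
  have \<delta>\<rho>: "\<delta> * \<rho> \<ge> 0" using \<delta> \<rho> by simp
  have "orbit_const * norm (R a) \<le> orbit_const * (\<rho>\<^sup>2 * norm a)" by (intro mult_left_mono dom_norms orbit_const_nonneg)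
  moreover have "K * (norm (R a) + 2 * K * norm (R (R a))) \<le> K * ((1 + 2 * K * \<rho>\<^sup>2) * \<rho>\<^sup>2 * norm a)"
    by (intro mult_left_mono dom_norms K)
  ultimately have "(norm a + orbit_const * norm (R a)) + K * (norm (R a) + 2 * K * norm (R (R a)))
    \<le> ((1 + orbit_const * \<rho>\<^sup>2) + K * ((1 + 2 * K * \<rho>\<^sup>2) * \<rho>\<^sup>2)) * norm a"
    by (simp add: algebra_simps)
  then have "\<tau> * (\<delta> * \<rho> * ((norm a + orbit_const * norm (R a)) + K * (norm (R a) + 2 * K * norm (R (R a)))))
    \<le> \<tau> * (\<delta> * \<rho> * (((1 + orbit_const * \<rho>\<^sup>2) + K * ((1 + 2 * K * \<rho>\<^sup>2) * \<rho>\<^sup>2)) * norm a))"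
    using \<tau> \<delta>\<rho> by (intro mult_left_mono) auto
  also have "\<dots> = \<delta> * semigroup_const * norm a" by (simp add: semigroup_const_def)
  finally have *: "\<tau> * (\<delta> * \<rho> * ((norm a + orbit_const * norm (R a)) + K * (norm (R a) + 2 * K * norm (R (R a)))))
    \<le> \<delta> * semigroup_const * norm a" .
  show "norm (gproj (Tp \<tau> (R (R a))) - E \<i> \<tau> (gproj (R (R a)))) \<le> \<delta> * semigroup_const * norm a"
    by (rule order_trans[OF Pg.semigroup_error *]) (use \<tau> in simp)
  show "norm (gproj (Tm \<tau> (R (R a))) - E (- \<i>) \<tau> (gproj (R (R a)))) \<le> \<delta> * semigroup_const * norm a"
    by (rule order_trans[OF Mg.semigroup_error *]) (use \<tau> in simp)
qed

text \<open>
  \<open>L\<^sub>h \<pi> x - \<pi> L x = T\<^sub>h\<^sup>- (T\<^sub>h\<^sup>+ \<pi> x - \<pi> b) + (T\<^sub>h\<^sup>- \<pi> b - \<pi> T\<^sup>- b)\<close> for \<open>b = T\<^sup>+ x\<close>, and \<open>T\<^sub>h\<^sup>-\<close> is a contraction.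
\<close>

lemma L_error: "norm (Lh (gproj (R (R a))) - gproj (L (R (R a)))) \<le> \<delta> * consistency_const * norm a"
proof -
  obtain b where b: "Tp \<tau> (R (R a)) = R (R b)"
    "norm b \<le> norm a + orbit_const * norm (R a) + K1 * (norm (R a) + 2 * K * norm (R (R a)))"
    using P.semigroup_dom2_growth[of \<tau> a] \<tau> by auto
  have "orbit_const * norm (R a) \<le> orbit_const * (\<rho>\<^sup>2 * norm a)" by (intro mult_left_mono dom_norms orbit_const_nonneg)
  moreover have "K1 * (norm (R a) + 2 * K * norm (R (R a))) \<le> K1 * ((1 + 2 * K * \<rho>\<^sup>2) * \<rho>\<^sup>2 * norm a)"
    by (intro mult_left_mono dom_norms K1)
  ultimately have nb: "norm b \<le> (1 + dom2_const) * norm a" using b(2) by (simp add: dom2_const_def algebra_simps)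
  have 1: "norm (E (- \<i>) \<tau> (E \<i> \<tau> (gproj (R (R a)))) - E (- \<i>) \<tau> (gproj (R (R b)))) \<le> \<delta> * semigroup_const * norm a"
  proof -
    have "norm (E (- \<i>) \<tau> (E \<i> \<tau> (gproj (R (R a))) - gproj (R (R b)))) \<le> norm (E \<i> \<tau> (gproj (R (R a))) - gproj (R (R b)))"
      by (rule E_contraction) (use \<tau> in auto)
    also have "\<dots> \<le> \<delta> * semigroup_const * norm a" using semigroup_errors(1)[of a] b(1) by (simp add: norm_minus_commute)
    finally show ?thesis by (simp add: E_diff)
  qed
  have 2: "norm (E (- \<i>) \<tau> (gproj (R (R b))) - gproj (Tm \<tau> (R (R b)))) \<le> \<delta> * semigroup_const * ((1 + dom2_const) * norm a)"
  proof -
    have "norm (E (- \<i>) \<tau> (gproj (R (R b))) - gproj (Tm \<tau> (R (R b)))) \<le> \<delta> * semigroup_const * norm b"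
      using semigroup_errors(2)[of b] by (simp add: norm_minus_commute)
    also have "\<dots> \<le> \<delta> * semigroup_const * ((1 + dom2_const) * norm a)" using \<delta> const_nonneg' by (intro mult_left_mono nb) auto
    finally show ?thesis .
  qed
  have "Lh (gproj (R (R a))) - gproj (L (R (R a)))
    = (E (- \<i>) \<tau> (E \<i> \<tau> (gproj (R (R a)))) - E (- \<i>) \<tau> (gproj (R (R b))))
      + (E (- \<i>) \<tau> (gproj (R (R b))) - gproj (Tm \<tau> (R (R b))))"
    by (simp add: Lh_def L_def b(1))
  then have "norm (Lh (gproj (R (R a))) - gproj (L (R (R a)))) \<le> \<delta> * semigroup_const * norm a + \<delta> * semigroup_const * ((1 + dom2_const) * norm a)"
    using norm_triangle_mono[OF 1 2] by simp
  then show ?thesis by (simp add: consistency_const_def algebra_simps)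
qed

text \<open>
  Each of the \<open>n\<close> factors contributes the consistency error of \<open>L\<^sub>h\<close> at \<open>L\<^sup>j x\<close>, \<open>j < n\<close>, and the
  contractions in front of it do not amplify it.  As \<open>\<parallel>L\<^sup>j x\<parallel>\<^sub>2\<close> is \<open>O(1 + j)\<close>, the sum is quadratic in \<open>n\<close>.
\<close>

lemma iterate_error:
  "norm ((Lh ^^ n) (gproj (R (R a))) - gproj ((L ^^ n) (R (R a)))) \<le> \<delta> * consistency_const * (real n * (1 + real n * growth_const)) * norm a"
proof (induction n)
  case (Suc n)
  obtain b where b: "(L ^^ n) (R (R a)) = R (R b)" "norm b \<le> (1 + real n * growth_const) * norm a"
    using L_iterates[of n a] by blast
  let ?u = "(Lh ^^ n) (gproj (R (R a)))"
  have \<delta>consistency_const: "\<delta> * consistency_const \<ge> 0" using \<delta> const_nonneg' by simp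
  have "norm (Lh (?u - gproj (R (R b)))) \<le> \<delta> * consistency_const * (real n * (1 + real n * growth_const)) * norm a"
    using order_trans[OF Lh_contraction Suc.IH] by (simp add: b(1))
  then have 1: "norm (Lh ?u - Lh (gproj (R (R b)))) \<le> \<delta> * consistency_const * (real n * (1 + real n * growth_const)) * norm a"
    by (simp add: Lh_diff)
  have 2: "norm (Lh (gproj (R (R b))) - gproj (L (R (R b)))) \<le> \<delta> * consistency_const * ((1 + real n * growth_const) * norm a)"
    using \<delta>consistency_const by (intro order_trans[OF L_error] mult_left_mono b(2))
  have "(Lh ^^ Suc n) (gproj (R (R a))) - gproj ((L ^^ Suc n) (R (R a)))
      = (Lh ?u - Lh (gproj (R (R b)))) + (Lh (gproj (R (R b))) - gproj (L (R (R b))))"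
    by (simp add: b(1))
  then have "norm ((Lh ^^ Suc n) (gproj (R (R a))) - gproj ((L ^^ Suc n) (R (R a))))
      \<le> \<delta> * consistency_const * (real n * (1 + real n * growth_const)) * norm a + \<delta> * consistency_const * ((1 + real n * growth_const) * norm a)"
    using norm_triangle_mono[OF 1 2] by simp
  also have "\<dots> = \<delta> * consistency_const * (real (Suc n) * (1 + real n * growth_const)) * norm a" by (simp add: algebra_simps)
  also have "\<dots> \<le> \<delta> * consistency_const * (real (Suc n) * (1 + real (Suc n) * growth_const)) * norm a"
    using \<delta>consistency_const const_nonneg by (intro mult_right_mono mult_left_mono add_left_mono) auto
  finally show ?case .
qed simp

lemma gproj_error: "norm (gproj (R (R a)) - R (R a)) \<le> \<delta> * (\<rho> * norm (R a))"
proof -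
  have "norm (gproj (R (R a)) - R (R a)) \<le> \<delta> * norm (Q (R a))"
    using approx[of "Q (R a)"] by (simp add: R_def)
  also have "\<dots> \<le> \<delta> * (\<rho> * norm (R a))" by (intro mult_left_mono Q_norm \<delta>)
  finally show ?thesis .
qed

lemma iterate_bound:
  "norm ((Lh ^^ n) (gproj (R (R a)))) \<le>
    (\<eta> ^ n * \<rho> ^ 4 + \<delta> * (graph_const * \<rho> ^ 3) + \<delta> * consistency_const * (real n * (1 + real n * growth_const))) * norm a"
proof -
  obtain b where b: "(L ^^ n) (R (R a)) = R (R b)" "norm (R (R b)) \<le> \<eta> ^ n * norm (R (R a))"
    "norm (R b) \<le> graph_const * norm (R a)"
    using L_iterates[of n a] by blast
  have "norm (R (R a)) \<le> \<rho>\<^sup>2 * (\<rho>\<^sup>2 * norm a)"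
    using \<rho> by (intro order_trans[OF R_norm] mult_left_mono R_norm) auto
  then have "\<eta> ^ n * norm (R (R a)) \<le> \<eta> ^ n * (\<rho> ^ 4 * norm a)"
    using \<eta> by (intro mult_left_mono) (auto simp: power2_eq_square power4_eq_xxxx mult.assoc)
  with b(2) have 1: "norm (R (R b)) \<le> \<eta> ^ n * \<rho> ^ 4 * norm a" by simp
  have "graph_const * norm (R a) \<le> graph_const * (\<rho>\<^sup>2 * norm a)" using const_nonneg by (intro mult_left_mono R_norm) auto
  with b(3) have "norm (R b) \<le> graph_const * (\<rho>\<^sup>2 * norm a)" by simp
  then have "\<delta> * (\<rho> * norm (R b)) \<le> \<delta> * (\<rho> * (graph_const * (\<rho>\<^sup>2 * norm a)))"
    using \<delta> \<rho> by (intro mult_left_mono) auto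
  then have 2: "norm (gproj (R (R b)) - R (R b)) \<le> \<delta> * (graph_const * \<rho> ^ 3) * norm a"
    using gproj_error[of b] by (simp add: power2_eq_square power3_eq_cube mult_ac)
  have "norm ((Lh ^^ n) (gproj (R (R a)))) \<le> norm ((Lh ^^ n) (gproj (R (R a))) - gproj (R (R b)))
      + (norm (gproj (R (R b)) - R (R b)) + norm (R (R b)))"
    using norm_triangle_ineq[of "(Lh ^^ n) (gproj (R (R a))) - gproj (R (R b))" "gproj (R (R b))"]
      norm_triangle_ineq[of "gproj (R (R b)) - R (R b)" "R (R b)"] by simp
  also have "\<dots> \<le> \<delta> * consistency_const * (real n * (1 + real n * growth_const)) * norm a
      + (\<delta> * (graph_const * \<rho> ^ 3) * norm a + \<eta> ^ n * \<rho> ^ 4 * norm a)"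
    using iterate_error[of n a] by (intro add_mono 1 2) (simp add: b(1))
  finally show ?thesis by (simp add: algebra_simps)
qed

text \<open>
  The discrete observers satisfy \<open>z\<^sub>h\<^sup>-(0) = (1 - L\<^sub>h) \<pi> z\<^sub>0 - r\<close> with a small residual \<open>r\<close>, so their
  Neumann sum telescopes to \<open>\<pi> z\<^sub>0 - L\<^sub>h\<^sup>n \<pi> z\<^sub>0\<close>, up to \<open>n\<close> copies of \<open>r\<close>.
\<close>

theorem reconstruction_error:
  assumes C: "bounded_linear (cadjoint C)" and BC: "\<And>x. B x = cadjoint C (C x)"
    and u: "u 0 = a" "\<And>t. t \<ge> 0 \<Longrightarrow> norm (u t) \<le> norm a"
      "\<And>t. t \<ge> 0 \<Longrightarrow> ((\<lambda>t. R (u t)) has_vector_derivative \<i> *\<^sub>C u t) (at t within {0..})"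
    and zp: "discrete_observer 1 A0 C V \<tau> y zp" "zp 0 = 0"
    and zm: "discrete_observer (- 1) A0 C V \<tau> y zm" "zm \<tau> = zp \<tau>"
    and int: "(\<lambda>t. norm (cadjoint C (C (R (R (u t))) - y t))) integrable_on {0..\<tau>}"
  shows "norm (R (R a) - (\<Sum>j<n. (discrete_L A0 B V \<tau> ^^ j) (zm 0))) \<le>
    (\<delta> * \<rho> ^ 3 + \<eta> ^ n * \<rho> ^ 4 + \<delta> * (graph_const * \<rho> ^ 3) + \<delta> * consistency_const * (real n * (1 + real n * growth_const))
      + 2 * real n * (\<tau> * \<delta> * (\<rho> * (1 + K * \<rho>\<^sup>2)))) * norm a
    + 2 * real n * integral {0..\<tau>} (\<lambda>t. norm (cadjoint C (C (R (R (u t))) - y t)))"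
proof -
  define I where "I = integral {0..\<tau>} (\<lambda>t. norm (cadjoint C (C (R (R (u t))) - y t)))"
  define \<beta> where "\<beta> = \<tau> * (\<delta> * \<rho> * (norm a + K * (\<rho>\<^sup>2 * norm a))) + I"
  have \<tau>0: "\<tau> \<ge> 0" using \<tau> by simp
  have d: "((\<lambda>t. R (u t)) has_vector_derivative \<i> *\<^sub>C u t) (at t within {0..\<tau>})" if "t \<in> {0..\<tau>}" for t
    by (rule has_vector_derivative_within_subset[OF u(3)]) (use that in auto)
  have R': "R (\<i> *\<^sub>C u t) = \<i> *\<^sub>C R (u t)" for t by (rule R_scaleC)
  have \<alpha>: "norm (R (u t)) \<le> \<rho>\<^sup>2 * norm a" "norm (\<i> *\<^sub>C u t) \<le> norm a" if "t \<in> {0..\<tau>}" for t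
    using u(2)[of t] that by (auto simp: norm_scaleC intro!: order_trans[OF R_norm] mult_left_mono)
  let ?z = "\<lambda>t. gproj (R (R (u t)))"
  have fwd: "norm ((?z \<tau> - zp \<tau>) - E \<i> \<tau> (?z 0 - zp 0)) \<le> \<beta>"
    unfolding \<beta>_def I_def by (rule forward_observer_error[OF \<tau>0 C BC d R' \<alpha> zp(1) int])
  have bwd: "norm ((?z 0 - zm 0) - E (- \<i>) \<tau> (?z \<tau> - zm \<tau>)) \<le> \<beta>"
    unfolding \<beta>_def I_def by (rule backward_observer_error[OF \<tau>0 C BC d R' \<alpha> zm(1) int])
  define p where "p = gproj (R (R a))"
  define r where "r = p - Lh p - zm 0"
  have pV: "p \<in> V" unfolding p_def by (rule gproj_R_in_V)
  have zmV: "zm 0 \<in> V" using zm(1) \<tau>0 unfolding discrete_observer_def by auto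
  have "norm (E (- \<i>) \<tau> (?z \<tau> - zp \<tau> - E \<i> \<tau> p)) \<le> norm (?z \<tau> - zp \<tau> - E \<i> \<tau> p)"
    by (rule E_contraction) (use \<tau>0 in auto)
  also have "\<dots> \<le> \<beta>" using fwd by (simp add: u(1) zp(2) p_def)
  finally have "norm (E (- \<i>) \<tau> (?z \<tau> - zp \<tau>) - Lh p) \<le> \<beta>" by (simp only: E_diff Lh_def)
  moreover have "norm ((p - zm 0) - E (- \<i>) \<tau> (?z \<tau> - zp \<tau>)) \<le> \<beta>" using bwd by (simp add: u(1) zm(2) p_def)
  ultimately have "norm (((p - zm 0) - E (- \<i>) \<tau> (?z \<tau> - zp \<tau>)) + (E (- \<i>) \<tau> (?z \<tau> - zp \<tau>) - Lh p)) \<le> \<beta> + \<beta>"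
    by (intro norm_triangle_mono)
  then have r: "norm r \<le> 2 * \<beta>" by (simp add: r_def algebra_simps)
  have "(\<Sum>j<n. (discrete_L A0 B V \<tau> ^^ j) (zm 0)) = (\<Sum>j<n. (Lh ^^ j) (p - Lh p - r))"
    by (simp add: discrete_L_pow[OF zmV] r_def)
  also have "\<dots> = (\<Sum>j<n. (Lh ^^ j) p - (Lh ^^ Suc j) p) - (\<Sum>j<n. (Lh ^^ j) r)"
    by (simp add: Lh_pow_diff sum_subtractf funpow_swap1)
  also have "(\<Sum>j<n. (Lh ^^ j) p - (Lh ^^ Suc j) p) = p - (Lh ^^ n) p"
    using sum_lessThan_telescope'[of "\<lambda>j. (Lh ^^ j) p" n] by simp
  finally have "R (R a) - (\<Sum>j<n. (discrete_L A0 B V \<tau> ^^ j) (zm 0))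
      = (R (R a) - p) + (Lh ^^ n) p + (\<Sum>j<n. (Lh ^^ j) r)" by simp
  moreover have "norm (R (R a) - p) \<le> \<delta> * \<rho> ^ 3 * norm a"
  proof -
    have "norm (R (R a) - p) \<le> \<delta> * (\<rho> * norm (R a))"
      using gproj_error[of a] by (simp add: p_def norm_minus_commute)
    also have "\<dots> \<le> \<delta> * (\<rho> * (\<rho>\<^sup>2 * norm a))" using \<delta> \<rho> by (intro mult_left_mono R_norm) auto
    finally show ?thesis by (simp add: power2_eq_square power3_eq_cube mult_ac)
  qed
  moreover have "norm (\<Sum>j<n. (Lh ^^ j) r) \<le> real n * (2 * \<beta>)"
  proof -
    have "norm (\<Sum>j<n. (Lh ^^ j) r) \<le> (\<Sum>j<n. 2 * \<beta>)"
      by (rule sum_norm_le) (rule order_trans[OF Lh_pow_contraction r])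
    then show ?thesis by simp
  qed
  ultimately have "norm (R (R a) - (\<Sum>j<n. (discrete_L A0 B V \<tau> ^^ j) (zm 0)))
     \<le> \<delta> * \<rho> ^ 3 * norm a + (\<eta> ^ n * \<rho> ^ 4 + \<delta> * (graph_const * \<rho> ^ 3) + \<delta> * consistency_const * (real n * (1 + real n * growth_const))) * norm a
       + real n * (2 * \<beta>)"
    using iterate_bound[of n a, folded p_def] by (simp only:) (intro norm_triangle_mono)
  then show ?thesis by (simp add: \<beta>_def I_def[symmetric] algebra_simps)
qed

end

section \<open>The convergence rate\<close>

text \<open>
  The difference of two solutions has constant norm.
\<close>

lemma conservative_solution_unique:
  fixes R :: "'a::complex_inner \<Rightarrow> 'a"
  assumes R: "bounded_linear R" and sc: "\<And>c x. R (c *\<^sub>C x) = c *\<^sub>C R x"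
    and sym: "\<And>x y. inner (R x) y = inner x (R y)" and A: "\<And>x y. A x = Some y \<longleftrightarrow> x = R y"
    and z: "conservative_solution A z0 z" and z': "conservative_solution A z0 z'" and t: "t \<ge> 0"
  shows "z t = z' t"
proof -
  interpret R: bounded_linear R by fact
  define w where "w t = z t - z' t" for t
  define b b' where "b s = the (A (z s))" and "b' s = the (A (z' s))" for s
  have "(norm (w t))\<^sup>2 \<le> (norm (w 0))\<^sup>2"
  proof (rule decreasing_if_derivative_nonpos[OF t])
    fix s :: real assume s: "s \<ge> 0"
    have d: "z s \<in> dom A" "z' s \<in> dom A"
      "(z has_vector_derivative \<i> *\<^sub>C the (A (z s))) (at s within {0..})"
      "(z' has_vector_derivative \<i> *\<^sub>C the (A (z' s))) (at s within {0..})"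
      using z z' s by (auto simp: conservative_solution_def)
    have "A (z s) = Some (b s)" "A (z' s) = Some (b' s)" using d(1,2) by (auto simp: b_def b'_def)
    then have w: "w s = R (b s - b' s)" by (simp add: A w_def R.diff)
    have "(w has_vector_derivative \<i> *\<^sub>C b s - \<i> *\<^sub>C b' s) (at s within {0..})"
      using has_vector_derivative_diff[OF d(3,4)] by (simp add: w_def[abs_def] b_def b'_def)
    then have "(w has_vector_derivative \<i> *\<^sub>C (b s - b' s)) (at s within {0..})"
      by (simp add: complex_vector.scale_right_diff_distrib)
    then show "((\<lambda>t. (norm (w t))\<^sup>2) has_real_derivative 2 * inner (\<i> *\<^sub>C (b s - b' s)) (w s)) (at s within {0..})"
      by (rule norm_power2_has_derivative)
    have "inner (\<i> *\<^sub>C v) (R v) = inner (\<i> *\<^sub>C R v) v" for v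
      by (simp only: sym[symmetric] sc)
    also have "inner (\<i> *\<^sub>C R v) v = 0" for v by (rule inner_skew_symmetric[OF sc sym]) simp
    finally show "2 * inner (\<i> *\<^sub>C (b s - b' s)) (w s) \<le> 0" by (simp add: w)
  qed
  moreover have "w 0 = 0" using z z' by (simp add: w_def conservative_solution_def)
  ultimately show ?thesis by (simp add: w_def)
qed

lemma generates_damped_iff:
  assumes gen: "generates (damped c A B) T" and A: "\<And>x y. A x = Some y \<longleftrightarrow> x = R y"
  shows "C0_semigroup T"
    and "((\<lambda>t. (T t x - x) /\<^sub>R t) \<longlongrightarrow> y) (at_right 0) \<longleftrightarrow> (\<exists>a. x = R a \<and> y = c *\<^sub>C a - B x)"
proof -
  show "C0_semigroup T" using gen by (simp add: generates_def)
  have "damped c A B x = Some y \<longleftrightarrow> (\<exists>a. A x = Some a \<and> y = c *\<^sub>C a - B x)"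
    by (auto simp: damped_def)
  then show "((\<lambda>t. (T t x - x) /\<^sub>R t) \<longlongrightarrow> y) (at_right 0) \<longleftrightarrow> (\<exists>a. x = R a \<and> y = c *\<^sub>C a - B x)"
    using gen unfolding generates_def A by auto
qed

text \<open>With \<open>h\<close> so small that \<open>\<bar>ln h\<bar> \<ge> 1\<close>, the number of terms is \<open>O(\<bar>ln h\<bar>)\<close>, and the first neglected
  power \<open>\<eta>\<^sup>n\<close> is at most \<open>h\<^sup>\<theta>\<close>.  The value \<open>ln 0 = 0\<close> makes the sum a single term when \<open>\<eta> = 0\<close>.\<close>

lemma truncation_index:
  fixes h \<theta> \<eta> :: real
  assumes h: "0 < h" "h \<le> exp (- 1)" and \<theta>: "\<theta> > 0" and \<eta>: "0 \<le> \<eta>" "\<eta> < 1"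
  obtains n where "{j. real j \<le> \<theta> * (ln h / ln \<eta>)} = {..<n}"
    "real n \<le> (\<theta> / \<bar>ln \<eta>\<bar> + 1) * \<bar>ln h\<bar>" "\<eta> ^ n \<le> h powr \<theta>"
proof -
  have lnh: "ln h \<le> - 1"
  proof -
    have "ln h \<le> ln (exp (- 1))" using h by (subst ln_le_cancel_iff) auto
    then show ?thesis by simp
  qed
  have ln\<eta>: "ln \<eta> \<le> 0" using \<eta> by (cases "\<eta> = 0") auto
  define N where "N = \<theta> * (ln h / ln \<eta>)"
  have N: "N = \<theta> / \<bar>ln \<eta>\<bar> * \<bar>ln h\<bar>" using lnh ln\<eta> by (simp add: N_def)
  have "N \<ge> 0" unfolding N using \<theta> by simp
  define n where "n = Suc (nat \<lfloor>N\<rfloor>)"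
  have "{j. real j \<le> N} = {..<n}"
  proof (intro set_eqI)
    fix j
    have "real j \<le> N \<longleftrightarrow> int j \<le> \<lfloor>N\<rfloor>" by (simp add: le_floor_iff)
    then show "j \<in> {j. real j \<le> N} \<longleftrightarrow> j \<in> {..<n}" using \<open>N \<ge> 0\<close> by (auto simp: n_def)
  qed
  moreover have "real n \<le> (\<theta> / \<bar>ln \<eta>\<bar> + 1) * \<bar>ln h\<bar>"
  proof -
    have "real n \<le> N + 1" using \<open>N \<ge> 0\<close> by (simp add: n_def)
    also have "\<dots> \<le> N + \<bar>ln h\<bar>" using lnh by simp
    finally show ?thesis by (simp add: N distrib_right)
  qed
  moreover have "\<eta> ^ n \<le> h powr \<theta>"
  proof (cases "\<eta> = 0")
    case False
    then have "\<eta> > 0" "ln \<eta> < 0" using \<eta> by auto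
    have "N \<le> real n" using \<open>N \<ge> 0\<close> unfolding n_def by linarith
    then have "\<eta> powr real n \<le> \<eta> powr N" using \<eta> \<open>\<eta> > 0\<close> by (intro powr_mono') auto
    also have "\<eta> powr N = exp (\<theta> * ln h)" using \<open>\<eta> > 0\<close> \<open>ln \<eta> < 0\<close> by (simp add: powr_def N_def)
    also have "\<dots> = h powr \<theta>" using h by (simp add: powr_def)
    finally show ?thesis using \<open>\<eta> > 0\<close> by (simp add: powr_realpow)
  qed (simp add: n_def)
  ultimately show thesis using that by (simp add: N_def)
qed

text \<open>
  Collects the powers of \<open>l = \<bar>ln h\<bar>\<close>: as \<open>l \<ge> 1\<close> and \<open>n \<le> b l\<close>, every term but the integral is at most a
  constant times \<open>H l\<^sup>2 x\<close>, where \<open>H = h\<^sup>\<theta>\<close> and \<open>x = \<parallel>z\<^sub>0\<parallel>\<^sub>2\<close>.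
\<close>

lemma (in damped_pair) error_bound_rate:
  assumes "M0 \<ge> 0" "b \<ge> 0" "l \<ge> 1" "0 \<le> H" "real n \<le> b * l" "\<eta> ^ n \<le> H" "0 \<le> I" "0 \<le> x"
  shows "((M0 * H) * \<rho> ^ 3 + \<eta> ^ n * \<rho> ^ 4 + (M0 * H) * (graph_const * \<rho> ^ 3) + (M0 * H) * consistency_const * (real n * (1 + real n * growth_const))
      + 2 * real n * (\<tau> * (M0 * H) * (\<rho> * (1 + K * \<rho>\<^sup>2)))) * x + 2 * real n * I
    \<le> (M0 * \<rho> ^ 3 + \<rho> ^ 4 + M0 * (graph_const * \<rho> ^ 3) + M0 * consistency_const * (b * (1 + b * growth_const))
      + 2 * b * (\<tau> * M0 * (\<rho> * (1 + K * \<rho>\<^sup>2))) + 2 * b + 1) * (H * l\<^sup>2 * x + l * I)"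
proof -
  have ll: "1 \<le> l\<^sup>2" "l \<le> l\<^sup>2" using assms(3) by (auto simp: power2_eq_square mult_le_cancel_left1 intro: order_trans)
  have n: "real n \<le> b * l\<^sup>2" using assms(5) mult_left_mono[OF ll(2) assms(2)] by linarith
  have nn: "real n * (1 + real n * growth_const) \<le> b * (1 + b * growth_const) * l\<^sup>2"
  proof -
    have "real n * real n \<le> (b * l) * (b * l)" using assms(2,3,5) by (intro mult_mono) auto
    then have "growth_const * (real n * real n) \<le> growth_const * (b * b * l\<^sup>2)"
      using const_nonneg by (intro mult_left_mono) (auto simp: power2_eq_square mult_ac)
    with n show ?thesis by (simp add: algebra_simps)
  qed
  have pos: "0 \<le> \<rho> ^ 3" "0 \<le> \<rho> ^ 4" "0 \<le> graph_const * \<rho> ^ 3" "0 \<le> \<tau> * (\<rho> * (1 + K * \<rho>\<^sup>2))"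
    using \<rho> const_nonneg \<tau> K by auto
  have H: "H \<le> H * l\<^sup>2" using mult_left_mono[OF ll(1) assms(4)] by simp
  have 1: "(M0 * H) * \<rho> ^ 3 \<le> (M0 * \<rho> ^ 3) * (H * l\<^sup>2)"
    using mult_left_mono[OF H, of "M0 * \<rho> ^ 3"] assms(1) pos by (simp add: mult_ac)
  have 2: "\<eta> ^ n * \<rho> ^ 4 \<le> \<rho> ^ 4 * (H * l\<^sup>2)"
    using mult_right_mono[of "\<eta> ^ n" "H * l\<^sup>2" "\<rho> ^ 4"] assms(6) H pos by (simp add: mult_ac)
  have 3: "(M0 * H) * (graph_const * \<rho> ^ 3) \<le> (M0 * (graph_const * \<rho> ^ 3)) * (H * l\<^sup>2)"
    using mult_left_mono[OF H, of "M0 * (graph_const * \<rho> ^ 3)"] assms(1) pos by (simp add: mult_ac)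
  have 4: "(M0 * H) * consistency_const * (real n * (1 + real n * growth_const)) \<le> (M0 * consistency_const * (b * (1 + b * growth_const))) * (H * l\<^sup>2)"
    using mult_left_mono[OF nn, of "(M0 * H) * consistency_const"] assms(1,4) const_nonneg' by (simp add: mult_ac)
  have gen: "2 * real n * (\<tau> * (M0 * H) * e) \<le> (2 * b * (\<tau> * M0 * e)) * (H * l\<^sup>2)" if "e \<ge> 0" for e
    using mult_left_mono[OF n, of "2 * (M0 * H) * (\<tau> * e)"] assms(1,4) that \<tau> by (simp add: mult_ac)
  have "0 \<le> \<rho> * (1 + K * \<rho>\<^sup>2)" using \<rho> K by simp
  note 5 = gen[OF this]
  define c where "c = M0 * \<rho> ^ 3 + \<rho> ^ 4 + M0 * (graph_const * \<rho> ^ 3) + M0 * consistency_const * (b * (1 + b * growth_const))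
      + 2 * b * (\<tau> * M0 * (\<rho> * (1 + K * \<rho>\<^sup>2)))"
  have c: "c \<ge> 0" unfolding c_def using assms(1,2) pos const_nonneg const_nonneg' \<tau> K
    by (intro add_nonneg_nonneg mult_nonneg_nonneg) (auto simp: mult_nonneg_nonneg)
  have "(M0 * H) * \<rho> ^ 3 + \<eta> ^ n * \<rho> ^ 4 + (M0 * H) * (graph_const * \<rho> ^ 3) + (M0 * H) * consistency_const * (real n * (1 + real n * growth_const))
      + 2 * real n * (\<tau> * (M0 * H) * (\<rho> * (1 + K * \<rho>\<^sup>2))) \<le> c * (H * l\<^sup>2)"
    unfolding c_def distrib_right[of _ _ "H * l\<^sup>2"] by (intro add_mono 1 2 3 4 5)
  then have X: "((M0 * H) * \<rho> ^ 3 + \<eta> ^ n * \<rho> ^ 4 + (M0 * H) * (graph_const * \<rho> ^ 3) + (M0 * H) * consistency_const * (real n * (1 + real n * growth_const))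
      + 2 * real n * (\<tau> * (M0 * H) * (\<rho> * (1 + K * \<rho>\<^sup>2)))) * x \<le> c * (H * l\<^sup>2) * x"
    using assms(8) by (intro mult_right_mono)
  have Y: "2 * real n * I \<le> 2 * b * (l * I)" using mult_right_mono[OF assms(5,7)] by simp
  have "c * (H * l\<^sup>2) * x + 2 * b * (l * I) \<le> (c + 2 * b + 1) * (H * l\<^sup>2 * x + l * I)"
  proof -
    have "0 \<le> H * l\<^sup>2 * x" "0 \<le> l * I" using assms by auto
    then have "0 \<le> (2 * b + 1) * (H * l\<^sup>2 * x) + (c + 1) * (l * I)" using c assms(2) by auto
    then show ?thesis by (simp add: algebra_simps)
  qed
  with X Y show ?thesis unfolding c_def by linarith
qed

theorem corollary2p2:
  fixes A0 :: "'a::complex_hilbert operator"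
    and C :: "'a \<Rightarrow> 'b::complex_hilbert"
    and \<tau> \<theta> \<eta> :: real
    and Tp Tm :: "real \<Rightarrow> 'a \<Rightarrow> 'a"
    and Xh :: "real \<Rightarrow> 'a set"
    and N :: "real \<Rightarrow> real"
  assumes "self_adjoint A0" and "strictly_positive A0"
    and "bounded_clinear C"
    and "bounded_on_dom (A0 \<circ>\<^sub>m A0) (cadjoint C \<circ> C)"
    and "bounded_on_dom A0 (cadjoint C \<circ> C)"
    and "\<tau> > 0" and "exactly_observable A0 C \<tau>"
    and "generates (damped \<i> A0 (cadjoint C \<circ> C)) Tp"
    and "generates (damped (- \<i>) A0 (cadjoint C \<circ> C)) Tm"
    and "\<eta> = onorm (Tm \<tau> \<circ> Tp \<tau>)"
    and "\<And>h. h > 0 \<Longrightarrow> finite_dim_subspace (Xh h) \<and> Xh h \<subseteq> dom (sqrt_operator A0)"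
    and "\<theta> > 0" and "approximation_property A0 Xh \<theta>"
    and "\<And>h. N h = \<theta> * (ln h / ln \<eta>)"
  shows "\<exists>M>0. \<exists>hs>0. \<forall>z0\<in>dom (A0 \<circ>\<^sub>m A0). \<forall>z. conservative_solution A0 z0 z \<longrightarrow>
    (\<forall>h\<in>{0<..<hs}. \<forall>yh zp zm.
       L1_on \<tau> yh \<and>
       discrete_observer 1 A0 C (Xh h) \<tau> yh zp \<and> zp 0 = 0 \<and>
       discrete_observer (- 1) A0 C (Xh h) \<tau> yh zm \<and> zm \<tau> = zp \<tau> \<longrightarrow>
       norm (z0 - (\<Sum>n | real n \<le> N h. (discrete_L A0 (cadjoint C \<circ> C) (Xh h) \<tau> ^^ n) (zm 0)))
         \<le> M * (h powr \<theta> * (ln h)\<^sup>2 * dom_norm (A0 \<circ>\<^sub>m A0) z0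
                + \<bar>ln h\<bar> * integral {0..\<tau>} (\<lambda>s. norm (cadjoint C (C (z s) - yh s)))))"
proof -
  define B where "B = cadjoint C \<circ> C"
  obtain Q where Q: "bounded_linear Q" "\<And>c x. Q (c *\<^sub>C x) = c *\<^sub>C Q x"
    "\<And>x y. inner (Q x) y = inner x (Q y)" "inj Q"
    and A0: "\<And>x y. A0 x = Some y \<longleftrightarrow> x = Q (Q y)"
    and sqrt_A0: "\<And>x y. sqrt_operator A0 x = Some y \<longleftrightarrow> x = Q y"
    using sqrt_operator_inverse[OF assms(1,2)] by blast
  have Cbl: "bounded_linear C" and Csc: "\<And>c x. C (c *\<^sub>C x) = c *\<^sub>C C x"
    using assms(3) by (auto simp: bounded_clinear_def)
  interpret C: bounded_linear C by (rule Cbl)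
  have C'bl: "bounded_linear (cadjoint C)" by (rule bounded_linear_cadjoint[OF assms(3)])
  have Bbl: "bounded_linear B" unfolding B_def o_def by (rule bounded_linear_compose[OF C'bl Cbl])
  have Bform: "inner (B x) y = inner (C x) (C y)" for x y
    using inner_cadjoint[OF assms(3), of y "C x"] by (simp add: B_def inner_commute)
  obtain K where K: "\<And>x. norm (B x) \<le> norm x * K" "K \<ge> 0"
    using bounded_linear.nonneg_bounded[OF Bbl] by blast
  obtain \<gamma> where \<gamma>: "\<And>x. norm (C x) \<le> norm x * \<gamma>" "\<gamma> \<ge> 0" using C.nonneg_bounded by blast
  obtain \<rho>0 where \<rho>0: "\<And>x. norm (Q x) \<le> norm x * \<rho>0" "\<rho>0 \<ge> 0"
    using bounded_linear.nonneg_bounded[OF Q(1)] by blast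
  define \<rho> where "\<rho> = max 1 \<rho>0"
  have \<rho>: "norm (Q x) \<le> \<rho> * norm x" for x
    using \<rho>0(1)[of x] mult_left_mono[of \<rho>0 \<rho> "norm x"] by (simp add: \<rho>_def mult.commute)
  obtain K1' where K1': "\<And>x. x \<in> dom A0 \<Longrightarrow> B x \<in> dom A0"
    "\<And>x. x \<in> dom A0 \<Longrightarrow> dom_norm A0 (B x) \<le> K1' * dom_norm A0 x"
    using assms(5) unfolding bounded_on_dom_def B_def by blast
  have A0_val: "A0 (Q (Q y)) = Some y" for y by (simp add: A0)
  have B_regular: "\<exists>b. B (Q (Q a)) = Q (Q b) \<and> norm b \<le> \<bar>K1'\<bar> * norm a" for a
  proof -
    have a: "Q (Q a) \<in> dom A0" using A0_val by blast
    then obtain b where b: "A0 (B (Q (Q a))) = Some b" using K1'(1) by blast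
    have "norm b \<le> K1' * norm a" using K1'(2)[OF a] by (simp add: dom_norm_def b A0_val)
    also have "\<dots> \<le> \<bar>K1'\<bar> * norm a" by (intro mult_right_mono) auto
    finally show ?thesis using b by (auto simp: A0)
  qed
  interpret Q: bounded_linear Q by (rule Q(1))
  interpret B: bounded_linear B by (rule Bbl)
  interpret S: damped_system Q B K "\<bar>K1'\<bar>" \<rho>
  proof unfold_locales
    show "B (c *\<^sub>C x) = c *\<^sub>C B x" for c x by (simp add: B_def Csc cadjoint_scaleC[OF assms(3)])
    show "0 \<le> inner (B x) x" for x by (simp add: Bform)
    show "norm (B x) \<le> K * norm x" for x using K(1)[of x] by (simp add: mult.commute)
  qed (use Q Bbl K B_regular \<rho> in \<open>auto simp: \<rho>_def\<close>)
  have A0R: "A0 x = Some y \<longleftrightarrow> x = S.R y" for x y by (simp add: A0 S.R_def)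
  interpret P: damped_semigroup Q B K "\<bar>K1'\<bar>" \<rho> \<i> Tp
    by unfold_locales (use generates_damped_iff[OF assms(8)[folded B_def] A0R] in simp_all)
  interpret M: damped_semigroup Q B K "\<bar>K1'\<bar>" \<rho> "- \<i>" Tm
    by unfold_locales (use generates_damped_iff[OF assms(9)[folded B_def] A0R] in simp_all)
  have orbit: "\<exists>u. u 0 = a \<and> (\<forall>t\<ge>0. norm (u t) \<le> norm a \<and>
      ((\<lambda>t. S.R (u t)) has_vector_derivative \<i> *\<^sub>C u t) (at t within {0..}))" for a
    by (rule unitary_orbit[OF S.R_bounded_linear S.R_scaleC S.R_symmetric S.R_pos S.R_inj])
  have solution: "conservative_solution A0 (S.R (u 0)) (\<lambda>t. S.R (u t))"
    if "\<And>t. t \<ge> 0 \<Longrightarrow> ((\<lambda>t. S.R (u t)) has_vector_derivative \<i> *\<^sub>C u t) (at t within {0..})" for u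
  proof -
    have "A0 (S.R (u t)) = Some (u t)" for t by (simp add: A0R)
    then show ?thesis using that by (auto simp: conservative_solution_def)
  qed
  obtain k where k: "k > 0" "\<And>z0 z. z0 \<in> dom A0 \<Longrightarrow> conservative_solution A0 z0 z \<Longrightarrow>
      k\<^sup>2 * (norm z0)\<^sup>2 \<le> integral {0..\<tau>} (\<lambda>t. (norm (C (z t)))\<^sup>2)"
    using assms(7) unfolding exactly_observable_def by blast
  have "\<exists>\<kappa>. 0 \<le> \<kappa> \<and> \<kappa> < 1 \<and> (\<forall>x. norm (Tp \<tau> x) \<le> \<kappa> * norm x)"
  proof (rule P.damped_decay[OF Cbl Bform _ \<gamma>(2) assms(6) k(1)])
    show "norm (C x) \<le> \<gamma> * norm x" for x using \<gamma>(1)[of x] by (simp add: mult.commute)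
    show "\<exists>u. u 0 = a \<and> (\<forall>t\<ge>0. ((\<lambda>t. S.R (u t)) has_vector_derivative \<i> *\<^sub>C u t) (at t within {0..}))" for a
      using orbit[of a] by blast
    fix u assume u: "\<And>t. t \<ge> 0 \<Longrightarrow> ((\<lambda>t. S.R (u t)) has_vector_derivative \<i> *\<^sub>C u t) (at t within {0..})"
    have "S.R (u 0) \<in> dom A0" using A0R by blast
    then show "k\<^sup>2 * (norm (S.R (u 0)))\<^sup>2 \<le> integral {0..\<tau>} (\<lambda>t. (norm (C (S.R (u t))))\<^sup>2)"
      using k(2) solution[OF u] by blast
  qed
  then obtain \<kappa> where \<kappa>: "0 \<le> \<kappa>" "\<kappa> < 1" "\<And>x. norm (Tp \<tau> x) \<le> \<kappa> * norm x" by blast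
  have Lbl: "bounded_linear (Tm \<tau> \<circ> Tp \<tau>)"
    unfolding o_def using assms(6)
    by (intro bounded_linear_compose[OF M.T_bounded_linear P.T_bounded_linear]) auto
  have "\<eta> \<le> \<kappa>"
    unfolding assms(10)
  proof (rule onorm_bound[OF \<kappa>(1)])
    show "norm ((Tm \<tau> \<circ> Tp \<tau>) x) \<le> \<kappa> * norm x" for x
      using order_trans[OF M.contraction \<kappa>(3)] assms(6) by simp
  qed
  then have \<eta>: "0 \<le> \<eta>" "\<eta> < 1" using \<kappa>(2) onorm_pos_le[OF Lbl] by (simp_all add: assms(10))
  interpret D: damped_pair Q B K "\<bar>K1'\<bar>" \<rho> Tp Tm \<tau> \<eta>
    by unfold_locales (use assms(6) \<eta> onorm[OF Lbl] in \<open>simp_all add: assms(10)\<close>)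
  obtain M0 h0 where M0: "M0 > 0" "h0 > 0" and approx: "\<And>\<phi> h. \<phi> \<in> dom (sqrt_operator A0) \<Longrightarrow> h \<in> {0<..<h0} \<Longrightarrow>
      norm (galerkin_proj A0 (Xh h) \<phi> - \<phi>) \<le> M0 * h powr \<theta> * dom_norm (sqrt_operator A0) \<phi>"
    using assms(13) unfolding approximation_property_def by blast
  define b where "b = \<theta> / \<bar>ln \<eta>\<bar> + 1"
  have b: "b \<ge> 0" using assms(12) by (simp add: b_def)
  define Mc where "Mc = M0 * \<rho> ^ 3 + \<rho> ^ 4 + M0 * (D.graph_const * \<rho> ^ 3) + M0 * D.consistency_const * (b * (1 + b * D.growth_const))
      + 2 * b * (\<tau> * M0 * (\<rho> * (1 + K * \<rho>\<^sup>2))) + 2 * b + 1"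
  have "Mc > 0"
    unfolding Mc_def using M0 b D.const_nonneg D.const_nonneg' S.\<rho> S.K assms(6)
    by (intro add_nonneg_pos add_nonneg_nonneg mult_nonneg_nonneg) auto
  define hs where "hs = min h0 (exp (- 1))"
  have "hs > 0" using M0 by (simp add: hs_def)
  show ?thesis
  proof (rule exI[of _ Mc], rule conjI[OF \<open>Mc > 0\<close>], rule exI[of _ hs], rule conjI[OF \<open>hs > 0\<close>],
      intro ballI allI impI, elim conjE)
    fix z0 z h yh zp zm
    assume z0: "z0 \<in> dom (A0 \<circ>\<^sub>m A0)" and z: "conservative_solution A0 z0 z" and h: "h \<in> {0<..<hs}"
      and yh: "L1_on \<tau> yh"
      and zp: "discrete_observer 1 A0 C (Xh h) \<tau> yh zp" "zp 0 = 0"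
      and zm: "discrete_observer (- 1) A0 C (Xh h) \<tau> yh zm" "zm \<tau> = zp \<tau>"
    from h have h0: "0 < h" "h < h0" "h \<le> exp (- 1)" by (auto simp: hs_def)
    obtain a where "(A0 \<circ>\<^sub>m A0) z0 = Some a" using z0 by blast
    then have norm_a: "dom_norm (A0 \<circ>\<^sub>m A0) z0 = norm a" and z0a: "z0 = S.R (S.R a)"
      by (auto simp: dom_norm_def map_comp_def A0R split: option.splits)
    obtain u where u: "u 0 = a" "\<And>t. t \<ge> 0 \<Longrightarrow> norm (u t) \<le> norm a"
      "\<And>t. t \<ge> 0 \<Longrightarrow> ((\<lambda>t. S.R (u t)) has_vector_derivative \<i> *\<^sub>C u t) (at t within {0..})"
      using orbit[of a] by blast
    have "((\<lambda>t. S.R (S.R (u t))) has_vector_derivative \<i> *\<^sub>C S.R (u t)) (at t within {0..})" if "t \<ge> 0" for t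
      using S.R.has_vector_derivative[OF u(3)[OF that]] by (simp add: S.R_scaleC)
    then have sol: "conservative_solution A0 z0 (\<lambda>t. S.R (S.R (u t)))"
      using solution[of "\<lambda>t. S.R (u t)"] by (simp add: u(1) z0a)
    have z_eq: "z t = S.R (S.R (u t))" if "t \<ge> 0" for t
      by (rule conservative_solution_unique[OF S.R_bounded_linear S.R_scaleC S.R_symmetric A0R z sol that])
    have "continuous_on {0..} z"
      unfolding continuous_on_eq_continuous_within
      using z has_vector_derivative_continuous unfolding conservative_solution_def by fastforce
    then have "continuous_on {0..\<tau>} (\<lambda>t. C (z t))"
      by (intro C.continuous_on) (auto elim: continuous_on_subset)
    then have int: "(\<lambda>t. norm (cadjoint C (C (z t) - yh t))) integrable_on {0..\<tau>}"
      by (rule integrable_norm_image_L1[OF C'bl _ yh])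
    have int': "(\<lambda>t. norm (cadjoint C (C (S.R (S.R (u t))) - yh t))) integrable_on {0..\<tau>}"
      using int by (rule integrable_eq) (simp add: z_eq)
    have int_eq: "integral {0..\<tau>} (\<lambda>t. norm (cadjoint C (C (S.R (S.R (u t))) - yh t)))
        = integral {0..\<tau>} (\<lambda>t. norm (cadjoint C (C (z t) - yh t)))"
      by (rule integral_cong) (simp add: z_eq)
    have sqrt_val: "sqrt_operator A0 (Q y) = Some y" for y by (simp add: sqrt_A0)
    have dom_sqrt: "dom (sqrt_operator A0) = range Q" using sqrt_A0 by blast
    interpret reconstruction Q B K "\<bar>K1'\<bar>" \<rho> Tp Tm \<tau> \<eta> A0 "Xh h" "M0 * h powr \<theta>"
    proof unfold_locales
      show "finite_dim_subspace (Xh h)" using assms(11)[OF h0(1)] by blast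
      show "Xh h \<subseteq> range Q" using assms(11)[OF h0(1)] dom_sqrt by blast
      show "norm (galerkin_proj A0 (Xh h) (Q y) - Q y) \<le> M0 * h powr \<theta> * norm y" for y
        using approx[of "Q y" h] h0 by (simp add: dom_sqrt dom_norm_def sqrt_val)
    qed (use sqrt_A0 M0 in auto)
    obtain n where n: "{j. real j \<le> \<theta> * (ln h / ln \<eta>)} = {..<n}" "real n \<le> b * \<bar>ln h\<bar>" "\<eta> ^ n \<le> h powr \<theta>"
      unfolding b_def by (rule truncation_index[OF h0(1,3) assms(12) \<eta>])
    have "ln h \<le> ln (exp (- 1))" using h0 by (subst ln_le_cancel_iff) auto
    then have l: "1 \<le> \<bar>ln h\<bar>" by simp
    have "norm (z0 - (\<Sum>n | real n \<le> N h. (discrete_L A0 B (Xh h) \<tau> ^^ n) (zm 0)))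
      = norm (S.R (S.R a) - (\<Sum>j<n. (discrete_L A0 B (Xh h) \<tau> ^^ j) (zm 0)))"
      by (simp only: assms(14) n(1) z0a)
    also have "\<dots> \<le> ((M0 * h powr \<theta>) * \<rho> ^ 3 + \<eta> ^ n * \<rho> ^ 4 + (M0 * h powr \<theta>) * (D.graph_const * \<rho> ^ 3)
        + (M0 * h powr \<theta>) * D.consistency_const * (real n * (1 + real n * D.growth_const))
        + 2 * real n * (\<tau> * (M0 * h powr \<theta>) * (\<rho> * (1 + K * \<rho>\<^sup>2)))) * norm a
      + 2 * real n * integral {0..\<tau>} (\<lambda>t. norm (cadjoint C (C (z t) - yh t)))"
      unfolding int_eq[symmetric]
      by (rule reconstruction_error[OF C'bl _ u zp zm int']) (simp add: B_def)
    also have "\<dots> \<le> Mc * (h powr \<theta> * \<bar>ln h\<bar>\<^sup>2 * norm a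
        + \<bar>ln h\<bar> * integral {0..\<tau>} (\<lambda>t. norm (cadjoint C (C (z t) - yh t))))"
      unfolding Mc_def using M0 b l n
      by (intro D.error_bound_rate integral_nonneg int) auto
    finally show "norm (z0 - (\<Sum>n | real n \<le> N h. (discrete_L A0 (cadjoint C \<circ> C) (Xh h) \<tau> ^^ n) (zm 0)))
         \<le> Mc * (h powr \<theta> * (ln h)\<^sup>2 * dom_norm (A0 \<circ>\<^sub>m A0) z0
                + \<bar>ln h\<bar> * integral {0..\<tau>} (\<lambda>s. norm (cadjoint C (C (z s) - yh s))))"
      by (simp add: B_def norm_a)
  qed
qed

end
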